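(* Let $1 \le a < 2$ be fixed, let $N = 2^n$ with $n$ a positive integer, and put $r = e^{-a/N}$. Let $V(r) = \sum_{i=1}^{\infty} r^{T_{i-1}} (2r)^{T_i - T_{i-1}}$ be the present value of the total gain in an infinite sequence of Petersburg games with discount factor $r$. Then, as $n \to \infty$, $2(1-r)V(r) - n$ converges in distribution to $2aU$, where $U = \int_0^\infty e^{-2at}\, dS(t)$ and $S$ is the Lévy process with $E(e^{izS(t)}) = e^{t l(z)}$, $$l(z) = \sum_{k=-\infty}^{0} 2^{-k}\left(e^{iz2^k} - 1 - iz2^k\right) + \sum_{k=1}^{\infty} 2^{-k}\left(e^{iz2^k} - 1\right), \qquad z \in \mathbb{R}.$$
   Context: $T_0 = 0$ and the increments $T_i - T_{i-1}$, $i = 1,2,\ldots$, are independent and identically distributed with $P(T_i - T_{i-1} = k) = 2^{-k}$, $k = 1,2,\ldots$ (the durations of successive Petersburg games; the $i$-th game pays $2^{T_i-T_{i-1}}$ at time $T_i$). The process $S$ starts at $S(0)=0$; equivalently $S(t)=\sum_{k\in\mathbb{Z}} 2^k Z_k(t)$, where the $Z_k$ are independent, $Z_k$ is a Poisson process of rate $2^{-k}$ for $k\ge 1$, and $Z_k$ is a Poisson process of rate $2^{-k}$ minus its mean $2^{-k}t$ for $k \le 0$. *)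

theory Defs
  imports "HOL-Probability.Probability"
begin

(* The subtraction T (Suc i) - T i is truncated subtraction on nat. Nothing is lost: the
   prescribed probabilities 2^-k, k >= 1, sum to 1, so the truncated increment is almost surely
   positive, and then it is the true one. *)
definition petersburg_times :: "'a measure \<Rightarrow> (nat \<Rightarrow> 'a \<Rightarrow> nat) \<Rightarrow> bool" where
  "petersburg_times M T \<longleftrightarrow>
     prob_space M \<and>
     (\<forall>i. T i \<in> measurable M (count_space UNIV)) \<and>
     (\<forall>\<omega>\<in>space M. T 0 \<omega> = 0) \<and>
     prob_space.indep_vars M (\<lambda>_. count_space UNIV) (\<lambda>i \<omega>. T (Suc i) \<omega> - T i \<omega>) UNIV \<and>
     (\<forall>i. \<forall>k\<ge>1. measure M {\<omega> \<in> space M. T (Suc i) \<omega> - T i \<omega> = k} = 1 / 2 ^ k)"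

(* The game with duration T (Suc i) - T i is game number i + 1. For 0 < r < 1 the series has
   nonnegative terms with finite total expectation, so it converges almost surely; on the
   exceptional null set the value of suminf is irrelevant. *)
definition petersburg_value :: "(nat \<Rightarrow> 'a \<Rightarrow> nat) \<Rightarrow> real \<Rightarrow> 'a \<Rightarrow> real" where
  "petersburg_value T r \<omega> = (\<Sum>i. r ^ T i \<omega> * (2 * r) ^ (T (Suc i) \<omega> - T i \<omega>))"

(* Only times t >= 0 matter; the values S t for t < 0 are arbitrary. *)
definition levy_process :: "'b measure \<Rightarrow> (real \<Rightarrow> 'b \<Rightarrow> real) \<Rightarrow> bool" where
  "levy_process M S \<longleftrightarrow>
     prob_space M \<and>
     (\<forall>t\<ge>0. S t \<in> borel_measurable M) \<and>
     (AE \<omega> in M. S 0 \<omega> = 0) \<and>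
     (\<forall>(t :: nat \<Rightarrow> real) m. 0 \<le> t 0 \<and> mono t \<longrightarrow>
        prob_space.indep_vars M (\<lambda>_. borel) (\<lambda>i \<omega>. S (t (Suc i)) \<omega> - S (t i) \<omega>) {..<m}) \<and>
     (\<forall>s\<ge>0. \<forall>t\<ge>0. distr M borel (\<lambda>\<omega>. S (s + t) \<omega> - S s \<omega>) = distr M borel (S t)) \<and>
     (\<forall>t\<ge>0. \<forall>\<epsilon>>0.
        ((\<lambda>s. measure M {\<omega> \<in> space M. \<epsilon> < \<bar>S s \<omega> - S t \<omega>\<bar>}) \<longlongrightarrow> 0) (at t within {0..})) \<and>
     (AE \<omega> in M. \<forall>t\<ge>0. continuous (at_right t) (\<lambda>s. S s \<omega>) \<and>
        (t > 0 \<longrightarrow> (\<exists>l. ((\<lambda>s. S s \<omega>) \<longlongrightarrow> l) (at_left t))))"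

definition petersburg_exponent :: "real \<Rightarrow> complex" where
  "petersburg_exponent z =
     (\<Sum>\<^sub>\<infinity>k\<in>{..0::int}. complex_of_real (2 powi (- k)) *
        (iexp (z * 2 powi k) - 1 - \<i> * complex_of_real (z * 2 powi k))) +
     (\<Sum>\<^sub>\<infinity>k\<in>{1::int..}. complex_of_real (2 powi (- k)) * (iexp (z * 2 powi k) - 1))"

(* The partition t 0 <= ... <= t m of [0, b] with tags \<xi> i in [t i, t (Suc i)], mesh below h. *)
definition tagged_partition ::
    "real \<Rightarrow> real \<Rightarrow> nat \<Rightarrow> (nat \<Rightarrow> real) \<Rightarrow> (nat \<Rightarrow> real) \<Rightarrow> bool" where
  "tagged_partition b h m t \<xi> \<longleftrightarrow>
     t 0 = 0 \<and> t m = b \<and> (\<forall>i<m. t i \<le> \<xi> i \<and> \<xi> i \<le> t (Suc i) \<and> t (Suc i) - t i < h)"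

(* The integral of a deterministic f over [0, b] with respect to S: the limit in probability of
   the Riemann-Stieltjes sums as the mesh tends to 0. *)
definition has_stochastic_integral ::
    "'b measure \<Rightarrow> (real \<Rightarrow> 'b \<Rightarrow> real) \<Rightarrow> (real \<Rightarrow> real) \<Rightarrow> real \<Rightarrow> ('b \<Rightarrow> real) \<Rightarrow> bool" where
  "has_stochastic_integral M S f b I \<longleftrightarrow>
     I \<in> borel_measurable M \<and>
     (\<forall>\<epsilon>>0. \<forall>\<delta>>0. \<exists>h>0. \<forall>m t \<xi>. tagged_partition b h m t \<xi> \<longrightarrow>
        measure M {\<omega> \<in> space M.
          \<epsilon> < \<bar>(\<Sum>i<m. f (\<xi> i) * (S (t (Suc i)) \<omega> - S (t i) \<omega>)) - I \<omega>\<bar>} < \<delta>)"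

(* The improper integral over [0, \<infinity>): the limit in probability of the integrals over [0, b]. *)
definition has_improper_stochastic_integral ::
    "'b measure \<Rightarrow> (real \<Rightarrow> 'b \<Rightarrow> real) \<Rightarrow> (real \<Rightarrow> real) \<Rightarrow> ('b \<Rightarrow> real) \<Rightarrow> bool" where
  "has_improper_stochastic_integral M S f U \<longleftrightarrow>
     U \<in> borel_measurable M \<and>
     (\<exists>I. (\<forall>b\<ge>0. has_stochastic_integral M S f b (I b)) \<and>
        (\<forall>\<epsilon>>0. ((\<lambda>b. measure M {\<omega> \<in> space M. \<epsilon> < \<bar>I b \<omega> - U \<omega>\<bar>}) \<longlongrightarrow> 0) at_top))"

end

(* Both limits are computed through characteristic functions. Let X be a game duration, N = 2^n and
   lambda_n(w) = N E(exp(i w 2^X / N) - 1), so that lambda_n(w) - i n w differs from the exponent l(w)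
   of S by at most w^2 / N.

   The partial gains are followed step by step. With G(s) = exp(integral over [s, oo) of
   lambda_n(2 a z e^(-2at)) dt), the quantity E(exp(i z 2(1-r) V_m) G(T_m / 2N)) starts at G(0) for
   m = 0 and tends to E exp(i z 2(1-r) V(r)) as m -> oo. Conditioning on the first m games and
   expanding to first order (E X = 2 makes the main terms cancel), the m-th step changes it by
   O(N^(-3/2) e^(-3m/4N)), so the total change is O(N^(-1/2)).

   On the other side, regulated paths have convergent Riemann-Stieltjes sums, which gives the
   integrals over [0, b]; the increment of such an integral over [b, b'] has characteristic function
   exp(integral of l(z e^(-2at)) over [b, b']), whence they are Cauchy in probability and the limit U
   has characteristic function exp(integral of l(z e^(-2at)) over [0, oo)). *)
theory Submission
  imports Defs
begin

subsection \<open>The characteristic exponent of a single game\<close>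

text \<open>Two obstacles shape the estimates. The gain 2^X of a game has no mean, so a bound that
  is Lipschitz in the gain does not survive averaging. And X enters twice, as the size of the gain
  and as the time that discounts all later gains, so the discounted gains are not independent. Time
  is therefore measured by s = T/2N: there r^T is exactly exp(-2as), and as a game lasts 2 on
  average, about N games fill one unit of s. G(s) is the characteristic function that the gains
  after s would have if they came from a compound Poisson process with N games per unit of s;
  exchanging this prediction for actual games one at a time is an argument of Lindeberg type. N
  being a power of 2 puts the jumps 2^X/N on the lattice of jumps of S, which is why a single limit
  law appears. On the side of S, the paths have infinite variation, since jumps 2^k occur at rate
  2^-k for every k <= 0. The integrals exist because the integrand is smooth and takes the
  derivative in an integration by parts.\<close>

lemma iexp_diff_le: "norm (iexp x - iexp y) \<le> \<bar>x - y\<bar>"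
proof -
  have "iexp x - iexp y = iexp y * (iexp (x - y) - 1)"
    by (simp add: algebra_simps flip: exp_add)
  then have "norm (iexp x - iexp y) = norm (iexp (x - y) - 1)"
    by (simp add: norm_mult)
  also have "\<dots> \<le> \<bar>x - y\<bar>"
    using iexp_approx1[of "x - y" 0] by simp
  finally show ?thesis .
qed

text \<open>Interpolation between the Lipschitz bound, for close arguments, and the trivial bound 2.
  An order below 1 is what can be averaged over 2^X.\<close>

lemma iexp_diff_le_powr: "norm (iexp x - iexp y) \<le> 2 * \<bar>x - y\<bar> powr (3/4)"
proof (cases "\<bar>x - y\<bar> \<le> 1")
  case True
  have "\<bar>x - y\<bar> = \<bar>x - y\<bar> powr 1" by simp
  also have "\<dots> \<le> \<bar>x - y\<bar> powr (3/4)"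
    using powr_mono'[of "3/4" 1 "\<bar>x - y\<bar>"] True by simp
  finally show ?thesis using iexp_diff_le[of x y] by (smt (verit) powr_ge_zero)
next
  case False
  have "norm (iexp x - iexp y) \<le> norm (iexp x) + norm (iexp y)" by (rule norm_triangle_ineq4)
  also have "\<dots> = 2" by simp
  also have "\<dots> \<le> 2 * \<bar>x - y\<bar> powr (3/4)"
    using False by (simp add: ge_one_powr_ge_zero)
  finally show ?thesis .
qed

lemma iexp_second_order: "norm (iexp x - 1 - \<i> * complex_of_real x) \<le> x\<^sup>2 / 2"
  using iexp_approx1[of x 1] by (simp add: power2_eq_square algebra_simps)

text \<open>The closed left half-plane is convex and |exp| is at most 1 on it, so the Taylor
  remainders have absolute constants. The exponents compared below lie there, being exponents of
  characteristic functions.\<close>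

lemma exp_taylor_left_half_plane:
  fixes u v :: complex
  assumes "Re u \<le> 0" "Re v \<le> 0"
  shows "norm (exp v - exp u) \<le> norm (v - u)"
    and "norm (exp v - exp u - exp u * (v - u)) \<le> (norm (v - u))\<^sup>2"
proof -
  have S: "convex {z. Re z \<le> 0}" by (rule convex_halfspace_Re_le)
  show "norm (exp v - exp u) \<le> norm (v - u)"
    using field_Taylor[OF S, of 0 "\<lambda>_. exp" 1 u v] assms
    by (simp add: DERIV_exp has_field_derivative_at_within)
  show "norm (exp v - exp u - exp u * (v - u)) \<le> (norm (v - u))\<^sup>2"
    using field_Taylor[OF S, of 1 "\<lambda>_. exp" 1 u v] assms
    by (simp add: DERIV_exp has_field_derivative_at_within diff_diff_add power2_eq_square)
qed

section \<open>The law of one game duration and its moments\<close>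

definition game_length :: "nat pmf" where
  "game_length = map_pmf Suc (geometric_pmf (1/2))"

text \<open>
  Although \<^term>\<open>2 ^ X\<close> has infinite mean for a game of duration \<^term>\<open>X\<close>, its moment of order
  \<open>3/4\<close> is finite. As \<open>2 * 3/4 > 1\<close>, error bounds of that order still sum to something negligible.
\<close>

abbreviation moment_weight :: "nat \<Rightarrow> real" where
  "moment_weight k \<equiv> (real k)\<^sup>2 * (2 powr (3/4)) ^ k"

definition moment_const :: real where
  "moment_const = measure_pmf.expectation game_length moment_weight"

lemma set_game_length: "k \<in> set_pmf game_length \<longleftrightarrow> k \<ge> 1"
  by (cases k) (auto simp: game_length_def set_pmf_geometric)

lemma pmf_game_length: "pmf game_length k = (if k = 0 then 0 else 1 / 2 ^ k)"
proof (cases k)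
  case 0
  then show ?thesis using set_game_length[of 0] by (simp add: set_pmf_iff)
next
  case (Suc j)
  have "pmf game_length (Suc j) = pmf (geometric_pmf (1/2)) j"
    unfolding game_length_def by (intro pmf_map_inj') auto
  then show ?thesis using Suc by (simp add: power_one_over)
qed

lemma integrable_game_length_iff:
  fixes f :: "nat \<Rightarrow> 'b :: {banach, second_countable_topology}"
  shows "integrable (measure_pmf game_length) f \<longleftrightarrow>
    summable (\<lambda>k. norm (f (Suc k)) / 2 ^ Suc k)"
proof -
  have "integrable (measure_pmf game_length) f \<longleftrightarrow>
      integrable (count_space UNIV) (\<lambda>k. pmf game_length k *\<^sub>R f k)"
    unfolding measure_pmf_eq_density by (subst integrable_density) auto
  also have "\<dots> \<longleftrightarrow> summable (\<lambda>k. norm (pmf game_length k *\<^sub>R f k))"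
    by (rule integrable_count_space_nat_iff)
  also have "\<dots> \<longleftrightarrow> summable (\<lambda>k. norm (pmf game_length (Suc k) *\<^sub>R f (Suc k)))"
    by (rule summable_Suc_iff[symmetric])
  finally show ?thesis by (simp add: pmf_game_length)
qed

lemma expectation_game_length:
  fixes f :: "nat \<Rightarrow> 'b :: {banach, second_countable_topology}"
  assumes "integrable (measure_pmf game_length) f"
  shows "measure_pmf.expectation game_length f = (\<Sum>k. (1 / 2 ^ Suc k) *\<^sub>R f (Suc k))"
proof -
  have *: "integrable (count_space UNIV) (\<lambda>k. pmf game_length k *\<^sub>R f k)"
    using assms unfolding measure_pmf_eq_density by (subst (asm) integrable_density) auto
  have "measure_pmf.expectation game_length f = (\<integral>k. pmf game_length k *\<^sub>R f k \<partial>count_space UNIV)"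
    unfolding measure_pmf_eq_density by (subst integral_density) auto
  also have "\<dots> = (\<Sum>k. pmf game_length k *\<^sub>R f k)"
    using * by (rule integral_count_space_nat)
  also have "\<dots> = (\<Sum>k. pmf game_length (Suc k) *\<^sub>R f (Suc k))"
    using suminf_split_initial_segment[of "\<lambda>k. pmf game_length k *\<^sub>R f k" 1] *
    by (simp add: integrable_count_space_nat_iff summable_norm_cancel pmf_game_length)
  finally show ?thesis by (simp add: pmf_game_length)
qed

lemma expectation_game_length_ident: "measure_pmf.expectation game_length real = 2"
  and integrable_game_length_ident: "integrable (measure_pmf game_length) real"
proof -
  have s: "(\<lambda>k. real (Suc k) / 2 ^ Suc k) sums 2"
    using sums_mult[OF geometric_deriv_sums[of "1/2::real"], of "1/2"]
    by (simp add: power_one_over power2_eq_square field_simps)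
  show i: "integrable (measure_pmf game_length) real"
    using s by (simp add: integrable_game_length_iff sums_iff)
  show "measure_pmf.expectation game_length real = 2"
    using s by (subst expectation_game_length[OF i]) (simp add: sums_iff)
qed

lemma integrable_moment_weight: "integrable (measure_pmf game_length) moment_weight"
proof -
  \<comment> \<open>As 1.7^4 > 8, the quotient 2^(3/4) / 2 is below 0.85; from k = 20 on, ((k + 1) /
    k)^2 is at most (21/20)^2 = 1.1025, and 0.85 * 1.1025 < 0.95.\<close>
  have "(2 powr (3/4)) ^ 4 = (8::real)"
    by (simp add: powr_power)
  then have "(2 powr (3/4)) ^ 4 < (17/10 :: real) ^ 4" by (simp add: power4_eq_xxxx)
  then have c: "2 powr (3/4) < (17/10 :: real)" by (rule power_less_imp_less_base) simp
  have "summable (\<lambda>k. norm (moment_weight k) / 2 ^ k)"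
  proof (rule summable_ratio_test[where c = "95/100" and N = 20])
    fix k :: nat assume "20 \<le> k"
    then have "20 * (real k + 1) \<le> 21 * real k" by simp
    then have "(20 * (real k + 1))\<^sup>2 \<le> (21 * real k)\<^sup>2" by (intro power_mono) auto
    then have "400 * (real k + 1)\<^sup>2 \<le> 441 * (real k)\<^sup>2"
      unfolding power_mult_distrib by simp
    then have "(real k + 1)\<^sup>2 * (17/20) \<le> 95/100 * (real k)\<^sup>2"
      using zero_le_power2[of "real k"] by linarith
    moreover have "(real k + 1)\<^sup>2 * (2 powr (3/4) / 2) \<le> (real k + 1)\<^sup>2 * (17/20)"
      using c by (intro mult_left_mono) auto
    ultimately have "(real k + 1)\<^sup>2 * (2 powr (3/4) / 2) \<le> 95/100 * (real k)\<^sup>2" by linarith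
    then have "(real k + 1)\<^sup>2 * (2 powr (3/4) / 2) * ((2 powr (3/4)) ^ k / 2 ^ k)
        \<le> 95/100 * (real k)\<^sup>2 * ((2 powr (3/4)) ^ k / 2 ^ k)"
      by (intro mult_right_mono) auto
    then show "norm (norm (moment_weight (Suc k)) / 2 ^ Suc k)
        \<le> 95/100 * norm (norm (moment_weight k) / 2 ^ k)"
      by (simp add: abs_mult add.commute mult_ac)
  qed simp
  then show ?thesis
    unfolding integrable_game_length_iff
    by (subst summable_Suc_iff[of "\<lambda>k. norm (moment_weight k) / 2 ^ k"])
qed

text \<open>Domination by the weight gives integrability and the size of the mean at once; all error
  terms of a game are averaged in this way. The value at 0 is free because the law has no mass
  there.\<close>

lemma game_length_bounded:
  fixes f :: "nat \<Rightarrow> 'b :: {banach, second_countable_topology}"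
  assumes "\<And>k. 1 \<le> k \<Longrightarrow> norm (f k) \<le> B * moment_weight k"
  shows "integrable (measure_pmf game_length) f"
    and "norm (measure_pmf.expectation game_length f) \<le> B * moment_const"
proof -
  have i: "integrable (measure_pmf game_length) (\<lambda>k. B * moment_weight k)"
    using integrable_moment_weight by (rule integrable_mult_right)
  have ae: "AE k in measure_pmf game_length. norm (f k) \<le> B * moment_weight k"
    using assms by (auto simp: AE_measure_pmf_iff set_game_length)
  show "integrable (measure_pmf game_length) f"
    by (rule Bochner_Integration.integrable_bound[OF i]) (use ae in \<open>auto elim: AE_mp\<close>)
  have "norm (measure_pmf.expectation game_length f)
      \<le> measure_pmf.expectation game_length (\<lambda>k. norm (f k))"
    by (rule integral_norm_bound)
  also have "\<dots> \<le> measure_pmf.expectation game_length (\<lambda>k. B * moment_weight k)"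
    by (rule integral_mono_AE) (use ae i \<open>integrable _ f\<close> in auto)
  finally have "norm (measure_pmf.expectation game_length f)
      \<le> measure_pmf.expectation game_length (\<lambda>k. B * moment_weight k)" .
  then show "norm (measure_pmf.expectation game_length f) \<le> B * moment_const"
    by (simp add: moment_const_def)
qed

lemma moment_const_nonneg: "0 \<le> moment_const"
  unfolding moment_const_def by (rule integral_nonneg_AE) simp

text \<open>The function lambda_n of the overview: the exponent of a compound Poisson process with
  2^n jumps per unit of time, each distributed as 2^X / 2^n.\<close>

definition game_exponent :: "nat \<Rightarrow> real \<Rightarrow> complex" where
  "game_exponent n w =
     2 ^ n * measure_pmf.expectation game_length (\<lambda>k. iexp (w * 2 ^ k / 2 ^ n) - 1)"

lemma powr_scale_pow:
  fixes x :: real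
  assumes "0 \<le> x"
  shows "(x * 2 ^ k / 2 ^ n) powr (3/4)
    = x powr (3/4) * (2 ^ n) powr (- 3/4) * (2 powr (3/4)) ^ k"
proof -
  have "((2::real) ^ k) powr (3/4) = (2 powr (3/4)) ^ k"
    by (simp add: powr_power powr_powr mult.commute flip: powr_realpow)
  then show ?thesis
    using assms by (simp add: powr_mult powr_divide powr_minus divide_simps)
qed

text \<open>Three kinds of term get averaged: 2^(3k/4) from a jump, the same times k when a time
  increment or a discount error multiplies it, and k^2 from two time increments. One weight serves
  them all.\<close>

lemma moment_weight_ge:
  assumes "1 \<le> k"
  shows "(2 powr (3/4)) ^ k \<le> moment_weight k" "real k * (2 powr (3/4)) ^ k \<le> moment_weight k"
    "(real k)\<^sup>2 \<le> moment_weight k"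
proof -
  have g: "1 \<le> (2 powr (3/4) :: real) ^ k" by (intro one_le_power ge_one_powr_ge_zero) auto
  have k: "1 \<le> real k" using assms by simp
  then have k2: "real k \<le> (real k)\<^sup>2" by (simp add: power2_eq_square)
  show "real k * (2 powr (3/4)) ^ k \<le> moment_weight k"
    using k2 g by (intro mult_right_mono) auto
  show "(2 powr (3/4)) ^ k \<le> moment_weight k"
    using mult_right_mono[of 1 "(real k)\<^sup>2" "(2 powr (3/4)) ^ k"] k2 k g by simp
  show "(real k)\<^sup>2 \<le> moment_weight k"
    using mult_left_mono[of 1 "(2 powr (3/4)) ^ k" "(real k)\<^sup>2"] g by simp
qed

lemma integrable_iexp_game_length [simp]:
  "integrable (measure_pmf game_length) (\<lambda>k. iexp (f k))"
  by (rule measure_pmf.integrable_const_bound[where B = 1]) auto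

text \<open>The Hoelder constant N * N^(-3/4) = N^(1/4) grows with N. In the one-step estimate this
  is affordable, because there the exponent is integrated over a time of order k / N only.\<close>

lemma game_exponent_diff:
  "norm (game_exponent n w - game_exponent n w')
    \<le> 2 * moment_const * (2 ^ n) powr (1/4) * \<bar>w - w'\<bar> powr (3/4)"
proof -
  let ?B = "2 * \<bar>w - w'\<bar> powr (3/4) * (2 ^ n) powr (- 3/4)"
  have b: "norm (iexp (w * 2 ^ k / 2 ^ n) - iexp (w' * 2 ^ k / 2 ^ n)) \<le> ?B * moment_weight k"
    if "1 \<le> k" for k
  proof -
    have "\<bar>w * 2 ^ k / 2 ^ n - w' * 2 ^ k / 2 ^ n\<bar> = \<bar>w - w'\<bar> * 2 ^ k / 2 ^ n"
      by (simp add: abs_mult flip: diff_divide_distrib left_diff_distrib)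
    then have "norm (iexp (w * 2 ^ k / 2 ^ n) - iexp (w' * 2 ^ k / 2 ^ n))
        \<le> 2 * (\<bar>w - w'\<bar> * 2 ^ k / 2 ^ n) powr (3/4)"
      using iexp_diff_le_powr[of "w * 2 ^ k / 2 ^ n" "w' * 2 ^ k / 2 ^ n"] by simp
    also have "\<dots> = ?B * (2 powr (3/4)) ^ k" by (subst powr_scale_pow) auto
    also have "\<dots> \<le> ?B * moment_weight k"
      using moment_weight_ge(1)[OF that] by (intro mult_left_mono) auto
    finally show ?thesis .
  qed
  have "game_exponent n w - game_exponent n w' = 2 ^ n *
      measure_pmf.expectation game_length (\<lambda>k. iexp (w * 2 ^ k / 2 ^ n) - iexp (w' * 2 ^ k / 2 ^ n))"
    unfolding game_exponent_def right_diff_distrib[symmetric]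
    by (subst Bochner_Integration.integral_diff[symmetric],
        (intro Bochner_Integration.integrable_diff integrable_iexp_game_length measure_pmf.integrable_const)+, simp)
  then have "norm (game_exponent n w - game_exponent n w') \<le> 2 ^ n * (?B * moment_const)"
    using game_length_bounded(2)[OF b] by (simp add: norm_mult norm_power)
  also have "\<dots> = 2 * moment_const * (2 ^ n * (2 ^ n) powr (- 3/4)) * \<bar>w - w'\<bar> powr (3/4)" by simp
  also have "2 ^ n * (2 ^ n) powr (- 3/4) = (2 ^ n :: real) powr (1/4)"
    using powr_add[of "2 ^ n :: real" 1 "- 3/4"] by simp
  finally show ?thesis .
qed

lemma game_exponent_0 [simp]: "game_exponent n 0 = 0"
  by (simp add: game_exponent_def)

lemma game_exponent_bound:
  "norm (game_exponent n w) \<le> 2 * moment_const * (2 ^ n) powr (1/4) * \<bar>w\<bar> powr (3/4)"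
  using game_exponent_diff[of n w 0] by simp

lemma scaleR_power_two: "(2 ^ n) *\<^sub>R (z :: complex) = 2 ^ n * z"
  by (simp add: scaleR_conv_of_real)

text \<open>Re (exp(ix) - 1) = cos x - 1 is nonpositive. This places the exponents in the half-plane
  where exp is 1-Lipschitz.\<close>

lemma Re_game_exponent: "Re (game_exponent n w) \<le> 0"
proof -
  have "Re (game_exponent n w) = 2 ^ n *
      measure_pmf.expectation game_length (\<lambda>k. Re (iexp (w * 2 ^ k / 2 ^ n) - 1))"
    by (subst integral_Re,
        intro Bochner_Integration.integrable_diff integrable_iexp_game_length measure_pmf.integrable_const)
      (simp only: game_exponent_def scaleR_complex.simps flip: scaleR_power_two)
  moreover have "0 \<le> measure_pmf.expectation game_length (\<lambda>k. - Re (iexp (w * 2 ^ k / 2 ^ n) - 1))"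
    by (rule integral_nonneg_AE) (simp add: Re_exp)
  then have "measure_pmf.expectation game_length (\<lambda>k. Re (iexp (w * 2 ^ k / 2 ^ n) - 1)) \<le> 0"
    by (simp only: Bochner_Integration.integral_minus neg_0_le_iff_le)
  ultimately show ?thesis by (simp only: mult_le_0_iff) simp
qed

lemma isCont_game_exponent: "isCont (game_exponent n) w"
proof -
  let ?C = "2 * moment_const * (2 ^ n) powr (1/4)"
  have "((\<lambda>w'. ?C * \<bar>w' - w\<bar> powr (3/4)) \<longlongrightarrow> ?C * \<bar>w - w\<bar> powr (3/4)) (at w)"
    by (intro tendsto_intros tendsto_powr') auto
  then have "((\<lambda>w'. ?C * \<bar>w' - w\<bar> powr (3/4)) \<longlongrightarrow> 0) (at w)" by simp
  then have "((\<lambda>w'. game_exponent n w' - game_exponent n w) \<longlongrightarrow> 0) (at w)"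
    by (rule Lim_null_comparison[rotated]) (use game_exponent_diff in \<open>auto intro!: always_eventually\<close>)
  then show ?thesis
    unfolding isCont_def by (simp add: LIM_zero_iff)
qed

lemma has_sum_powi_atMost: "((\<lambda>k::int. (2::real) powi k) has_sum 2 * 2 powi m) {..m}"
proof -
  have im: "{..m} = (\<lambda>j. m - int j) ` UNIV"
  proof (intro set_eqI iffI)
    fix k assume "k \<in> {..m}"
    then have "k = m - int (nat (m - k))" by simp
    then show "k \<in> (\<lambda>j. m - int j) ` UNIV" by blast
  qed auto
  have s: "(\<lambda>j. 2 powi m * (1/2) ^ j) sums (2 powi m * (1 / (1 - 1/2 :: real)))"
    by (intro sums_mult geometric_sums) auto
  have "((\<lambda>j. 2 powi m * (1/2) ^ j) has_sum (2 * 2 powi m :: real)) (UNIV :: nat set)"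
    using s by (intro norm_summable_imp_has_sum) (auto simp: sums_iff mult.commute)
  moreover have "(\<lambda>k. (2::real) powi k) \<circ> (\<lambda>j. m - int j) = (\<lambda>j. 2 powi m * (1/2) ^ j)"
    by (auto simp: power_int_diff power_one_over divide_simps)
  ultimately show ?thesis
    unfolding im by (subst has_sum_reindex) (auto simp: inj_on_def)
qed

text \<open>With N = 2^n a game of length j + 1 gives the jump 2^k, k = j + 1 - n, and its rate N *
  2^-(j + 1) is 2^-k. So the exponents for all n are sections of one series over the integers, which
  differ only in where they start.\<close>

lemma has_sum_game_exponent:
  "((\<lambda>k. complex_of_real (2 powi (- k)) * (iexp (w * 2 powi k) - 1)) has_sum game_exponent n w)
     {1 - int n..}"
proof -
  let ?u = "\<lambda>k::int. complex_of_real (2 powi (- k)) * (iexp (w * 2 powi k) - 1)"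
  let ?v = "\<lambda>j. (1 / 2 ^ Suc j) *\<^sub>R (iexp (w * 2 ^ Suc j / 2 ^ n) - 1)"
  have im: "{1 - int n..} = (\<lambda>j. 1 - int n + int j) ` UNIV"
  proof (intro set_eqI iffI)
    fix k assume "k \<in> {1 - int n..}"
    then have "k = 1 - int n + int (nat (k - (1 - int n)))" by simp
    then show "k \<in> (\<lambda>j. 1 - int n + int j) ` UNIV" by blast
  qed auto
  have i: "integrable (measure_pmf game_length) (\<lambda>k. iexp (w * 2 ^ k / 2 ^ n) - 1)"
    by (intro Bochner_Integration.integrable_diff integrable_iexp_game_length) simp
  have s: "summable (\<lambda>j. norm (?v j))"
    using i unfolding integrable_game_length_iff norm_scaleR by simp
  have "(?v has_sum (\<Sum>j. ?v j)) UNIV"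
    by (rule norm_summable_imp_has_sum[OF s summable_sums[OF summable_norm_cancel[OF s]]])
  then have "(?v has_sum measure_pmf.expectation game_length (\<lambda>k. iexp (w * 2 ^ k / 2 ^ n) - 1)) UNIV"
    by (simp only: expectation_game_length[OF i])
  then have h: "((\<lambda>j. 2 ^ n * ?v j) has_sum game_exponent n w) UNIV"
    unfolding game_exponent_def by (rule has_sum_cmult_right)
  have p: "2 powi (1 - int n + int j) = (2 ^ Suc j / 2 ^ n :: real)" for j
    by (simp add: power_int_diff power_int_add)
  have c: "complex_of_real (inverse (2 ^ Suc j / 2 ^ n)) * x = 2 ^ n * ((1 / 2 ^ Suc j) *\<^sub>R x)" for j x
    by (simp add: scaleR_conv_of_real)
  have comp: "?u \<circ> (\<lambda>j. 1 - int n + int j) = (\<lambda>j. 2 ^ n * ?v j)"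
    by (rule ext) (simp only: comp_def power_int_minus p c times_divide_eq_right)
  have inj: "inj (\<lambda>j. 1 - int n + int j)" by (simp add: inj_on_def)
  show ?thesis
    unfolding im has_sum_reindex[OF inj] comp by (rule h)
qed

text \<open>The compensator of each k in 1 - n, ..., 0 is 2^-k * i w 2^k = i w, and there are n of
  them: this is the origin of the centring by n. What is missing is the compensated tail k \<le> -
  n, whose terms are at most w^2 / 2 * 2^k and add up to w^2 / 2^n.\<close>

lemma game_exponent_approx:
  "norm (game_exponent n w - \<i> * complex_of_real (n * w) - petersburg_exponent w) \<le> w\<^sup>2 / 2 ^ n"
proof -
  define u where "u = (\<lambda>k::int. complex_of_real (2 powi (- k)) * (iexp (w * 2 powi k) - 1))"
  define v where "v = (\<lambda>k::int. complex_of_real (2 powi (- k)) *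
        (iexp (w * 2 powi k) - 1 - \<i> * complex_of_real (w * 2 powi k)))"
  have vu: "v k = u k - \<i> * complex_of_real w" for k
    by (simp add: v_def u_def algebra_simps power_int_minus)
  have vb: "norm (v k) \<le> w\<^sup>2 / 2 * 2 powi k" for k
  proof -
    have "norm (v k) = 2 powi (- k) *
        norm (iexp (w * 2 powi k) - 1 - \<i> * complex_of_real (w * 2 powi k))"
      unfolding v_def norm_mult norm_of_real by simp
    also have "\<dots> \<le> 2 powi (- k) * ((w * 2 powi k)\<^sup>2 / 2)"
      using iexp_second_order[of "w * 2 powi k"] by (rule mult_left_mono) simp
    also have "\<dots> = w\<^sup>2 / 2 * 2 powi k"
      by (simp add: power_int_minus power2_eq_square field_simps)
    finally show ?thesis .
  qed
  have bs: "((\<lambda>k. w\<^sup>2 / 2 * 2 powi k) has_sum w\<^sup>2 / 2 * (2 * 2 powi m)) {..m}" for m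
    by (intro has_sum_cmult_right has_sum_powi_atMost)
  have vs: "v summable_on {..m}" for m
  proof (rule abs_summable_summable)
    show "(\<lambda>k. norm (v k)) summable_on {..m}"
      by (rule summable_on_comparison_test[OF has_sum_imp_summable[OF bs[of m]]]) (use vb in auto)
  qed
  have tail: "norm (infsum v {..- int n}) \<le> w\<^sup>2 / 2 ^ n"
  proof -
    have "norm (infsum v {..- int n}) \<le> w\<^sup>2 / 2 * (2 * 2 powi (- int n))"
      by (rule norm_infsum_le[OF has_sum_infsum[OF vs] bs]) (use vb in auto)
    also have "\<dots> = w\<^sup>2 / 2 ^ n" by (simp add: power_int_minus divide_simps)
    finally show ?thesis .
  qed
  \<comment> \<open>For n = 0 the series starts at k = 1, so \<open>game_exponent 0\<close> is
    exactly the uncompensated half of \<open>petersburg_exponent\<close>.\<close>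
  have "(u has_sum (\<Sum>k\<in>{1 - int n..0}. u k) + game_exponent 0 w) ({1 - int n..0} \<union> {1..})"
    using has_sum_game_exponent[of w 0]
    by (intro has_sum_Un_disjoint has_sum_finite) (auto simp: u_def)
  also have "{1 - int n..0} \<union> {1..} = {1 - int n..}" by auto
  finally have g: "game_exponent n w = (\<Sum>k\<in>{1 - int n..0}. u k) + game_exponent 0 w"
    using has_sum_game_exponent[of w n] unfolding u_def by (rule has_sum_unique[rotated])
  have "infsum v {..0} = infsum v ({..- int n} \<union> {1 - int n..0})"
    by (rule arg_cong[where f = "infsum v"]) auto
  also have "\<dots> = infsum v {..- int n} + (\<Sum>k\<in>{1 - int n..0}. v k)"
    by (subst infsum_Un_disjoint) (use vs in auto)
  also have "(\<Sum>k\<in>{1 - int n..0}. v k) = (\<Sum>k\<in>{1 - int n..0}. u k) - \<i> * complex_of_real (n * w)"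
    by (simp add: vu sum_subtractf)
  finally have "infsum v {..0} = infsum v {..- int n} + ((\<Sum>k\<in>{1 - int n..0}. u k) - \<i> * complex_of_real (n * w))" .
  moreover have "infsum u {1..} = game_exponent 0 w"
    using has_sum_game_exponent[of w 0] by (intro infsumI) (simp add: u_def)
  moreover have "petersburg_exponent w = infsum v {..0} + infsum u {1..}"
    unfolding petersburg_exponent_def u_def v_def by simp
  ultimately have "game_exponent n w - \<i> * complex_of_real (n * w) - petersburg_exponent w
      = - infsum v {..- int n}"
    using g by simp
  then show ?thesis using tail by simp
qed

lemma petersburg_exponent_0 [simp]: "petersburg_exponent 0 = 0"
  using game_exponent_approx[of 0 0] by simp

lemma petersburg_exponent_bound:
  "norm (petersburg_exponent w) \<le> 2 * moment_const * \<bar>w\<bar> powr (3/4) + w\<^sup>2"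
proof -
  have "norm (petersburg_exponent w)
      \<le> norm (game_exponent 0 w) + norm (game_exponent 0 w - petersburg_exponent w)"
    by (metis add.commute norm_minus_commute norm_triangle_sub)
  then show ?thesis
    using game_exponent_approx[of 0 w] game_exponent_bound[of 0 w] by simp
qed

text \<open>The correction i n w is imaginary, so the sign passes from \<open>game_exponent\<close>
  to the limit.\<close>

lemma Re_petersburg_exponent: "Re (petersburg_exponent w) \<le> 0"
proof (rule LIMSEQ_le_const)
  show "(\<lambda>n. w\<^sup>2 * (1/2) ^ n) \<longlonglongrightarrow> 0"
    by (intro tendsto_mult_right_zero LIMSEQ_realpow_zero) auto
  have "Re (petersburg_exponent w) \<le> w\<^sup>2 * (1/2) ^ n" for n
  proof -
    have "Re (petersburg_exponent w) = Re (game_exponent n w)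
        - Re (game_exponent n w - \<i> * complex_of_real (n * w) - petersburg_exponent w)"
      by simp
    also have "\<dots> \<le> 0 + w\<^sup>2 / 2 ^ n"
      using Re_game_exponent[of n w] game_exponent_approx[of n w]
        abs_Re_le_cmod[of "game_exponent n w - \<i> * complex_of_real (n * w) - petersburg_exponent w"]
      by linarith
    finally show ?thesis by (simp add: power_one_over divide_simps)
  qed
  then show "\<exists>N. \<forall>n\<ge>N. Re (petersburg_exponent w) \<le> w\<^sup>2 * (1/2) ^ n" by blast
qed

text \<open>The error w^2 / 2^n is uniform on bounded sets, so continuity is inherited from the
  Hoelder continuous \<open>game_exponent\<close>.\<close>

lemma continuous_on_petersburg_exponent: "continuous_on UNIV petersburg_exponent"
proof -
  have "continuous_on {-B..B} petersburg_exponent" for B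
  proof (rule uniform_limit_theorem)
    show "\<forall>\<^sub>F n in sequentially. continuous_on {-B..B} (\<lambda>w. game_exponent n w - \<i> * complex_of_real (n * w))"
      by (intro always_eventually allI continuous_intros continuous_at_imp_continuous_on)
        (auto intro: isCont_game_exponent)
    show "uniform_limit {-B..B} (\<lambda>n w. game_exponent n w - \<i> * complex_of_real (n * w))
        petersburg_exponent sequentially"
    proof (rule uniform_limitI)
      fix e :: real assume "0 < e"
      have "(\<lambda>n. B\<^sup>2 * (1/2) ^ n) \<longlonglongrightarrow> 0"
        by (intro tendsto_mult_right_zero LIMSEQ_realpow_zero) auto
      then have "\<forall>\<^sub>F n in sequentially. B\<^sup>2 * (1/2) ^ n < e"
        using \<open>0 < e\<close> by (rule order_tendstoD)
      then show "\<forall>\<^sub>F n in sequentially. \<forall>w\<in>{-B..B}.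
          dist (game_exponent n w - \<i> * complex_of_real (n * w)) (petersburg_exponent w) < e"
      proof eventually_elim
        case (elim n)
        show ?case
        proof
          fix w assume "w \<in> {-B..B}"
          then have "w\<^sup>2 \<le> B\<^sup>2" by (intro abs_le_square_iff[THEN iffD1]) auto
          then have "w\<^sup>2 / 2 ^ n \<le> B\<^sup>2 / 2 ^ n" by (rule divide_right_mono) simp
          also have "\<dots> < e" using elim by (simp add: power_one_over)
          finally show "dist (game_exponent n w - \<i> * complex_of_real (n * w)) (petersburg_exponent w) < e"
            using game_exponent_approx[of n w] by (simp add: dist_norm)
        qed
      qed
    qed
  qed simp
  then have "isCont petersburg_exponent w" for w
    by (rule continuous_on_interior[of "{- (\<bar>w\<bar> + 1)..\<bar>w\<bar> + 1}"]) auto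
  then show ?thesis by (simp add: continuous_at_imp_continuous_on)
qed

subsection \<open>One step of the discounted game\<close>

lemma exp_decay_integral:
  fixes f :: "real \<Rightarrow> complex"
  assumes cont: "continuous_on {0..} f" and bd: "\<And>t. 0 \<le> t \<Longrightarrow> norm (f t) \<le> K * exp (- \<alpha> * t)"
    and "0 < \<alpha>" "0 \<le> s"
  shows exp_decay_integrable: "f integrable_on {s..}"
    and norm_exp_decay_integral: "norm (integral {s..} f) \<le> K * (exp (- \<alpha> * s) / \<alpha>)"
proof -
  have e: "((\<lambda>t. K * exp (- \<alpha> * t)) has_integral K * (exp (- \<alpha> * s) / \<alpha>)) {s..}"
    using has_integral_exp_minus_to_infinity[OF \<open>0 < \<alpha>\<close>, of s] by (rule has_integral_mult_right)
  show i: "f integrable_on {s..}"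
  proof (rule measurable_bounded_by_integrable_imp_integrable)
    have "continuous_on {s..} f" by (rule continuous_on_subset[OF cont]) (use \<open>0 \<le> s\<close> in auto)
    then show "f \<in> borel_measurable (lebesgue_on {s..})"
      by (rule continuous_imp_measurable_on_sets_lebesgue) simp
  qed (use e bd \<open>0 \<le> s\<close> in \<open>auto simp: integrable_on_def\<close>)
  show "norm (integral {s..} f) \<le> K * (exp (- \<alpha> * s) / \<alpha>)"
    using integral_norm_bound_integral[OF i has_integral_integrable[OF e]] bd \<open>0 \<le> s\<close>
    unfolding integral_unique[OF e] by auto
qed

lemma integral_atLeast_split:
  fixes f :: "real \<Rightarrow> complex"
  assumes "f integrable_on {s..u}" "f integrable_on {u..}" "s \<le> u"
  shows "integral {s..} f = integral {s..u} f + integral {u..} f"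
proof -
  have "(f has_integral integral {s..u} f + integral {u..} f) ({s..u} \<union> {u..})"
  proof (rule has_integral_Un)
    have "{s..u} \<inter> {u..} = {u}" using assms by auto
    then show "negligible ({s..u} \<inter> {u..})" by simp
  qed (use assms in \<open>auto simp: integrable_integral\<close>)
  moreover have "{s..u} \<union> {u..} = {s..}" using assms by auto
  ultimately show ?thesis by (simp add: integral_unique)
qed

lemma Re_integral_nonpos:
  fixes f :: "real \<Rightarrow> complex"
  assumes "\<And>t. t \<in> S \<Longrightarrow> Re (f t) \<le> 0"
  shows "Re (integral S f) \<le> 0"
proof (cases "f integrable_on S")
  case True
  then have "((\<lambda>t. Re (f t)) has_integral Re (integral S f)) S"
    by (intro has_integral_Re integrable_integral)
  from has_integral_neg[OF this] have "0 \<le> - Re (integral S f)"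
    by (rule has_integral_nonneg) (use assms in auto)
  then show ?thesis by simp
\<comment> \<open>A non-integrable function has integral 0 by convention, which satisfies the
  bound.\<close>
qed (simp add: not_integrable_integral)

text \<open>To be used at x = a / N, where exp (- x) = r. It compares at once 1 - r with a / N and
  the discount r^k within the game with 1. The product lies between x * exp (- (k + 1) x) and x, and
  k + 1 \<le> 2 k.\<close>

lemma discount_error:
  assumes "0 \<le> x" "1 \<le> k"
  shows "\<bar>(1 - exp (- x)) * exp (- x) ^ k - x\<bar> \<le> 2 * real k * x\<^sup>2"
proof -
  have ek: "exp (- x) ^ k = exp (- (real k * x))"
    by (simp flip: exp_of_nat_mult)
  have "x * exp (- x) \<le> 1 - exp (- x)"
    using exp_ge_add_one_self[of x] by (simp add: exp_minus field_simps)
  then have "x * exp (- x) * exp (- (real k * x)) \<le> (1 - exp (- x)) * exp (- (real k * x))"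
    by (rule mult_right_mono) simp
  moreover have "exp (- x) * exp (- (real k * x)) = exp (- ((real k + 1) * x))"
    by (simp add: algebra_simps flip: exp_add)
  moreover have "x * (1 - (real k + 1) * x) \<le> x * exp (- ((real k + 1) * x))"
    using exp_ge_add_one_self[of "- ((real k + 1) * x)"] assms by (intro mult_left_mono) auto
  ultimately have "x - (real k + 1) * x\<^sup>2 \<le> (1 - exp (- x)) * exp (- (real k * x))"
    by (simp add: algebra_simps power2_eq_square)
  moreover have "(real k + 1) * x\<^sup>2 \<le> 2 * real k * x\<^sup>2"
    using assms by (intro mult_right_mono) auto
  moreover have "(1 - exp (- x)) * exp (- (real k * x)) \<le> x * 1"
    using exp_ge_add_one_self[of "- x"] assms by (intro mult_mono) auto
  ultimately show ?thesis unfolding ek by (auto simp: abs_if)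
qed

text \<open>At time s = T / 2N a game of length k adds 2 (1 - r) r^T (2 r)^k, about 2 a exp (- 2 a
  s) * 2^k / N; hence the argument of \<open>game_exponent\<close>.\<close>

definition discounted_exponent :: "nat \<Rightarrow> real \<Rightarrow> real \<Rightarrow> real \<Rightarrow> complex" where
  "discounted_exponent n a z t = game_exponent n (2 * a * z * exp (- 2 * a * t))"

text \<open>The function G of the overview, the predicted characteristic function of the gains still
  to come after time s.\<close>

definition tail_char :: "nat \<Rightarrow> real \<Rightarrow> real \<Rightarrow> real \<Rightarrow> complex" where
  "tail_char n a z s = exp (integral {s..} (discounted_exponent n a z))"

text \<open>Gives up c^(3/4) for c, so that only integer powers of k meet the weight.\<close>

lemma powr_three_quarters_le:
  fixes c x :: real
  assumes "1 \<le> c" "0 \<le> x"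
  shows "(c * x) powr (3/4) \<le> c * x powr (3/4)"
proof -
  have "c powr (3/4) \<le> c powr 1" using assms by (intro powr_mono) auto
  then show ?thesis using assms by (simp add: powr_mult mult_right_mono)
qed

lemma continuous_on_discounted_exponent: "continuous_on S (discounted_exponent n a z)"
proof -
  have "continuous_on UNIV (game_exponent n)"
    by (simp add: continuous_at_imp_continuous_on isCont_game_exponent)
  then have "continuous_on S (\<lambda>t. game_exponent n (2 * a * z * exp (- 2 * a * t)))"
    by (rule continuous_on_compose2) (auto intro!: continuous_intros)
  then show ?thesis
    by (simp add: discounted_exponent_def[abs_def])
qed

text \<open>A bound of order 3/4 turns the decay exp (- 2 a t) into exp (- (3/2) a t). This is fast
  enough for integrals up to infinity.\<close>

lemma discounted_exponent_bound:
  "norm (discounted_exponent n a z t)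
    \<le> 2 * moment_const * (2 ^ n) powr (1/4) * \<bar>2 * a * z\<bar> powr (3/4) * exp (- (3/2 * a) * t)"
proof -
  have "\<bar>2 * a * z * exp (- 2 * a * t)\<bar> powr (3/4) = \<bar>2 * a * z\<bar> powr (3/4) * exp (- (3/2 * a) * t)"
    by (simp add: abs_mult powr_mult powr_def[of "exp _"])
  then show ?thesis
    using game_exponent_bound[of n "2 * a * z * exp (- 2 * a * t)"]
    unfolding discounted_exponent_def by (simp only: mult.assoc)
qed

lemma discounted_exponent_integrable:
  assumes "0 < a" "0 \<le> s"
  shows "discounted_exponent n a z integrable_on {s..}"
  by (rule exp_decay_integrable[OF continuous_on_discounted_exponent discounted_exponent_bound])
    (use assms in auto)

lemma Re_discounted_exponent: "Re (discounted_exponent n a z t) \<le> 0"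
  unfolding discounted_exponent_def by (rule Re_game_exponent)

lemma norm_tail_char_le_1: "norm (tail_char n a z s) \<le> 1"
  using Re_integral_nonpos[of "{s..}" "discounted_exponent n a z"] Re_discounted_exponent
  by (simp add: tail_char_def)

text \<open>A game of length k multiplies by \<open>iexp (Y k)\<close> and shortens the tail
  exponent by \<open>\<Lambda> k\<close>. With M = N^(-3/4) and W = |w|^(3/4) both effects have
  order M W. Their means agree to first order, and every remaining term carries the factor M^2 =
  N^(-3/2).\<close>

lemma one_step_bound:
  fixes n :: nat and a z s :: real
  defines "N \<equiv> 2 ^ n :: real"
  defines "r \<equiv> exp (- a / N)" and "w \<equiv> 2 * a * z * exp (- 2 * a * s)"
  assumes a: "1 \<le> a" "a < 2" and s: "0 \<le> s"
  shows "norm (measure_pmf.expectation game_length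
      (\<lambda>k. iexp (z * (2 * (1 - r)) * exp (- 2 * a * s) * (2 * r) ^ k) * tail_char n a z (s + k / (2 * N)))
      - tail_char n a z s)
    \<le> (8 * moment_const + 2 * moment_const\<^sup>2 + moment_const ^ 3) *
      (N powr (- 3/4))\<^sup>2 * (\<bar>w\<bar> powr (3/4) + (\<bar>w\<bar> powr (3/4))\<^sup>2)"
proof -
  define M where "M = N powr (- 3/4)"
  define W where "W = \<bar>w\<bar> powr (3/4)"
  define h where "h = discounted_exponent n a z"
  define G where "G = tail_char n a z s"
  define Gk where "Gk k = tail_char n a z (s + real k / (2 * N))" for k
  define \<Lambda> where "\<Lambda> k = integral {s..s + real k / (2 * N)} h" for k
  define Y where "Y k = z * (2 * (1 - r)) * exp (- 2 * a * s) * (2 * r) ^ k" for k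
  define \<kappa> where "\<kappa> = moment_const"
  have N: "1 \<le> N" by (simp add: N_def)
  have M: "0 \<le> M" and W: "0 \<le> W" and \<kappa>: "0 \<le> \<kappa>"
    by (simp_all add: M_def W_def \<kappa>_def moment_const_nonneg)
  \<comment> \<open>Writes the Hoelder constant so that integration over a step of length k / 2N
    cancels the N and leaves M.\<close>
  have NM: "N powr (1/4) = N * M"
    using powr_add[of N 1 "- 3/4"] N by (simp add: M_def)
  have r: "0 < r" "r \<le> 1" "1 - r \<le> a / N"
    using exp_ge_add_one_self[of "- a / N"] a N by (auto simp: r_def)

  have hs: "h s = game_exponent n w" by (simp add: h_def discounted_exponent_def w_def)
  have wt: "2 * a * z * exp (- 2 * a * t) = w * exp (- 2 * a * (t - s))" for t
    by (simp add: w_def algebra_simps flip: exp_add)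
  have ht: "norm (h t) \<le> 2 * \<kappa> * (N * M) * W" if "s \<le> t" for t
  proof -
    have "\<bar>w * exp (- 2 * a * (t - s))\<bar> \<le> \<bar>w\<bar> * 1"
      unfolding abs_mult using that a by (intro mult_left_mono) auto
    then have "\<bar>w * exp (- 2 * a * (t - s))\<bar> powr (3/4) \<le> W"
      unfolding W_def by (intro powr_mono2) auto
    then have "2 * \<kappa> * (N * M) * \<bar>w * exp (- 2 * a * (t - s))\<bar> powr (3/4) \<le> 2 * \<kappa> * (N * M) * W"
      using N M \<kappa> by (intro mult_left_mono) auto
    then show ?thesis
      using game_exponent_bound[of n "w * exp (- 2 * a * (t - s))"]
      unfolding h_def discounted_exponent_def wt \<kappa>_def[symmetric] N_def[symmetric] NM by linarith
  qed
  have \<Lambda>b: "norm (\<Lambda> k) \<le> \<kappa> * M * W * k" for k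
  proof -
    have "norm (\<Lambda> k) \<le> 2 * \<kappa> * (N * M) * W * (s + real k / (2 * N) - s)"
      unfolding \<Lambda>_def h_def
      by (rule integral_bound) (use ht N in \<open>auto simp: h_def continuous_on_discounted_exponent\<close>)
    also have "\<dots> = \<kappa> * M * W * k" using N by simp
    finally show ?thesis .
  qed
  \<comment> \<open>The exponent is frozen at the left end. Over the step w moves by at most |w| * 2
    k / N, by a < 2 and the step length k / 2N; the Hoelder bound turns this into a second factor
    M.\<close>
  have \<Lambda>d: "norm (complex_of_real (k / (2 * N)) * h s - \<Lambda> k) \<le> 2 * \<kappa> * M\<^sup>2 * W * (real k)\<^sup>2"
    if "1 \<le> k" for k
  proof -
    let ?u = "s + real k / (2 * N)"
    have su: "s \<le> ?u" using N by simp
    have d: "norm (h s - h t) \<le> 2 * \<kappa> * (N * M) * (2 * real k * (W * M))" if t: "t \<in> {s..?u}" for t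
    proof -
      have "w - w * exp (- 2 * a * (t - s)) = w * (1 - exp (- 2 * a * (t - s)))"
        by (simp add: algebra_simps)
      then have "\<bar>w - w * exp (- 2 * a * (t - s))\<bar> = \<bar>w\<bar> * (1 - exp (- 2 * a * (t - s)))"
        using t a by (simp add: abs_mult)
      also have "\<dots> \<le> \<bar>w\<bar> * (2 * a * (t - s))"
        using exp_ge_add_one_self[of "- 2 * a * (t - s)"] by (intro mult_left_mono) auto
      also have "\<dots> \<le> \<bar>w\<bar> * (2 * 2 * (k / (2 * N)))"
        using t a by (intro mult_left_mono mult_mono) auto
      finally have "\<bar>w - w * exp (- 2 * a * (t - s))\<bar> powr (3/4) \<le> (2 * real k * (\<bar>w\<bar> / N)) powr (3/4)"
        by (intro powr_mono2) (auto simp: field_simps)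
      also have "\<dots> \<le> 2 * real k * (\<bar>w\<bar> / N) powr (3/4)"
        by (rule powr_three_quarters_le) (use \<open>1 \<le> k\<close> N in auto)
      also have "(\<bar>w\<bar> / N) powr (3/4) = W * M"
        using N by (simp add: W_def M_def powr_divide powr_minus divide_simps)
      finally have "2 * \<kappa> * (N * M) * \<bar>w - w * exp (- 2 * a * (t - s))\<bar> powr (3/4)
          \<le> 2 * \<kappa> * (N * M) * (2 * real k * (W * M))"
        using N M \<kappa> by (intro mult_left_mono) auto
      then show ?thesis
        using game_exponent_diff[of n w "w * exp (- 2 * a * (t - s))"]
        unfolding hs unfolding h_def discounted_exponent_def wt \<kappa>_def[symmetric] N_def[symmetric] NM by linarith
    qed
    have hi: "h integrable_on {s..?u}"
      unfolding h_def by (intro integrable_continuous_interval continuous_on_discounted_exponent)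
    have "complex_of_real (k / (2 * N)) * h s - \<Lambda> k = integral {s..?u} (\<lambda>t. h s - h t)"
      using su unfolding \<Lambda>_def by (subst integral_diff) (auto simp: hi scaleR_conv_of_real)
    also have "norm \<dots> \<le> 2 * \<kappa> * (N * M) * (2 * real k * (W * M)) * (?u - s)"
      by (rule integral_bound[OF su])
        (use d in \<open>auto simp: h_def intro!: continuous_intros continuous_on_discounted_exponent\<close>)
    also have "\<dots> = 2 * \<kappa> * M\<^sup>2 * W * (real k)\<^sup>2"
      using N by (simp add: power2_eq_square)
    finally show ?thesis .
  qed

  define A where "A = integral {s..} h"
  have G: "G = exp A" by (simp add: G_def tail_char_def A_def h_def)
  have split: "A = \<Lambda> k + integral {s + real k / (2 * N)..} h" for k
    unfolding A_def \<Lambda>_def h_def using N s a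
    by (intro integral_atLeast_split discounted_exponent_integrable integrable_continuous_interval
        continuous_on_discounted_exponent) auto
  \<comment> \<open>The expansion is made around A and not around 0: A and A - \<Lambda> k are both
    tail exponents and so have nonpositive real part, whereas - \<Lambda> k alone has a nonnegative
    one.\<close>
  have Gk: "Gk k = exp (A - \<Lambda> k)" for k
    using split[of k] by (simp add: Gk_def tail_char_def h_def)
  have ReA: "Re A \<le> 0"
    unfolding A_def h_def by (intro Re_integral_nonpos Re_discounted_exponent)
  have ReA\<Lambda>: "Re (A - \<Lambda> k) \<le> 0" for k
  proof -
    have "A - \<Lambda> k = integral {s + real k / (2 * N)..} h" using split[of k] by simp
    then show ?thesis unfolding h_def by (simp only:) (intro Re_integral_nonpos Re_discounted_exponent)
  qed
  have G1: "norm G \<le> 1" using ReA by (simp add: G)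
  have GG: "norm (Gk k - G) \<le> \<kappa> * M * W * k" for k
    using exp_taylor_left_half_plane(1)[OF ReA ReA\<Lambda>[of k]] \<Lambda>b[of k] by (simp add: G Gk)
  have GG2: "norm (Gk k - G + G * \<Lambda> k) \<le> (\<kappa> * M * W * k)\<^sup>2" for k
  proof -
    have "norm (Gk k - G + G * \<Lambda> k) \<le> (norm (\<Lambda> k))\<^sup>2"
      using exp_taylor_left_half_plane(2)[OF ReA ReA\<Lambda>[of k]] by (simp add: G Gk)
    also have "\<dots> \<le> (\<kappa> * M * W * k)\<^sup>2" using \<Lambda>b[of k] by (rule power_mono) simp
    finally show ?thesis .
  qed

  have absw: "\<bar>w\<bar> = 2 * a * (\<bar>z\<bar> * exp (- 2 * a * s))" using a by (simp add: w_def abs_mult)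
  have Yb: "norm (iexp (Y k) - 1) \<le> 2 * (W * M * (2 powr (3/4)) ^ k)" for k
  proof -
    have "\<bar>Y k\<bar> = \<bar>z\<bar> * exp (- 2 * a * s) * 2 * 2 ^ k * ((1 - r) * r ^ k)"
      using r by (simp add: Y_def abs_mult power_mult_distrib)
    also have "\<dots> \<le> \<bar>z\<bar> * exp (- 2 * a * s) * 2 * 2 ^ k * (a / N * 1)"
      using r a N by (intro mult_left_mono mult_mono power_le_one) auto
    also have "\<dots> = \<bar>w\<bar> * 2 ^ k / 2 ^ n" by (simp add: absw N_def)
    finally have "\<bar>Y k\<bar> powr (3/4) \<le> (\<bar>w\<bar> * 2 ^ k / 2 ^ n) powr (3/4)"
      by (intro powr_mono2) auto
    also have "\<dots> = W * M * (2 powr (3/4)) ^ k"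
      unfolding W_def M_def N_def by (rule powr_scale_pow) simp
    finally show ?thesis using iexp_diff_le_powr[of "Y k" 0] by simp
  qed
  \<comment> \<open>The true coefficient (1 - r) r^k is replaced by a / N. The relative error of
    order k / N costs, after the power 3/4, a further factor k M.\<close>
  have Yd: "norm (iexp (Y k) - iexp (w * 2 ^ k / N)) \<le> 8 * M\<^sup>2 * W * (real k * (2 powr (3/4)) ^ k)"
    if "1 \<le> k" for k
  proof -
    have "\<bar>Y k - w * 2 ^ k / N\<bar> = \<bar>z\<bar> * exp (- 2 * a * s) * 2 * 2 ^ k * \<bar>(1 - r) * r ^ k - a / N\<bar>"
    proof -
      have "Y k - w * 2 ^ k / N = z * exp (- 2 * a * s) * 2 * 2 ^ k * ((1 - r) * r ^ k - a / N)"
        by (simp add: Y_def w_def power_mult_distrib algebra_simps)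
      then show ?thesis by (simp add: abs_mult)
    qed
    also have "\<bar>(1 - r) * r ^ k - a / N\<bar> \<le> 2 * real k * (a / N)\<^sup>2"
      using discount_error[of "a / N" k] that a N by (simp add: r_def)
    also have "\<bar>z\<bar> * exp (- 2 * a * s) * 2 * 2 ^ k * (2 * real k * (a / N)\<^sup>2)
        = \<bar>w\<bar> * 2 ^ k * (2 * real k) * (a / N\<^sup>2)"
      by (simp add: absw power2_eq_square)
    also have "\<dots> \<le> \<bar>w\<bar> * 2 ^ k * (2 * real k) * (2 / N\<^sup>2)"
      using a N by (intro mult_left_mono divide_right_mono) auto
    also have "\<dots> = (4 * real k * (\<bar>w\<bar> / N)) * 2 ^ k / 2 ^ n"
      by (simp add: N_def power2_eq_square)
    finally have "\<bar>Y k - w * 2 ^ k / N\<bar> powr (3/4) \<le> ((4 * real k * (\<bar>w\<bar> / N)) * 2 ^ k / 2 ^ n) powr (3/4)"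
      by (intro powr_mono2) (auto simp: mult_left_mono)
    also have "\<dots> = (4 * real k * (\<bar>w\<bar> / N)) powr (3/4) * M * (2 powr (3/4)) ^ k"
      unfolding M_def N_def by (rule powr_scale_pow) simp
    also have "\<dots> \<le> 4 * real k * (\<bar>w\<bar> / N) powr (3/4) * M * (2 powr (3/4)) ^ k"
      using that N M by (intro mult_right_mono powr_three_quarters_le) auto
    also have "(\<bar>w\<bar> / N) powr (3/4) = W * M"
      using N by (simp add: W_def M_def powr_divide powr_minus divide_simps)
    finally show ?thesis
      using iexp_diff_le_powr[of "Y k" "w * 2 ^ k / N"] by (simp add: power2_eq_square mult_ac)
  qed

  \<comment> \<open>Five sources of change: \<open>f1\<close> is the product of the two
    fluctuations, \<open>f2\<close> idealises the gain, \<open>f3\<close> is the main term, which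
    has mean 0, \<open>f4\<close> freezes the exponent at s, and \<open>f5\<close> is the
    second-order remainder of exp.\<close>
  define f1 where "f1 k = (iexp (Y k) - 1) * (Gk k - G)" for k
  define f2 where "f2 k = G * (iexp (Y k) - iexp (w * 2 ^ k / N))" for k
  define f3 where "f3 k = G * (iexp (w * 2 ^ k / N) - 1 - h s / (2 * N) * real k)" for k
  define f4 where "f4 k = G * (complex_of_real (real k / (2 * N)) * h s - \<Lambda> k)" for k
  define f5 where "f5 k = Gk k - G + G * \<Lambda> k" for k
  have sum: "iexp (Y k) * Gk k - G = f1 k + f2 k + f3 k + f4 k + f5 k" for k
    by (simp add: f1_def f2_def f3_def f4_def f5_def algebra_simps)

  have b1: "norm (f1 k) \<le> 2 * \<kappa> * M\<^sup>2 * W\<^sup>2 * moment_weight k" if "1 \<le> k" for k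
  proof -
    have "norm (f1 k) \<le> 2 * (W * M * (2 powr (3/4)) ^ k) * (\<kappa> * M * W * k)"
      unfolding f1_def norm_mult using Yb[of k] GG[of k] M W by (intro mult_mono) auto
    also have "\<dots> = 2 * \<kappa> * M\<^sup>2 * W\<^sup>2 * (real k * (2 powr (3/4)) ^ k)" by (simp add: power2_eq_square)
    also have "\<dots> \<le> 2 * \<kappa> * M\<^sup>2 * W\<^sup>2 * moment_weight k"
      using moment_weight_ge(2)[OF that] \<kappa> by (intro mult_left_mono) auto
    finally show ?thesis .
  qed
  have b2: "norm (f2 k) \<le> 8 * M\<^sup>2 * W * moment_weight k" if "1 \<le> k" for k
  proof -
    have "norm (f2 k) \<le> 1 * (8 * M\<^sup>2 * W * (real k * (2 powr (3/4)) ^ k))"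
      unfolding f2_def norm_mult using Yd[OF that] G1 by (intro mult_mono) auto
    also have "\<dots> \<le> 1 * (8 * M\<^sup>2 * W * moment_weight k)"
      using moment_weight_ge(2)[OF that] W by (intro mult_left_mono) auto
    finally show ?thesis by simp
  qed
  have b4: "norm (f4 k) \<le> 2 * \<kappa> * M\<^sup>2 * W * moment_weight k" if "1 \<le> k" for k
  proof -
    have "norm (f4 k) \<le> 1 * (2 * \<kappa> * M\<^sup>2 * W * (real k)\<^sup>2)"
      unfolding f4_def norm_mult using \<Lambda>d[OF that] G1 by (intro mult_mono) auto
    also have "\<dots> \<le> 1 * (2 * \<kappa> * M\<^sup>2 * W * moment_weight k)"
      using moment_weight_ge(3)[OF that] W \<kappa> by (intro mult_left_mono) auto
    finally show ?thesis by simp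
  qed
  have b5: "norm (f5 k) \<le> \<kappa>\<^sup>2 * M\<^sup>2 * W\<^sup>2 * moment_weight k" if "1 \<le> k" for k
  proof -
    have "norm (f5 k) \<le> (\<kappa> * M * W * k)\<^sup>2" unfolding f5_def by (rule GG2)
    also have "\<dots> = \<kappa>\<^sup>2 * M\<^sup>2 * W\<^sup>2 * (real k)\<^sup>2" by (simp add: power_mult_distrib)
    also have "\<dots> \<le> \<kappa>\<^sup>2 * M\<^sup>2 * W\<^sup>2 * moment_weight k"
      using moment_weight_ge(3)[OF that] by (intro mult_left_mono) auto
    finally show ?thesis .
  qed
  let ?E = "measure_pmf.expectation game_length"
  note I1 = game_length_bounded[of f1, OF b1] and I2 = game_length_bounded[of f2, OF b2]
    and I4 = game_length_bounded[of f4, OF b4] and I5 = game_length_bounded[of f5, OF b5]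
  have ir: "integrable (measure_pmf game_length) (\<lambda>k. complex_of_real (real k))"
    by (rule integrable_of_real[OF integrable_game_length_ident])
  have ie: "integrable (measure_pmf game_length) (\<lambda>k. iexp (w * 2 ^ k / N) - 1)"
    by (intro Bochner_Integration.integrable_diff integrable_iexp_game_length measure_pmf.integrable_const)
  have I3: "integrable (measure_pmf game_length) f3"
    unfolding f3_def
    by (intro integrable_mult_right Bochner_Integration.integrable_diff[OF ie] integrable_mult_right ir)
  have er: "?E (\<lambda>k. complex_of_real (real k)) = 2"
    using integral_of_real[of "measure_pmf game_length" real, where ?'a = complex]
    by (simp add: expectation_game_length_ident integrable_game_length_ident)
  have ee: "?E (\<lambda>k. iexp (w * 2 ^ k / N) - 1) = h s / N"
    unfolding hs game_exponent_def N_def of_real_power of_real_numeral by simp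
  \<comment> \<open>The mean duration 2 cancels the 2 in the time scale 2 N, so the mean jump term h
    s / N equals the mean loss of the tail exponent.\<close>
  have E3: "?E f3 = 0"
  proof -
    have "?E f3 = G * (?E (\<lambda>k. iexp (w * 2 ^ k / N) - 1) - ?E (\<lambda>k. h s / (2 * N) * complex_of_real (real k)))"
      unfolding f3_def
      by (subst Bochner_Integration.integral_diff[symmetric, OF ie integrable_mult_right[OF ir]])
        (rule integral_mult_right_zero)
    also have "?E (\<lambda>k. h s / (2 * N) * complex_of_real (real k)) = h s / (2 * N) * 2"
      by (subst integral_mult_right_zero) (simp only: er)
    finally show ?thesis unfolding ee by simp
  qed
  have If: "integrable (measure_pmf game_length) (\<lambda>k. iexp (Y k) * Gk k)"
    by (rule measure_pmf.integrable_const_bound[where B = 1])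
      (auto simp: norm_mult Gk_def norm_tail_char_le_1)
  have "?E (\<lambda>k. iexp (Y k) * Gk k) - G = ?E (\<lambda>k. iexp (Y k) * Gk k - G)"
    by (subst Bochner_Integration.integral_diff[OF If]) auto
  also have "\<dots> = ?E (\<lambda>k. f1 k + f2 k + f3 k + f4 k + f5 k)" by (simp only: sum)
  also have "\<dots> = ?E f1 + ?E f2 + ?E f3 + ?E f4 + ?E f5"
    using I1(1) I2(1) I3 I4(1) I5(1) by simp
  also have "\<dots> = ?E f1 + ?E f2 + ?E f4 + ?E f5" by (simp add: E3)
  also have "norm \<dots> \<le> norm (?E f1) + norm (?E f2) + norm (?E f4) + norm (?E f5)"
    by (intro order_trans[OF norm_triangle_ineq] add_mono order_refl)
  also have "\<dots> \<le> 2 * \<kappa> * M\<^sup>2 * W\<^sup>2 * \<kappa> + 8 * M\<^sup>2 * W * \<kappa> + 2 * \<kappa> * M\<^sup>2 * W * \<kappa> + \<kappa>\<^sup>2 * M\<^sup>2 * W\<^sup>2 * \<kappa>"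
    using I1(2) I2(2) I4(2) I5(2) unfolding \<kappa>_def[symmetric] by linarith
  also have "\<dots> = M\<^sup>2 * ((8 * \<kappa> + 2 * \<kappa>\<^sup>2) * W + (2 * \<kappa>\<^sup>2 + \<kappa> ^ 3) * W\<^sup>2)"
    by (simp add: algebra_simps power2_eq_square power3_eq_cube)
  \<comment> \<open>The coefficients of W and of its square are both enlarged to one common
    constant.\<close>
  also have "\<dots> \<le> M\<^sup>2 * ((8 * \<kappa> + 2 * \<kappa>\<^sup>2 + \<kappa> ^ 3) * W + (8 * \<kappa> + 2 * \<kappa>\<^sup>2 + \<kappa> ^ 3) * W\<^sup>2)"
  proof (intro mult_left_mono add_mono[of "_ * W"] mult_right_mono)
    show "8 * \<kappa> + 2 * \<kappa>\<^sup>2 \<le> 8 * \<kappa> + 2 * \<kappa>\<^sup>2 + \<kappa> ^ 3"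
      and "2 * \<kappa>\<^sup>2 + \<kappa> ^ 3 \<le> 8 * \<kappa> + 2 * \<kappa>\<^sup>2 + \<kappa> ^ 3"
      using \<kappa> by simp_all
  qed (use W in auto)
  also have "\<dots> = (8 * \<kappa> + 2 * \<kappa>\<^sup>2 + \<kappa> ^ 3) * M\<^sup>2 * (W + W\<^sup>2)" by (simp add: algebra_simps)
  finally show ?thesis
    unfolding Y_def Gk_def G_def M_def W_def \<kappa>_def .
qed

text \<open>Fubini for the joint law. The map f is there because independence of blocks of a family
  yields B as a function on an index set; for a one-point set f reads off its only
  coordinate.\<close>

lemma (in prob_space) expectation_indep_pmf:
  fixes g :: "'c \<times> 'd \<Rightarrow> complex"
  assumes ind: "indep_var S A S' B" and f: "f \<in> measurable S' (count_space UNIV)"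
    and p: "distr M (count_space UNIV) (\<lambda>\<omega>. f (B \<omega>)) = measure_pmf p"
    and g: "g \<in> borel_measurable (S \<Otimes>\<^sub>M count_space UNIV)" and bd: "\<And>x. norm (g x) \<le> c"
  shows "expectation (\<lambda>\<omega>. g (A \<omega>, f (B \<omega>)))
    = expectation (\<lambda>\<omega>. measure_pmf.expectation p (\<lambda>k. g (A \<omega>, k)))"
proof -
  have [measurable]: "A \<in> measurable M S" "B \<in> measurable M S'"
    using ind by (auto dest: indep_var_rv1 indep_var_rv2)
  note [measurable] = g f
  let ?g = "\<lambda>x. g (fst x, f (snd x))"
  interpret A: prob_space "distr M S A" by (rule prob_space_distr) simp
  interpret B: prob_space "distr M S' B" by (rule prob_space_distr) simp
  interpret AB: pair_prob_space "distr M S A" "distr M S' B" ..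
  have J: "distr M S A \<Otimes>\<^sub>M distr M S' B = distr M (S \<Otimes>\<^sub>M S') (\<lambda>\<omega>. (A \<omega>, B \<omega>))"
    using ind by (simp add: indep_var_distribution_eq)
  have i: "integrable (distr M S A \<Otimes>\<^sub>M distr M S' B) ?g"
    by (rule AB.integrable_const_bound[where B = c]) (use bd in auto)
  have inner: "(\<integral>y. g (x, f y) \<partial>distr M S' B) = measure_pmf.expectation p (\<lambda>k. g (x, k))"
    if x: "x \<in> space S" for x
  proof -
    have [measurable]: "(\<lambda>k. g (x, k)) \<in> borel_measurable (count_space UNIV)" by simp
    have "(\<integral>y. g (x, f y) \<partial>distr M S' B) = expectation (\<lambda>\<omega>. g (x, f (B \<omega>)))"
      by (subst integral_distr) auto
    also have "\<dots> = (\<integral>k. g (x, k) \<partial>distr M (count_space UNIV) (\<lambda>\<omega>. f (B \<omega>)))"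
      by (subst integral_distr) auto
    finally show ?thesis by (simp only: p)
  qed
  have m: "(\<lambda>x. \<integral>y. g (x, f y) \<partial>distr M S' B) \<in> borel_measurable S"
    by (rule B.borel_measurable_lebesgue_integral) simp
  have "expectation (\<lambda>\<omega>. g (A \<omega>, f (B \<omega>))) = integral\<^sup>L (distr M S A \<Otimes>\<^sub>M distr M S' B) ?g"
    unfolding J by (subst integral_distr) auto
  also have "\<dots> = (\<integral>x. \<integral>y. g (x, f y) \<partial>distr M S' B \<partial>distr M S A)"
    using AB.integral_fst'[OF i] by simp
  also have "\<dots> = expectation (\<lambda>\<omega>. \<integral>y. g (A \<omega>, f y) \<partial>distr M S' B)"
    using m by (subst integral_distr) auto
  also have "\<dots> = expectation (\<lambda>\<omega>. measure_pmf.expectation p (\<lambda>k. g (A \<omega>, k)))"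
    by (intro Bochner_Integration.integral_cong refl inner measurable_space[of A M S]) auto
  finally show ?thesis .
qed

text \<open>A function of the sequence of durations and not a random variable, as is
  \<open>gain\<close>: dependence on the first m durations then becomes invariance under restriction
  to {..<m}.\<close>

definition elapsed :: "nat \<Rightarrow> (nat \<Rightarrow> nat) \<Rightarrow> nat" where
  "elapsed m x = (\<Sum>i<m. x i)"

definition gain :: "real \<Rightarrow> nat \<Rightarrow> (nat \<Rightarrow> nat) \<Rightarrow> real" where
  "gain r m x = (\<Sum>i<m. r ^ elapsed i x * (2 * r) ^ x i)"

lemma elapsed_restrict: "j \<le> m \<Longrightarrow> elapsed j (restrict x {..<m}) = elapsed j x"
  unfolding elapsed_def by (intro sum.cong) auto

lemma gain_restrict: "gain r m (restrict x {..<m}) = gain r m x"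
  unfolding gain_def by (intro sum.cong) (auto simp: elapsed_restrict)

section \<open>Exchanging the prediction for actual games, one at a time\<close>

locale petersburg = prob_space M for M :: "'a measure" +
  fixes T :: "nat \<Rightarrow> 'a \<Rightarrow> nat"
  assumes times: "petersburg_times M T"
begin

definition X :: "nat \<Rightarrow> 'a \<Rightarrow> nat" where
  "X i \<omega> = T (Suc i) \<omega> - T i \<omega>"

lemma T_measurable [measurable]: "T i \<in> measurable M (count_space UNIV)"
  using times by (simp add: petersburg_times_def)

lemma T_0: "\<omega> \<in> space M \<Longrightarrow> T 0 \<omega> = 0"
  using times by (simp add: petersburg_times_def)

lemma X_measurable [measurable]: "X i \<in> measurable M (count_space UNIV)"
  unfolding X_def[abs_def] by measurable

lemma X_indep: "indep_vars (\<lambda>_. count_space UNIV) X UNIV"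
  using times by (simp add: petersburg_times_def X_def[abs_def])

text \<open>The prescribed probabilities for k \<ge> 1 sum to 1, so no mass is left for the value 0,
  and point masses on a countable set of full measure determine the law.\<close>

lemma X_distr: "distr M (count_space UNIV) (X i) = measure_pmf game_length"
proof -
  let ?D = "distr M (count_space UNIV) (X i)"
  interpret D: prob_space ?D by (rule prob_space_distr) simp
  have m: "measure ?D {k} = 1 / 2 ^ k" if "1 \<le> k" for k
  proof -
    have "measure ?D {k} = prob {\<omega> \<in> space M. T (Suc i) \<omega> - T i \<omega> = k}"
      by (subst measure_distr) (auto simp: X_def intro!: arg_cong[where f = prob])
    also have "\<dots> = 1 / 2 ^ k" using times that by (simp add: petersburg_times_def)
    finally show ?thesis .
  qed
  have "(\<lambda>k. measure ?D {Suc k}) sums measure ?D (\<Union>k. {Suc k})"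
    by (rule D.finite_measure_UNION) (auto simp: disjoint_family_on_def)
  moreover have "(\<lambda>k. measure ?D {Suc k}) sums 1"
    using power_half_series by (simp add: m power_one_over)
  ultimately have 1: "D.prob (\<Union>k. {Suc k}) = 1" by (rule sums_unique2)
  have ae: "AE k in ?D. k \<in> {1..}"
  proof -
    have "AE k in ?D. k \<in> (\<Union>k. {Suc k})"
      by (subst D.AE_in_set_eq_1) (use 1 in auto)
    then show ?thesis by (rule AE_mp) auto
  qed
  show ?thesis
  proof (rule measure_eqI_countable_AE[where \<Omega> = "{1..}"])
    fix k :: nat assume "k \<in> {1..}"
    then show "emeasure ?D {k} = emeasure (measure_pmf game_length) {k}"
      using m[of k] by (simp add: D.emeasure_eq_measure emeasure_pmf_single pmf_game_length)
  qed (use ae in \<open>auto simp: AE_measure_pmf_iff set_game_length\<close>)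
qed

lemma AE_X_ge_1: "AE \<omega> in M. \<forall>i. 1 \<le> X i \<omega>"
proof -
  have "AE \<omega> in M. 1 \<le> X i \<omega>" for i
  proof -
    have "AE k in distr M (count_space UNIV) (X i). 1 \<le> k"
      unfolding X_distr by (auto simp: AE_measure_pmf_iff set_game_length)
    then show ?thesis by (subst (asm) AE_distr_iff) auto
  qed
  then show ?thesis by (simp add: AE_all_countable)
qed

text \<open>Almost surely all truncated differences are at least 1, hence genuine, and they
  telescope. The bound m \<le> T m is what makes the step errors decay geometrically in m.\<close>

lemma AE_T_eq_sum: "AE \<omega> in M. \<forall>m. T m \<omega> = (\<Sum>i<m. X i \<omega>) \<and> m \<le> T m \<omega>"
  using AE_X_ge_1 AE_space
proof eventually_elim
  case (elim \<omega>)
  have "T m \<omega> = (\<Sum>i<m. X i \<omega>) \<and> m \<le> T m \<omega>" for m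
  proof (induction m)
    case 0
    then show ?case using elim by (simp add: T_0)
  next
    case (Suc m)
    have "1 \<le> T (Suc m) \<omega> - T m \<omega>" using elim by (simp add: X_def)
    then show ?case using Suc by (auto simp: X_def)
  qed
  then show ?case by blast
qed

text \<open>A finite product of countable discrete spaces is discrete, so every function of the
  first m durations is measurable.\<close>

lemma prefix_measurable:
  "(\<lambda>\<omega>. restrict (\<lambda>i. X i \<omega>) {..<m}) \<in> measurable M (count_space (PiE {..<m} (\<lambda>_. UNIV)))"
proof -
  have "(\<lambda>\<omega>. restrict (\<lambda>i. X i \<omega>) {..<m}) \<in> measurable M (PiM {..<m} (\<lambda>_. count_space UNIV))"
    by measurable
  also have "PiM {..<m} (\<lambda>_. count_space (UNIV :: nat set)) = count_space (PiE {..<m} (\<lambda>_. UNIV))"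
    by (rule count_space_PiM_finite) auto
  finally show ?thesis .
qed

lemma expectation_prefix:
  fixes g :: "(nat \<Rightarrow> nat) \<times> nat \<Rightarrow> complex"
  assumes "\<And>x. norm (g x) \<le> c"
  shows "expectation (\<lambda>\<omega>. g (restrict (\<lambda>i. X i \<omega>) {..<m}, X m \<omega>)) =
    expectation (\<lambda>\<omega>. measure_pmf.expectation game_length (\<lambda>k. g (restrict (\<lambda>i. X i \<omega>) {..<m}, k)))"
proof -
  have P: "PiM {..<m} (\<lambda>_. count_space (UNIV :: nat set)) = count_space (PiE {..<m} (\<lambda>_. UNIV))"
    by (rule count_space_PiM_finite) auto
  have ind: "indep_var (PiM {..<m} (\<lambda>_. count_space UNIV)) (\<lambda>\<omega>. restrict (\<lambda>i. X i \<omega>) {..<m})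
      (PiM {m} (\<lambda>_. count_space UNIV)) (\<lambda>\<omega>. restrict (\<lambda>i. X i \<omega>) {m})"
    by (rule indep_var_restrict[OF X_indep]) auto
  \<comment> \<open>Countably many prefixes: the product with the next duration is discrete as well,
    which makes an arbitrary g measurable.\<close>
  have "countable (PiE {..<m} (\<lambda>_. UNIV :: nat set))" by (rule countable_PiE) auto
  then have "g \<in> borel_measurable (PiM {..<m} (\<lambda>_. count_space UNIV) \<Otimes>\<^sub>M count_space UNIV)"
    unfolding P by (simp add: pair_measure_countable)
  from expectation_indep_pmf[OF ind, where f = "\<lambda>x. x m" and p = game_length, OF _ _ this assms]
  show ?thesis by (simp add: X_distr)
qed

text \<open>Genuine gains for the first m games, prediction from time T_m / 2N on.\<close>

definition partial_char :: "nat \<Rightarrow> real \<Rightarrow> real \<Rightarrow> nat \<Rightarrow> 'a \<Rightarrow> complex" where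
  "partial_char n a z m \<omega> =
     iexp (z * (2 * (1 - exp (- a / 2 ^ n))) * gain (exp (- a / 2 ^ n)) m (\<lambda>i. X i \<omega>)) *
     tail_char n a z (elapsed m (\<lambda>i. X i \<omega>) / (2 * 2 ^ n))"

lemma partial_char_measurable [measurable]: "partial_char n a z m \<in> borel_measurable M"
proof -
  let ?r = "exp (- a / 2 ^ n)"
  have "(\<lambda>x. iexp (z * (2 * (1 - ?r)) * gain ?r m x) * tail_char n a z (elapsed m x / (2 * 2 ^ n))) \<in>
      borel_measurable (count_space (PiE {..<m} (\<lambda>_. UNIV)))" by simp
  from measurable_compose[OF prefix_measurable this] show ?thesis
    unfolding gain_restrict elapsed_restrict[OF order_refl] partial_char_def[abs_def] .
qed

lemma norm_partial_char: "norm (partial_char n a z m \<omega>) \<le> 1"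
  unfolding partial_char_def norm_mult by (simp add: norm_tail_char_le_1)

lemma integrable_partial_char: "integrable M (partial_char n a z m)"
  by (rule integrable_const_bound[where B = 1]) (auto simp: norm_partial_char)

definition step_const :: "real \<Rightarrow> real \<Rightarrow> real" where
  "step_const a z = (8 * moment_const + 2 * moment_const\<^sup>2 + moment_const ^ 3) *
     (\<bar>2 * a * z\<bar> powr (3/4) + (\<bar>2 * a * z\<bar> powr (3/4))\<^sup>2)"

lemma step_const_nonneg: "0 \<le> step_const a z"
  unfolding step_const_def using moment_const_nonneg by simp

text \<open>Given the first m durations, the gain so far is a factor of modulus 1, and r^(T_m) = exp
  (- 2 a s) at s = T_m / 2N. What remains is \<open>one_step_bound\<close> at this s.\<close>

lemma partial_char_step:
  assumes a: "1 \<le> a" "a < 2"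
  shows "norm (expectation (partial_char n a z (Suc m)) - expectation (partial_char n a z m))
    \<le> step_const a z * ((2 ^ n) powr (- 3/4))\<^sup>2 * exp (- (3/4) / 2 ^ n) ^ m"
proof -
  define r where "r = exp (- a / 2 ^ n)"
  define c where "c = z * (2 * (1 - r))"
  define M2 where "M2 = ((2 ^ n) powr (- 3/4) :: real)\<^sup>2"
  define G where "G = tail_char n a z"
  define f where "f x k = iexp (c * r ^ elapsed m x * (2 * r) ^ k) * G (elapsed m x / (2 * 2 ^ n) + k / (2 * 2 ^ n))"
    for x and k :: nat
  define g where "g = (\<lambda>(x, k). iexp (c * gain r m x) * (f x k - G (elapsed m x / (2 * 2 ^ n))))"
  have G1: "norm (G s) \<le> 1" for s unfolding G_def by (rule norm_tail_char_le_1)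
  have f1: "norm (f x k) \<le> 1" for x k by (simp add: f_def norm_mult G1)
  have gb: "norm (g y) \<le> 2" for y
  proof -
    obtain x k where y: "y = (x, k)" by (cases y)
    have "norm (g y) = norm (f x k - G (elapsed m x / (2 * 2 ^ n)))"
      by (simp add: y g_def norm_mult)
    also have "\<dots> \<le> norm (f x k) + norm (G (elapsed m x / (2 * 2 ^ n)))" by (rule norm_triangle_ineq4)
    also have "\<dots> \<le> 2" using f1[of x k] G1[of "elapsed m x / (2 * 2 ^ n)"] by linarith
    finally show ?thesis .
  qed
  have diff: "partial_char n a z (Suc m) \<omega> - partial_char n a z m \<omega>
      = g (restrict (\<lambda>i. X i \<omega>) {..<m}, X m \<omega>)" for \<omega>
  proof -
    let ?x = "\<lambda>i. X i \<omega>"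
    have "gain r (Suc m) ?x = gain r m ?x + r ^ elapsed m ?x * (2 * r) ^ X m \<omega>"
      by (simp add: gain_def)
    then have "iexp (c * gain r (Suc m) ?x)
        = iexp (c * gain r m ?x) * iexp (c * r ^ elapsed m ?x * (2 * r) ^ X m \<omega>)"
      by (simp add: distrib_left exp_add mult.assoc)
    moreover have "elapsed (Suc m) ?x / (2 * 2 ^ n) = elapsed m ?x / (2 * 2 ^ n) + X m \<omega> / (2 * 2 ^ n)"
      by (simp add: elapsed_def add_divide_distrib)
    ultimately show ?thesis
      unfolding partial_char_def g_def f_def G_def case_prod_conv gain_restrict
        elapsed_restrict[OF order_refl] r_def[symmetric] c_def[symmetric]
      by (simp only: right_diff_distrib mult.assoc)
  qed
  have bound: "norm (measure_pmf.expectation game_length (\<lambda>k. g (restrict (\<lambda>i. X i \<omega>) {..<m}, k)))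
      \<le> step_const a z * M2 * exp (- (3/4) / 2 ^ n) ^ m"
    if "m \<le> elapsed m (\<lambda>i. X i \<omega>)" for \<omega>
  proof -
    define x where "x = restrict (\<lambda>i. X i \<omega>) {..<m}"
    define s where "s = elapsed m x / (2 * 2 ^ n)"
    define w where "w = 2 * a * z * exp (- 2 * a * s)"
    define W where "W = \<bar>2 * a * z\<bar> powr (3/4)"
    define q where "q = exp (- (3/4) / 2 ^ n :: real) ^ m"
    define K where "K = 8 * moment_const + 2 * moment_const\<^sup>2 + moment_const ^ 3"
    have K: "0 \<le> K" using moment_const_nonneg by (simp add: K_def)
    have s: "m / (2 * 2 ^ n) \<le> s"
      using that by (simp add: s_def x_def elapsed_restrict divide_right_mono)
    then have "0 \<le> s" by (rule order_trans[rotated]) simp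
    have rs: "r ^ elapsed m x = exp (- 2 * a * s)"
      by (simp add: r_def s_def flip: exp_of_nat_mult)
    have fi: "integrable (measure_pmf game_length) (f x)"
      by (rule measure_pmf.integrable_const_bound[where B = 1]) (auto simp: f1)
    have "measure_pmf.expectation game_length (\<lambda>k. g (x, k))
        = iexp (c * gain r m x) * (measure_pmf.expectation game_length (f x) - G s)"
      unfolding g_def case_prod_conv s_def
      by (subst integral_mult_right_zero, subst Bochner_Integration.integral_diff[OF fi]) auto
    then have "norm (measure_pmf.expectation game_length (\<lambda>k. g (x, k)))
        = norm (measure_pmf.expectation game_length (f x) - G s)"
      by (simp add: norm_mult)
    also have "\<dots> \<le> K * M2 * (\<bar>w\<bar> powr (3/4) + (\<bar>w\<bar> powr (3/4))\<^sup>2)"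
      using one_step_bound[OF a \<open>0 \<le> s\<close>, where n = n and z = z]
      unfolding f_def rs s_def[symmetric] unfolding G_def c_def r_def K_def M2_def w_def .
    also have "\<dots> \<le> K * M2 * (W * q + W\<^sup>2 * q)"
    proof -
      have "\<bar>w\<bar> powr (3/4) = W * exp (- (3/2 * a * s))"
        by (simp add: w_def W_def abs_mult powr_mult powr_def[of "exp _"])
      \<comment> \<open>Uses a \<ge> 1 and s \<ge> m / 2N, the latter from T_m \<ge> m: the random
        decay becomes a deterministic geometric one.\<close>
      also have "3/4 / 2 ^ n * m \<le> 3/2 * a * s"
      proof -
        have "3/4 / 2 ^ n * m = 3/2 * 1 * (m / (2 * 2 ^ n))" by simp
        also have "\<dots> \<le> 3/2 * a * s" using s a by (intro mult_mono) auto
        finally show ?thesis .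
      qed
      then have "W * exp (- (3/2 * a * s)) \<le> W * exp (- (3/4 / 2 ^ n * m))"
        by (intro mult_left_mono) (auto simp: W_def)
      also have "exp (- (3/4 / 2 ^ n * m)) = q"
        by (simp add: q_def mult.commute flip: exp_of_nat_mult)
      finally have 1: "\<bar>w\<bar> powr (3/4) \<le> W * q" .
      \<comment> \<open>With q at most 1, the squared term decays at least as fast as the linear one
        and can share its factor q.\<close>
      have q: "0 \<le> q" "q \<le> 1" unfolding q_def by (auto intro!: power_le_one)
      have "(\<bar>w\<bar> powr (3/4))\<^sup>2 \<le> (W * q)\<^sup>2" using 1 by (rule power_mono) simp
      also have "\<dots> = W\<^sup>2 * (q * q)" by (simp add: power2_eq_square)
      also have "\<dots> \<le> W\<^sup>2 * (q * 1)" using q by (intro mult_left_mono) auto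
      finally have "(\<bar>w\<bar> powr (3/4))\<^sup>2 \<le> W\<^sup>2 * q" by simp
      with 1 show ?thesis
        using K by (intro mult_left_mono add_mono) (auto simp: M2_def)
    qed
    also have "\<dots> = step_const a z * M2 * q"
      by (simp add: step_const_def K_def W_def algebra_simps)
    finally show ?thesis unfolding x_def q_def .
  qed
  have "expectation (partial_char n a z (Suc m)) - expectation (partial_char n a z m)
      = expectation (\<lambda>\<omega>. g (restrict (\<lambda>i. X i \<omega>) {..<m}, X m \<omega>))"
    by (subst Bochner_Integration.integral_diff[symmetric, OF integrable_partial_char integrable_partial_char])
      (simp only: diff)
  also have "\<dots> = expectation (\<lambda>\<omega>. measure_pmf.expectation game_length
      (\<lambda>k. g (restrict (\<lambda>i. X i \<omega>) {..<m}, k)))"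
    by (rule expectation_prefix[OF gb])
  also have "norm \<dots> \<le> expectation (\<lambda>\<omega>. norm (measure_pmf.expectation game_length
      (\<lambda>k. g (restrict (\<lambda>i. X i \<omega>) {..<m}, k))))"
    by (rule integral_norm_bound)
  also have "\<dots> \<le> expectation (\<lambda>_. step_const a z * M2 * exp (- (3/4) / 2 ^ n) ^ m)"
  proof (rule integral_mono_AE')
    show "AE \<omega> in M. norm (measure_pmf.expectation game_length
        (\<lambda>k. g (restrict (\<lambda>i. X i \<omega>) {..<m}, k))) \<le> step_const a z * M2 * exp (- (3/4) / 2 ^ n) ^ m"
      using AE_T_eq_sum
    proof eventually_elim
      case (elim \<omega>)
      then have "m \<le> elapsed m (\<lambda>i. X i \<omega>)" unfolding elapsed_def by metis
      then show ?case by (rule bound)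
    qed
  qed (auto simp: step_const_nonneg M2_def)
  also have "\<dots> = step_const a z * M2 * exp (- (3/4) / 2 ^ n) ^ m" by (simp add: prob_space)
  finally show ?thesis unfolding M2_def .
qed

end

section \<open>From the compound Poisson prediction to the exponent of S\<close>

lemma petersburg_exponent_decay:
  assumes "0 < a" "0 \<le> t"
  shows "norm (petersburg_exponent (2 * a * z * exp (- 2 * a * t)))
    \<le> (2 * moment_const * \<bar>2 * a * z\<bar> powr (3/4) + (2 * a * z)\<^sup>2) * exp (- (3/2 * a) * t)"
proof -
  define w where "w = 2 * a * z * exp (- 2 * a * t)"
  have 1: "\<bar>w\<bar> powr (3/4) = \<bar>2 * a * z\<bar> powr (3/4) * exp (- (3/2 * a) * t)"
    by (simp add: w_def abs_mult powr_mult powr_def[of "exp _"])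
  have "w\<^sup>2 = (2 * a * z)\<^sup>2 * exp (- 4 * a * t)"
    by (simp add: w_def power_mult_distrib flip: exp_double)
  also have "\<dots> \<le> (2 * a * z)\<^sup>2 * exp (- (3/2 * a) * t)"
    using assms by (intro mult_left_mono) (auto simp: mult_right_mono)
  finally have "norm (petersburg_exponent w)
      \<le> 2 * moment_const * (\<bar>2 * a * z\<bar> powr (3/4) * exp (- (3/2 * a) * t))
        + (2 * a * z)\<^sup>2 * exp (- (3/2 * a) * t)"
    using petersburg_exponent_bound[of w] unfolding 1 by linarith
  then show ?thesis unfolding w_def by (simp add: algebra_simps)
qed

lemma continuous_on_petersburg_exponent_exp:
  "continuous_on S (\<lambda>t. petersburg_exponent (c * exp (- 2 * a * t)))"
  by (rule continuous_on_compose2[OF continuous_on_petersburg_exponent])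
    (auto intro!: continuous_intros)

lemma petersburg_exponent_exp_integrable:
  assumes "0 < a" "0 \<le> s"
  shows "(\<lambda>t. petersburg_exponent (2 * a * z * exp (- 2 * a * t))) integrable_on {s..}"
  by (rule exp_decay_integrable[OF continuous_on_petersburg_exponent_exp petersburg_exponent_decay])
    (use assms in auto)

text \<open>The integral of the correction i n * 2 a z exp (- 2 a t) over the half-line is exactly i
  n z, so subtracting n cancels it. The remaining error is at most the integral of 4 a^2 z^2 exp (-
  4 a t) / 2^n, which is a z^2 / 2^n.\<close>

lemma tail_char_limit:
  assumes a: "0 < a"
  shows "norm (iexp (- (z * real n)) * tail_char n a z 0
      - exp (integral {0..} (\<lambda>t. petersburg_exponent (2 * a * z * exp (- 2 * a * t)))))
    \<le> a * z\<^sup>2 / 2 ^ n"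
proof -
  define h where "h = discounted_exponent n a z"
  define l where "l = (\<lambda>t. petersburg_exponent (2 * a * z * exp (- 2 * a * t)))"
  define m where "m = (\<lambda>t. \<i> * complex_of_real (n * (2 * a * z * exp (- 2 * a * t))))"
  have m: "(m has_integral \<i> * complex_of_real (z * n)) {0..}"
  proof -
    have "((\<lambda>t. n * (2 * a * z) * exp (- (2 * a) * t)) has_integral n * (2 * a * z) * (exp (- (2 * a) * 0) / (2 * a))) {0..}"
      using a by (intro has_integral_mult_right has_integral_exp_minus_to_infinity) auto
    also have "n * (2 * a * z) * (exp (- (2 * a) * 0) / (2 * a)) = z * n" using a by simp
    finally have "((\<lambda>t. complex_of_real (n * (2 * a * z) * exp (- (2 * a) * t))) has_integral
        complex_of_real (z * n)) {0..}"
      by (rule has_integral_of_real)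
    then show ?thesis unfolding m_def by (intro has_integral_mult_right) (simp add: mult_ac)
  qed
  have hi: "h integrable_on {0..}" unfolding h_def by (rule discounted_exponent_integrable) (use a in auto)
  have li: "l integrable_on {0..}" unfolding l_def by (rule petersburg_exponent_exp_integrable) (use a in auto)
  have Re: "Re (integral {0..} l) \<le> 0" "Re (integral {0..} h - \<i> * complex_of_real (z * n)) \<le> 0"
    using Re_integral_nonpos[of "{0..}" l] Re_petersburg_exponent
      Re_integral_nonpos[of "{0..}" h] Re_discounted_exponent by (auto simp: l_def h_def)
  have e: "iexp (- (z * real n)) * tail_char n a z 0 = exp (integral {0..} h - \<i> * complex_of_real (z * n))"
    unfolding tail_char_def h_def by (simp add: exp_diff exp_minus field_simps)
  have "norm (iexp (- (z * real n)) * tail_char n a z 0 - exp (integral {0..} l))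
      \<le> norm (integral {0..} h - \<i> * complex_of_real (z * n) - integral {0..} l)"
    unfolding e by (rule exp_taylor_left_half_plane(1)[OF Re])
  also have "integral {0..} h - \<i> * complex_of_real (z * n) - integral {0..} l = integral {0..} (\<lambda>t. h t - m t - l t)"
    using hi li m by (intro integral_unique[symmetric] has_integral_diff) auto
  also have "norm \<dots> \<le> 4 * a\<^sup>2 * z\<^sup>2 / 2 ^ n * (exp (- (4 * a) * 0) / (4 * a))"
  proof (rule norm_exp_decay_integral)
    show "continuous_on {0..} (\<lambda>t. h t - m t - l t)"
      unfolding h_def l_def m_def
      by (intro continuous_on_diff continuous_on_discounted_exponent continuous_on_petersburg_exponent_exp)
        (auto intro!: continuous_intros)
    show "norm (h t - m t - l t) \<le> 4 * a\<^sup>2 * z\<^sup>2 / 2 ^ n * exp (- (4 * a) * t)" for t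
    proof -
      have "norm (h t - m t - l t) \<le> (2 * a * z * exp (- 2 * a * t))\<^sup>2 / 2 ^ n"
        unfolding h_def m_def l_def discounted_exponent_def by (rule game_exponent_approx)
      also have "\<dots> = 4 * a\<^sup>2 * z\<^sup>2 / 2 ^ n * exp (- (4 * a) * t)"
        by (simp add: power_mult_distrib flip: exp_double)
      finally show ?thesis .
    qed
  qed (use a in auto)
  also have "\<dots> = a * z\<^sup>2 / 2 ^ n" using a by (simp add: power2_eq_square)
  finally show ?thesis unfolding l_def .
qed

lemma tail_char_tendsto_1:
  assumes a: "0 < a" and f: "filterlim f at_top F"
  shows "((\<lambda>m. tail_char n a z (f m)) \<longlongrightarrow> 1) F"
proof -
  define K where "K = 2 * moment_const * (2 ^ n) powr (1/4) * \<bar>2 * a * z\<bar> powr (3/4)"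
  have f0: "eventually (\<lambda>m. 0 \<le> f m) F" using f by (auto simp: filterlim_at_top)
  have b: "norm (integral {s..} (discounted_exponent n a z)) \<le> K * (exp (- (3/2 * a) * s) / (3/2 * a))"
    if "0 \<le> s" for s
    unfolding K_def
    by (rule norm_exp_decay_integral[OF continuous_on_discounted_exponent discounted_exponent_bound])
      (use a that in auto)
  have "filterlim (\<lambda>m. (3/2 * a) * f m) at_top F"
    using f a by (intro filterlim_tendsto_pos_mult_at_top[OF tendsto_const]) auto
  then have "filterlim (\<lambda>m. - ((3/2 * a) * f m)) at_bot F"
    by (simp add: filterlim_uminus_at_top)
  then have "((\<lambda>m. exp (- ((3/2 * a) * f m))) \<longlongrightarrow> 0) F"
    by (rule filterlim_compose[OF exp_at_bot])
  then have "((\<lambda>m. K * (exp (- (3/2 * a) * f m) / (3/2 * a))) \<longlongrightarrow> K * (0 / (3/2 * a))) F"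
    using a by (intro tendsto_intros) auto
  then have "((\<lambda>m. K * (exp (- (3/2 * a) * f m) / (3/2 * a))) \<longlongrightarrow> 0) F" by simp
  then have "((\<lambda>m. integral {f m..} (discounted_exponent n a z)) \<longlongrightarrow> 0) F"
    by (rule Lim_null_comparison[rotated]) (use f0 b in \<open>auto elim: eventually_mono\<close>)
  then have "((\<lambda>m. exp (integral {f m..} (discounted_exponent n a z))) \<longlongrightarrow> exp 0) F"
    by (rule tendsto_exp)
  then show ?thesis by (simp add: tail_char_def)
qed

context petersburg
begin

lemma petersburg_value_measurable [measurable]: "petersburg_value T r \<in> borel_measurable M"
  unfolding petersburg_value_def[abs_def] by measurable

text \<open>As T_i \<ge> i almost surely, the series is dominated by that of r^i (2 r)^(X_i). Its
  mean is finite: E (2 r)^X is the geometric series of r, and the factors r^i are summable.\<close>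

lemma AE_gain_tendsto:
  assumes r: "0 < r" "r < 1"
  shows "AE \<omega> in M. (\<lambda>m. gain r m (\<lambda>i. X i \<omega>)) \<longlonglongrightarrow> petersburg_value T r \<omega>"
proof -
  have ir: "integrable (measure_pmf game_length) (\<lambda>k. (2 * r) ^ k)"
  proof -
    have "summable (\<lambda>k. r ^ Suc k)" using r by (subst summable_Suc_iff) (simp add: summable_geometric)
    also have "(\<lambda>k. r ^ Suc k) = (\<lambda>k. norm ((2 * r) ^ Suc k) / 2 ^ Suc k)"
      using r by (simp add: power_mult_distrib abs_mult)
    finally show ?thesis unfolding integrable_game_length_iff .
  qed
  define C where "C = measure_pmf.expectation game_length (\<lambda>k. (2 * r) ^ k)"
  have C: "(\<integral>\<^sup>+\<omega>. ennreal ((2 * r) ^ X i \<omega>) \<partial>M) = ennreal C" for i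
  proof -
    have "(\<integral>\<^sup>+\<omega>. ennreal ((2 * r) ^ X i \<omega>) \<partial>M)
        = (\<integral>\<^sup>+k. ennreal ((2 * r) ^ k) \<partial>distr M (count_space UNIV) (X i))"
      by (subst nn_integral_distr) auto
    also have "\<dots> = ennreal C"
      unfolding X_distr C_def using r by (intro nn_integral_eq_integral ir) auto
    finally show ?thesis .
  qed
  have C0: "0 \<le> C" unfolding C_def using r by (intro integral_nonneg_AE) auto
  have "(\<integral>\<^sup>+\<omega>. (\<Sum>i. ennreal (r ^ i * (2 * r) ^ X i \<omega>)) \<partial>M)
      = (\<Sum>i. \<integral>\<^sup>+\<omega>. ennreal (r ^ i * (2 * r) ^ X i \<omega>) \<partial>M)"
    by (rule nn_integral_suminf) measurable
  also have "\<dots> = (\<Sum>i. ennreal (r ^ i * C))"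
  proof (rule suminf_cong)
    fix i
    have "(\<integral>\<^sup>+\<omega>. ennreal (r ^ i * (2 * r) ^ X i \<omega>) \<partial>M)
        = (\<integral>\<^sup>+\<omega>. ennreal (r ^ i) * ennreal ((2 * r) ^ X i \<omega>) \<partial>M)"
      using r by (intro nn_integral_cong ennreal_mult) auto
    also have "\<dots> = ennreal (r ^ i) * (\<integral>\<^sup>+\<omega>. ennreal ((2 * r) ^ X i \<omega>) \<partial>M)"
      by (rule nn_integral_cmult) measurable
    also have "\<dots> = ennreal (r ^ i * C)"
      unfolding C using r C0 by (intro ennreal_mult[symmetric]) auto
    finally show "(\<integral>\<^sup>+\<omega>. ennreal (r ^ i * (2 * r) ^ X i \<omega>) \<partial>M) = ennreal (r ^ i * C)" .
  qed
  also have "\<dots> = ennreal (\<Sum>i. r ^ i * C)"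
    using r C0 by (intro suminf_ennreal2 summable_mult2 summable_geometric) auto
  finally have "(\<integral>\<^sup>+\<omega>. (\<Sum>i. ennreal (r ^ i * (2 * r) ^ X i \<omega>)) \<partial>M) \<noteq> \<infinity>" by simp
  then have "AE \<omega> in M. (\<Sum>i. ennreal (r ^ i * (2 * r) ^ X i \<omega>)) \<noteq> \<infinity>"
    by (intro nn_integral_PInf_AE) measurable
  then show ?thesis using AE_T_eq_sum
  proof eventually_elim
    case (elim \<omega>)
    then have s: "summable (\<lambda>i. r ^ i * (2 * r) ^ X i \<omega>)"
      using r by (intro summable_suminf_not_top) auto
    have "summable (\<lambda>i. r ^ T i \<omega> * (2 * r) ^ X i \<omega>)"
    proof (rule summable_comparison_test'[OF s])
      fix i :: nat
      have "r ^ T i \<omega> \<le> r ^ i" using elim(2)[rule_format, of i] r by (intro power_decreasing) auto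
      then show "norm (r ^ T i \<omega> * (2 * r) ^ X i \<omega>) \<le> r ^ i * (2 * r) ^ X i \<omega>"
        using r by (simp add: abs_mult mult_right_mono)
    qed
    then have "(\<lambda>m. \<Sum>i<m. r ^ T i \<omega> * (2 * r) ^ X i \<omega>) \<longlonglongrightarrow> petersburg_value T r \<omega>"
      unfolding petersburg_value_def X_def[symmetric] by (rule summable_LIMSEQ)
    moreover have "T i \<omega> = elapsed i (\<lambda>i. X i \<omega>)" for i
      unfolding elapsed_def using elim by blast
    ultimately show ?case by (simp add: gain_def)
  qed
qed

lemma partial_char_tendsto:
  assumes a: "0 < a"
  shows "(\<lambda>m. expectation (partial_char n a z m)) \<longlonglongrightarrow>
    expectation (\<lambda>\<omega>. iexp (z * (2 * (1 - exp (- a / 2 ^ n))) * petersburg_value T (exp (- a / 2 ^ n)) \<omega>))"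
proof (rule integral_dominated_convergence[where w = "\<lambda>_. 1"])
  define r where "r = exp (- a / 2 ^ n)"
  have r: "0 < r" "r < 1" using a by (auto simp: r_def)
  show "AE \<omega> in M. (\<lambda>m. partial_char n a z m \<omega>) \<longlonglongrightarrow>
      iexp (z * (2 * (1 - exp (- a / 2 ^ n))) * petersburg_value T (exp (- a / 2 ^ n)) \<omega>)"
    using AE_gain_tendsto[OF r] AE_T_eq_sum
  proof eventually_elim
    case (elim \<omega>)
    have e: "m \<le> elapsed m (\<lambda>i. X i \<omega>)" for m
      unfolding elapsed_def using elim(2) by metis
    have "filterlim (\<lambda>m. elapsed m (\<lambda>i. X i \<omega>)) at_top sequentially"
      by (rule filterlim_at_top_mono[OF filterlim_ident]) (use e in auto)
    then have "filterlim (\<lambda>m. 1 / (2 * 2 ^ n) * real (elapsed m (\<lambda>i. X i \<omega>))) at_top sequentially"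
      by (intro filterlim_tendsto_pos_mult_at_top[OF tendsto_const]
          filterlim_compose[OF filterlim_real_sequentially]) auto
    then have "filterlim (\<lambda>m. elapsed m (\<lambda>i. X i \<omega>) / (2 * 2 ^ n)) at_top sequentially"
      by simp
    then have t: "(\<lambda>m. tail_char n a z (elapsed m (\<lambda>i. X i \<omega>) / (2 * 2 ^ n))) \<longlonglongrightarrow> 1"
      by (rule tail_char_tendsto_1[OF a])
    have "(\<lambda>m. iexp (z * (2 * (1 - r)) * gain r m (\<lambda>i. X i \<omega>)) *
        tail_char n a z (elapsed m (\<lambda>i. X i \<omega>) / (2 * 2 ^ n))) \<longlonglongrightarrow>
        iexp (z * (2 * (1 - r)) * petersburg_value T r \<omega>) * 1"
      by (intro tendsto_mult t tendsto_exp tendsto_const tendsto_of_real elim(1))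
    then show ?case unfolding r_def partial_char_def by simp
  qed
qed (auto simp: norm_partial_char)

lemma value_char_bound:
  assumes a: "1 \<le> a" "a < 2"
  shows "norm (expectation (\<lambda>\<omega>. iexp (z * (2 * (1 - exp (- a / 2 ^ n))) *
      petersburg_value T (exp (- a / 2 ^ n)) \<omega>)) - tail_char n a z 0)
    \<le> 3 * step_const a z * (2 ^ n) powr (- 1/2)"
proof -
  define F where "F m = expectation (partial_char n a z m)" for m
  define N where "N = (2 ^ n :: real)"
  define q where "q = exp (- (3/4) / N)"
  define D where "D = step_const a z * (N powr (- 3/4))\<^sup>2"
  have N: "1 \<le> N" by (simp add: N_def)
  have q: "0 < q" "q < 1" using N by (auto simp: q_def)
  have D: "0 \<le> D" by (simp add: D_def step_const_nonneg)
  have F0: "F 0 = tail_char n a z 0"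
    by (simp add: F_def partial_char_def[abs_def] gain_def elapsed_def prob_space)
  have "norm (F m - F 0) \<le> (\<Sum>j<m. D * q ^ j)" for m
  proof (induction m)
    case (Suc m)
    have "norm (F (Suc m) - F m) \<le> D * q ^ m"
      unfolding F_def D_def q_def N_def by (rule partial_char_step[OF a])
    moreover have "norm (F (Suc m) - F 0) \<le> norm (F (Suc m) - F m) + norm (F m - F 0)"
      using norm_triangle_ineq[of "F (Suc m) - F m" "F m - F 0"] by simp
    ultimately show ?case using Suc by simp
  qed simp
  moreover have "(\<Sum>j<m. D * q ^ j) \<le> D * (1 / (1 - q))" for m
    using q D unfolding sum_distrib_left[symmetric]
    by (intro mult_left_mono) (auto simp: suminf_geometric[symmetric] intro!: sum_le_suminf summable_geometric)
  \<comment> \<open>From 1 - exp (- x) \<ge> x / (1 + x) at x = 3 / 4N one gets 1 + 4N/3, which is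
    at most 3 N as N \<ge> 1. This factor N turns the step error N^(-3/2) into N^(-1/2).\<close>
  moreover have "1 / (1 - q) \<le> 3 * N"
  proof -
    define x where "x = 3/4 / N"
    have x: "0 < x" using N by (simp add: x_def)
    have "q = exp (- x)" by (simp add: q_def x_def)
    also have "\<dots> = 1 / exp x" by (simp add: exp_minus inverse_eq_divide)
    also have "\<dots> \<le> 1 / (1 + x)"
      using x exp_ge_add_one_self[of x] by (intro divide_left_mono) auto
    finally have "x / (1 + x) \<le> 1 - q" using x by (simp add: field_simps)
    then have "1 / (1 - q) \<le> 1 / (x / (1 + x))" using x q by (intro divide_left_mono mult_pos_pos) auto
    also have "\<dots> = 1 + 4/3 * N" using N x by (simp add: x_def field_simps)
    also have "\<dots> \<le> 3 * N" using N by simp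
    finally show ?thesis .
  qed
  ultimately have b: "norm (F m - F 0) \<le> D * (3 * N)" for m
    using D by (meson mult_left_mono order_trans)
  have "(\<lambda>m. norm (F m - F 0)) \<longlonglongrightarrow> norm (expectation (\<lambda>\<omega>. iexp (z * (2 * (1 - exp (- a / 2 ^ n))) *
      petersburg_value T (exp (- a / 2 ^ n)) \<omega>)) - F 0)"
    unfolding F_def using a by (intro tendsto_intros partial_char_tendsto) auto
  then have "norm (expectation (\<lambda>\<omega>. iexp (z * (2 * (1 - exp (- a / 2 ^ n))) *
      petersburg_value T (exp (- a / 2 ^ n)) \<omega>)) - F 0) \<le> D * (3 * N)"
    by (rule Lim_bounded) (use b in auto)
  also have "D * (3 * N) = 3 * step_const a z * N powr (- 1/2)"
  proof -
    have "(N powr (- 3/4))\<^sup>2 * N = N powr (- 3/4) * N powr (- 3/4) * N powr 1"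
      using N by (simp add: power2_eq_square)
    also have "\<dots> = N powr (- 1/2)" by (simp only: powr_add[symmetric]) simp
    finally show ?thesis by (simp add: D_def)
  qed
  finally show ?thesis unfolding F0 N_def .
qed

lemma value_char_tendsto:
  assumes a: "1 \<le> a" "a < 2"
  shows "(\<lambda>n. char (distr M borel
      (\<lambda>\<omega>. 2 * (1 - exp (- a / 2 ^ n)) * petersburg_value T (exp (- a / 2 ^ n)) \<omega> - real n)) z)
    \<longlonglongrightarrow> exp (integral {0..} (\<lambda>t. petersburg_exponent (2 * a * z * exp (- 2 * a * t))))"
    (is "?c \<longlonglongrightarrow> ?L")
proof -
  have b: "norm (?c n - ?L) \<le> 3 * step_const a z * (2 ^ n) powr (- 1/2) + a * z\<^sup>2 * (1/2) ^ n" for n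
  proof -
    define c where "c = 2 * (1 - exp (- a / 2 ^ n))"
    define V where "V = petersburg_value T (exp (- a / 2 ^ n))"
    have 1: "norm (expectation (\<lambda>\<omega>. iexp (z * c * V \<omega>)) - tail_char n a z 0)
        \<le> 3 * step_const a z * (2 ^ n) powr (- 1/2)"
      unfolding c_def V_def by (rule value_char_bound[OF a])
    have 2: "norm (iexp (- (z * real n)) * tail_char n a z 0 - ?L) \<le> a * z\<^sup>2 / 2 ^ n"
      by (rule tail_char_limit) (use a in simp)
    have "?c n = expectation (\<lambda>\<omega>. iexp (z * (c * V \<omega> - real n)))"
      unfolding char_def c_def V_def by (subst integral_distr) auto
    also have "\<dots> = expectation (\<lambda>\<omega>. iexp (- (z * real n)) * iexp (z * c * V \<omega>))"
      by (intro Bochner_Integration.integral_cong) (auto simp: algebra_simps simp flip: exp_add)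
    also have "\<dots> = iexp (- (z * real n)) * expectation (\<lambda>\<omega>. iexp (z * c * V \<omega>))"
      by (rule integral_mult_right_zero)
    finally have eq: "?c n = iexp (- (z * real n)) * expectation (\<lambda>\<omega>. iexp (z * c * V \<omega>))" .
    \<comment> \<open>The centring by n is a factor u of modulus 1, so the error of
      \<open>value_char_bound\<close> passes through it unchanged.\<close>
    have "norm (u * x - y) \<le> norm (x - v) + norm (u * v - y)" if "norm u = 1" for u v x y :: complex
    proof -
      have "u * x - y = u * (x - v) + (u * v - y)" by (simp add: algebra_simps)
      moreover have "norm (u * (x - v)) = norm (x - v)" using that by (simp add: norm_mult)
      ultimately show ?thesis by (metis norm_triangle_ineq)
    qed
    then have "norm (?c n - ?L) \<le> norm (expectation (\<lambda>\<omega>. iexp (z * c * V \<omega>)) - tail_char n a z 0)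
        + norm (iexp (- (z * real n)) * tail_char n a z 0 - ?L)"
      unfolding eq using norm_exp_i_times[of "- (z * real n)"] by blast
    then have "norm (?c n - ?L) \<le> 3 * step_const a z * (2 ^ n) powr (- 1/2) + a * z\<^sup>2 / 2 ^ n"
      using 1 2 by linarith
    moreover have "a * z\<^sup>2 / 2 ^ n = a * z\<^sup>2 * (1/2) ^ n" by (simp add: power_one_over)
    ultimately show ?thesis by (simp only:)
  qed
  have p: "(2 ^ n) powr (- 1/2) = ((2::real) powr (- 1/2)) ^ n" for n
  proof -
    have "(2 ^ n) powr (- 1/2) = ((2::real) powr real n) powr (- 1/2)" by (simp add: powr_realpow)
    also have "\<dots> = (2 powr (- 1/2)) powr real n" by (simp only: powr_powr mult.commute)
    finally show ?thesis by (simp add: powr_realpow)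
  qed
  have "(2::real) powr (- 1/2) < 2 powr 0" by (intro powr_less_mono) auto
  then have t: "(\<lambda>n. ((2::real) powr (- 1/2)) ^ n) \<longlonglongrightarrow> 0" by (intro LIMSEQ_realpow_zero) auto
  have "(\<lambda>n. 3 * step_const a z * (2 ^ n) powr (- 1/2) + a * z\<^sup>2 * (1/2) ^ n)
      \<longlonglongrightarrow> 3 * step_const a z * 0 + a * z\<^sup>2 * 0"
    unfolding p
    by (rule tendsto_add[OF tendsto_mult[OF tendsto_const t]
          tendsto_mult[OF tendsto_const LIMSEQ_realpow_zero]]) auto
  then have "(\<lambda>n. 3 * step_const a z * (2 ^ n) powr (- 1/2) + a * z\<^sup>2 * (1/2) ^ n) \<longlonglongrightarrow> 0"
    by simp
  then have "(\<lambda>n. ?c n - ?L) \<longlonglongrightarrow> 0"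
    by (rule Lim_null_comparison[rotated]) (use b in auto)
  then show ?thesis by (simp add: LIM_zero_iff)
qed

end

subsection \<open>Riemann--Stieltjes sums along regulated paths\<close>

text \<open>One-sided limits everywhere, with no condition on the value at the point or on the
  variation.\<close>

definition regulated :: "(real \<Rightarrow> real) \<Rightarrow> bool" where
  "regulated g \<longleftrightarrow> (\<forall>t. (\<exists>l. (g \<longlongrightarrow> l) (at_left t)) \<and> (\<exists>l. (g \<longlongrightarrow> l) (at_right t)))"

lemma regulated_near:
  assumes "regulated g" "0 < e"
  obtains l l' d where "0 < d" "\<And>s. x - d < s \<Longrightarrow> s < x \<Longrightarrow> \<bar>g s - l\<bar> < e"
    "\<And>s. x < s \<Longrightarrow> s < x + d \<Longrightarrow> \<bar>g s - l'\<bar> < e"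
proof -
  obtain l l' where l: "(g \<longlongrightarrow> l) (at_left x)" and l': "(g \<longlongrightarrow> l') (at_right x)"
    using assms(1) unfolding regulated_def by blast
  have "\<forall>\<^sub>F s in at_left x. \<bar>g s - l\<bar> < e"
    using tendstoD[OF l \<open>0 < e\<close>] by (simp add: dist_real_def)
  then obtain y where y: "y < x" "\<And>s. y < s \<Longrightarrow> s < x \<Longrightarrow> \<bar>g s - l\<bar> < e"
    by (auto simp: eventually_at_left[of "x - 1"])
  have "\<forall>\<^sub>F s in at_right x. \<bar>g s - l'\<bar> < e"
    using tendstoD[OF l' \<open>0 < e\<close>] by (simp add: dist_real_def)
  then obtain y' where y': "x < y'" "\<And>s. x < s \<Longrightarrow> s < y' \<Longrightarrow> \<bar>g s - l'\<bar> < e"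
    by (auto simp: eventually_at_right[of _ "x + 1"])
  show ?thesis
    by (rule that[of "min (x - y) (y' - x)" l l']) (use y y' in auto)
qed

lemma regulated_bounded:
  assumes "regulated g" "a \<le> b"
  shows "\<exists>B. \<forall>s\<in>{a..b}. \<bar>g s\<bar> \<le> B"
  using \<open>a \<le> b\<close>
proof (induction rule: Bolzano)
  case (trans u v w)
  then obtain B B' where "\<forall>s\<in>{u..v}. \<bar>g s\<bar> \<le> B" "\<forall>s\<in>{v..w}. \<bar>g s\<bar> \<le> B'" by auto
  then have "\<forall>s\<in>{u..w}. \<bar>g s\<bar> \<le> max B B'"
    by (metis atLeastAtMost_iff le_max_iff_disj linear)
  then show ?case by blast
next
  case (local x)
  obtain l l' d where d: "0 < d" "\<And>s. x - d < s \<Longrightarrow> s < x \<Longrightarrow> \<bar>g s - l\<bar> < 1"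
    "\<And>s. x < s \<Longrightarrow> s < x + d \<Longrightarrow> \<bar>g s - l'\<bar> < 1"
    using regulated_near[OF assms(1) zero_less_one] by metis
  have "\<bar>g s\<bar> \<le> \<bar>l\<bar> + \<bar>l'\<bar> + \<bar>g x\<bar> + 1" if "\<bar>s - x\<bar> < d" for s
  proof (cases s x rule: linorder_cases)
    case less
    then show ?thesis using d(2)[of s] that by linarith
  next
    case greater
    then show ?thesis using d(3)[of s] that by linarith
  qed simp
  then show ?case
    using d(1)
    by (intro exI[of _ d] conjI allI impI exI[of _ "\<bar>l\<bar> + \<bar>l'\<bar> + \<bar>g x\<bar> + 1"] ballI) auto
qed

text \<open>Near x all values on one side are within e / 2 of the one-sided limit, so on a short
  interval x itself is the only possible exception. Bolzano's principle adds up the short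
  intervals.\<close>

lemma regulated_small_oscillation:
  assumes "regulated g" "0 < e" "a \<le> b"
  shows "\<exists>F. finite F \<and> (\<forall>x\<in>{a..b} - F. \<exists>d>0. \<forall>y. \<bar>y - x\<bar> < d \<longrightarrow> \<bar>g y - g x\<bar> < e)"
  using \<open>a \<le> b\<close>
proof (induction rule: Bolzano)
  case (trans u v w)
  then obtain F F' where F: "finite F" "finite F'"
    "\<forall>x\<in>{u..v} - F. \<exists>d>0. \<forall>y. \<bar>y - x\<bar> < d \<longrightarrow> \<bar>g y - g x\<bar> < e"
    "\<forall>x\<in>{v..w} - F'. \<exists>d>0. \<forall>y. \<bar>y - x\<bar> < d \<longrightarrow> \<bar>g y - g x\<bar> < e" by auto
  show ?case
  proof (intro exI[of _ "F \<union> F'"] conjI ballI)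
    fix x assume "x \<in> {u..w} - (F \<union> F')"
    then have "x \<in> {u..v} - F \<or> x \<in> {v..w} - F'" by auto
    then show "\<exists>d>0. \<forall>y. \<bar>y - x\<bar> < d \<longrightarrow> \<bar>g y - g x\<bar> < e" using F by blast
  qed (use F in auto)
next
  case (local x)
  obtain l l' d where d: "0 < d" "\<And>s. x - d < s \<Longrightarrow> s < x \<Longrightarrow> \<bar>g s - l\<bar> < e / 2"
    "\<And>s. x < s \<Longrightarrow> s < x + d \<Longrightarrow> \<bar>g s - l'\<bar> < e / 2"
    using regulated_near[OF assms(1) half_gt_zero[OF assms(2)]] by metis
  have *: "\<exists>\<delta>>0. \<forall>y. \<bar>y - s\<bar> < \<delta> \<longrightarrow> \<bar>g y - g s\<bar> < e" if s: "\<bar>s - x\<bar> < d" "s \<noteq> x" for s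
  \<comment> \<open>This radius keeps y on the same side of x as s and within distance d of
    x.\<close>
  proof (intro exI[of _ "min \<bar>s - x\<bar> (d - \<bar>s - x\<bar>)"] conjI allI impI)
    fix y assume y: "\<bar>y - s\<bar> < min \<bar>s - x\<bar> (d - \<bar>s - x\<bar>)"
    show "\<bar>g y - g s\<bar> < e"
    proof (cases "s < x")
      case True
      then have "x - d < y" "y < x" "x - d < s" using y s by auto
      then have "\<bar>g y - l\<bar> < e / 2" "\<bar>g s - l\<bar> < e / 2" using True d(2) by blast+
      then show ?thesis by linarith
    next
      case False
      then have "x < s" "y < x + d" "x < y" "s < x + d" using y s by auto
      then have "\<bar>g y - l'\<bar> < e / 2" "\<bar>g s - l'\<bar> < e / 2" using d(3) by blast+
      then show ?thesis by linarith
    qed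
  qed (use s in auto)
  have "\<exists>F. finite F \<and> (\<forall>s\<in>{u..v} - F. \<exists>d>0. \<forall>y. \<bar>y - s\<bar> < d \<longrightarrow> \<bar>g y - g s\<bar> < e)"
    if "u \<le> x \<and> x \<le> v \<and> v - u < d" for u v
  proof (intro exI[of _ "{x}"] conjI ballI)
    fix s assume "s \<in> {u..v} - {x}"
    then have "\<bar>s - x\<bar> < d" "s \<noteq> x" using that by auto
    then show "\<exists>d>0. \<forall>y. \<bar>y - s\<bar> < d \<longrightarrow> \<bar>g y - g s\<bar> < e" by (rule *)
  qed simp
  then show ?case using d(1) by blast
qed

text \<open>Take oscillation 1 / (n + 1) on [- n, n] and unite the finite exceptional sets over
  n.\<close>

lemma regulated_countable_discontinuities:
  assumes "regulated g"
  shows "countable {x. \<not> isCont g x}"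
proof -
  have "\<exists>F. finite F \<and> (\<forall>x\<in>{- real n..real n} - F. \<exists>d>0. \<forall>y. \<bar>y - x\<bar> < d \<longrightarrow> \<bar>g y - g x\<bar> < 1 / Suc n)" for n
    by (rule regulated_small_oscillation[OF assms]) auto
  then obtain F where F: "\<And>n. finite (F n)"
    "\<And>n x. x \<in> {- real n..real n} - F n \<Longrightarrow> \<exists>d>0. \<forall>y. \<bar>y - x\<bar> < d \<longrightarrow> \<bar>g y - g x\<bar> < 1 / Suc n"
    by metis
  have "isCont g x" if x: "x \<notin> (\<Union>n. F n)" for x
    unfolding continuous_at_eps_delta dist_real_def
  proof (intro allI impI)
    fix e :: real assume "0 < e"
    obtain n1 where n1: "\<bar>x\<bar> \<le> real n1" using real_arch_simple by blast
    obtain n2 where n2: "1 / e \<le> real n2" using real_arch_simple by blast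
    define n where "n = max n1 n2"
    have "x \<in> {- real n..real n} - F n" using x n1 by (auto simp: n_def)
    moreover have "1 / real (Suc n) \<le> e"
    proof -
      have "1 / e \<le> real (Suc n)" using n2 by (simp add: n_def)
      then show ?thesis using \<open>0 < e\<close> by (simp add: field_simps)
    qed
    ultimately show "\<exists>d>0. \<forall>x'. \<bar>x' - x\<bar> < d \<longrightarrow> \<bar>g x' - g x\<bar> < e"
      using F(2)[of x n] by (meson less_le_trans)
  qed
  then have "{x. \<not> isCont g x} \<subseteq> (\<Union>n. F n)" by blast
  moreover have "countable (\<Union>n. F n)" using F(1) by (intro countable_UN) (auto intro: countable_finite)
  ultimately show ?thesis by (rule countable_subset)
qed

lemma regulated_borel_measurable:
  assumes "regulated g"
  shows "g \<in> borel_measurable borel"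
  by (rule borel_measurable_continuous_countable_exceptions[OF regulated_countable_discontinuities[OF assms]])
    (auto intro!: continuous_at_imp_continuous_on)

lemma tagged_partition_mono:
  assumes "tagged_partition b h m t \<xi>" "i \<le> j" "j \<le> m"
  shows "t i \<le> t j"
  using assms(2,3)
proof (induction j rule: dec_induct)
  case (step k)
  then have "k < m" by simp
  then have "t k \<le> t (Suc k)" using assms(1) unfolding tagged_partition_def by (meson order_trans)
  then show ?case using step by auto
qed simp

lemma tagged_partition_mesh_mono:
  assumes "tagged_partition b h m t \<xi>" "h \<le> h'"
  shows "tagged_partition b h' m t \<xi>"
  using assms unfolding tagged_partition_def by (meson less_le_trans)

lemma tagged_partition_bounds:
  assumes "tagged_partition b h m t \<xi>"
  shows "i \<le> m \<Longrightarrow> 0 \<le> t i" "i \<le> m \<Longrightarrow> t i \<le> b" "i < m \<Longrightarrow> 0 \<le> \<xi> i" "i < m \<Longrightarrow> \<xi> i \<le> b"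
proof -
  show 1: "0 \<le> t i" if "i \<le> m" for i
    using tagged_partition_mono[OF assms, of 0 i] that assms by (simp add: tagged_partition_def)
  show 2: "t i \<le> b" if "i \<le> m" for i
    using tagged_partition_mono[OF assms, of i m] that assms by (simp add: tagged_partition_def)
  assume i: "i < m"
  then have "t i \<le> \<xi> i" "\<xi> i \<le> t (Suc i)" using assms by (auto simp: tagged_partition_def)
  then show "0 \<le> \<xi> i" "\<xi> i \<le> b" using 1[of i] 2[of "Suc i"] i by auto
qed

text \<open>
  Writing \<open>f(\<xi>)\<close> as \<open>f(b)\<close> minus the integral of \<open>f'\<close> over \<open>[\<xi>, b]\<close>, a Riemann--Stieltjes sum becomes
  an integral of \<open>f'\<close> against the following sums, which are values of \<open>g\<close> close to \<open>s\<close>.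
\<close>

lemma tagged_partition_jump_sum:
  fixes g :: "real \<Rightarrow> real"
  assumes p: "tagged_partition b h m t \<xi>" and "0 < h" and s: "0 \<le> s" "s \<le> b"
  shows "\<exists>u\<in>{0..b}. \<bar>u - s\<bar> < h \<and>
    (\<Sum>i<m. if \<xi> i \<le> s then g (t (Suc i)) - g (t i) else 0) = g u - g 0"
proof -
  have t: "t 0 = 0" "t m = b" "\<And>i. i < m \<Longrightarrow> t i \<le> \<xi> i" "\<And>i. i < m \<Longrightarrow> \<xi> i \<le> t (Suc i)"
    "\<And>i. i < m \<Longrightarrow> t (Suc i) - t i < h"
    using p by (auto simp: tagged_partition_def)
  \<comment> \<open>Tags increase with i, so those up to s form an initial segment and the sum
    telescopes. The induction must remember that u is still \<open>t j\<close> as long as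
    \<open>t j \<le> s\<close>; once a tag exceeds s, u stays put within one mesh of s.\<close>
  have "\<exists>u. 0 \<le> u \<and> u \<le> t j \<and> \<bar>u - min s (t j)\<bar> < h \<and> (t j \<le> s \<longrightarrow> u = t j) \<and>
      (\<Sum>i<j. if \<xi> i \<le> s then g (t (Suc i)) - g (t i) else 0) = g u - g 0" if "j \<le> m" for j
    using that
  proof (induction j)
    case 0
    then show ?case using t s \<open>0 < h\<close> by (intro exI[of _ 0]) auto
  next
    case (Suc j)
    then obtain u where u: "0 \<le> u" "u \<le> t j" "\<bar>u - min s (t j)\<bar> < h" "t j \<le> s \<longrightarrow> u = t j"
      "(\<Sum>i<j. if \<xi> i \<le> s then g (t (Suc i)) - g (t i) else 0) = g u - g 0" by auto
    have j: "t j \<le> \<xi> j" "\<xi> j \<le> t (Suc j)" "t (Suc j) - t j < h" using t Suc.prems by auto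
    show ?case
    proof (cases "\<xi> j \<le> s")
      case True
      then have "u = t j" using u j by auto
      then show ?thesis using True u j \<open>0 < h\<close> by (intro exI[of _ "t (Suc j)"]) auto
    next
      case False
      then show ?thesis using u j by (intro exI[of _ u]) auto
    qed
  qed
  from this[of m] obtain u where "0 \<le> u" "u \<le> b" "\<bar>u - min s b\<bar> < h"
      "(\<Sum>i<m. if \<xi> i \<le> s then g (t (Suc i)) - g (t i) else 0) = g u - g 0"
    using t by auto
  then show ?thesis using s by (intro bexI[of _ u]) (auto simp: min_def split: if_splits)
qed

text \<open>The sums \<open>J k s\<close> tend to g s - g 0 wherever g is continuous, that is off a
  countable set, and stay below 2 B; dominated convergence does the rest. The limit does not involve
  the partitions.\<close>

lemma riemann_stieltjes_sums_converge:
  fixes f f' g :: "real \<Rightarrow> real"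
  assumes g: "regulated g" and f: "\<And>s. (f has_real_derivative f' s) (at s)"
    and f': "continuous_on UNIV f'" and b: "0 \<le> b"
    and p: "\<And>k. tagged_partition b (h k) (m k) (t k) (\<xi> k)" and h: "\<And>k. 0 < h k" "h \<longlonglongrightarrow> 0"
  shows "(\<lambda>k. \<Sum>i<m k. f (\<xi> k i) * (g (t k (Suc i)) - g (t k i))) \<longlonglongrightarrow>
    f b * (g b - g 0) - (\<integral>s. indicator {0..b} s * (f' s * (g s - g 0)) \<partial>lborel)"
proof -
  define J where "J k s = (\<Sum>i<m k. if \<xi> k i \<le> s then g (t k (Suc i)) - g (t k i) else 0)" for k s
  obtain B where B: "\<And>s. s \<in> {0..b} \<Longrightarrow> \<bar>g s\<bar> \<le> B" using regulated_bounded[OF g b] by blast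
  have "compact (f' ` {0..b})"
    by (intro compact_continuous_image continuous_on_subset[OF f']) auto
  then obtain C where C: "\<And>s. s \<in> {0..b} \<Longrightarrow> \<bar>f' s\<bar> \<le> C"
    by (force dest!: compact_imp_bounded simp: bounded_iff)
  have f'm [measurable]: "f' \<in> borel_measurable borel" using f' by (rule borel_measurable_continuous_onI)
  have gm [measurable]: "g \<in> borel_measurable borel" using g by (rule regulated_borel_measurable)
  have Jm [measurable]: "J k \<in> borel_measurable borel" for k unfolding J_def[abs_def] by measurable
  have near: "\<exists>u\<in>{0..b}. \<bar>u - s\<bar> < h k \<and> J k s = g u - g 0" if "s \<in> {0..b}" for k s
    unfolding J_def using that h by (intro tagged_partition_jump_sum[OF p]) auto
  have sum_eq: "(\<Sum>i<m k. f (\<xi> k i) * (g (t k (Suc i)) - g (t k i)))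
      = f b * (g b - g 0) - (\<integral>s. indicator {0..b} s * (f' s * J k s) \<partial>lborel)" for k
  proof -
    define D where "D i = g (t k (Suc i)) - g (t k i)" for i
    note bounds = tagged_partition_bounds[OF p[of k]]
    have FTC: "has_bochner_integral lborel (\<lambda>s. indicator {\<xi> k i..b} s * f' s) (f b - f (\<xi> k i))"
      if "i < m k" for i
    proof -
      have "has_bochner_integral lborel (\<lambda>s. f' s * indicator {\<xi> k i..b} s) (f b - f (\<xi> k i))"
        using bounds(4)[OF that] f f'
        by (intro has_bochner_integral_FTC_Icc_real) (auto simp: continuous_on_eq_continuous_at)
      then show ?thesis by (simp add: mult.commute)
    qed
    have "indicator {0..b} s * (f' s * J k s) = (\<Sum>i<m k. D i * (indicator {\<xi> k i..b} s * f' s))" for s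
      unfolding J_def D_def sum_distrib_left using bounds(3)
      by (intro sum.cong) (auto simp: indicator_def dest: order_trans)
    moreover have "has_bochner_integral lborel (\<lambda>s. \<Sum>i<m k. D i * (indicator {\<xi> k i..b} s * f' s))
        (\<Sum>i<m k. D i * (f b - f (\<xi> k i)))"
      using FTC by (intro has_bochner_integral_sum has_bochner_integral_mult_right) auto
    ultimately have "(\<integral>s. indicator {0..b} s * (f' s * J k s) \<partial>lborel) = (\<Sum>i<m k. D i * (f b - f (\<xi> k i)))"
      by (simp add: has_bochner_integral_integral_eq)
    also have "\<dots> = f b * (\<Sum>i<m k. D i) - (\<Sum>i<m k. f (\<xi> k i) * D i)"
      by (simp add: sum_distrib_left algebra_simps sum_subtractf)
    also have "(\<Sum>i<m k. D i) = g b - g 0"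
      unfolding D_def using p[of k] by (subst sum_lessThan_telescope) (simp add: tagged_partition_def)
    finally show ?thesis by (simp add: D_def)
  qed
  have "(\<lambda>k. \<integral>s. indicator {0..b} s * (f' s * J k s) \<partial>lborel) \<longlonglongrightarrow>
      (\<integral>s. indicator {0..b} s * (f' s * (g s - g 0)) \<partial>lborel)"
  proof (rule integral_dominated_convergence[where w = "\<lambda>s. C * (2 * B) * indicator {0..b} s"])
    show "integrable lborel (\<lambda>s. C * (2 * B) * indicator {0..b} s)"
      using b by (intro integrable_mult_right integrable_real_indicator) auto
    show "AE s in lborel. norm (indicator {0..b} s * (f' s * J k s)) \<le> C * (2 * B) * indicator {0..b} s" for k
    proof (intro AE_I2)
      fix s
      show "norm (indicator {0..b} s * (f' s * J k s)) \<le> C * (2 * B) * indicator {0..b} s"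
      proof (cases "s \<in> {0..b}")
        case True
        obtain u where "u \<in> {0..b}" "J k s = g u - g 0" using near[OF True] by blast
        then have "\<bar>J k s\<bar> \<le> 2 * B" using B[of u] B[of 0] b by auto
        then have "\<bar>f' s\<bar> * \<bar>J k s\<bar> \<le> C * (2 * B)" using C[OF True] by (intro mult_mono) auto
        then show ?thesis using True by (simp add: abs_mult)
      qed simp
    qed
    have "AE s in lborel. s \<notin> {x. \<not> isCont g x}"
      by (intro AE_not_in countable_imp_null_set_lborel regulated_countable_discontinuities g)
    then show "AE s in lborel. (\<lambda>k. indicator {0..b} s * (f' s * J k s)) \<longlonglongrightarrow>
        indicator {0..b} s * (f' s * (g s - g 0))"
    proof eventually_elim
      case (elim s)
      show ?case
      proof (cases "s \<in> {0..b}")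
        case True
        obtain u where u: "\<And>k. \<bar>u k - s\<bar> < h k" "\<And>k. J k s = g (u k) - g 0"
          using near[OF True] by metis
        have "(\<lambda>k. u k - s) \<longlonglongrightarrow> 0"
          by (rule Lim_null_comparison[OF always_eventually h(2)]) (use u(1) in \<open>auto intro: less_imp_le\<close>)
        then have "u \<longlonglongrightarrow> s" by (simp add: LIM_zero_iff)
        then have "(\<lambda>k. g (u k)) \<longlonglongrightarrow> g s" using elim by (intro isCont_tendsto_compose[of s g]) auto
        then show ?thesis unfolding u(2) by (intro tendsto_intros)
      qed simp
    qed
  qed auto
  then show ?thesis unfolding sum_eq by (intro tendsto_intros)
qed

subsection \<open>Stochastic integrals with respect to the Levy process\<close>

lemma (in prob_space) AE_tendsto_imp_tendsto_prob:
  fixes Y :: "nat \<Rightarrow> 'a \<Rightarrow> real"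
  assumes [measurable]: "\<And>k. Y k \<in> borel_measurable M" "Z \<in> borel_measurable M"
    and conv: "AE \<omega> in M. (\<lambda>k. Y k \<omega>) \<longlonglongrightarrow> Z \<omega>" and "0 < e"
  shows "(\<lambda>k. prob {\<omega> \<in> space M. e < \<bar>Y k \<omega> - Z \<omega>\<bar>}) \<longlonglongrightarrow> 0"
proof -
  have "(\<lambda>k. expectation (indicator {\<omega> \<in> space M. e < \<bar>Y k \<omega> - Z \<omega>\<bar>} :: 'a \<Rightarrow> real))
      \<longlonglongrightarrow> expectation (\<lambda>_. 0 :: real)"
  proof (rule integral_dominated_convergence[where w = "\<lambda>_. 1"])
    show "AE \<omega> in M. (\<lambda>k. indicator {\<omega> \<in> space M. e < \<bar>Y k \<omega> - Z \<omega>\<bar>} \<omega> :: real) \<longlonglongrightarrow> 0"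
      using conv
    proof eventually_elim
      case (elim \<omega>)
      have "\<forall>\<^sub>F k in sequentially. \<bar>Y k \<omega> - Z \<omega>\<bar> < e"
        using tendstoD[OF elim \<open>0 < e\<close>] by (simp add: dist_real_def)
      then have "\<forall>\<^sub>F k in sequentially. (indicator {\<omega> \<in> space M. e < \<bar>Y k \<omega> - Z \<omega>\<bar>} \<omega> :: real) = 0"
        by eventually_elim auto
      then show ?case by (rule tendsto_eventually)
    qed
  qed (auto simp: indicator_def)
  then show ?thesis by (simp add: integral_indicator)
qed

lemma (in prob_space) tendsto_prob_imp_tendsto_char:
  assumes [measurable]: "\<And>k. Y k \<in> borel_measurable M" "Z \<in> borel_measurable M"
    and conv: "\<And>e. 0 < e \<Longrightarrow> ((\<lambda>k. prob {\<omega> \<in> space M. e < \<bar>Y k \<omega> - Z \<omega>\<bar>}) \<longlongrightarrow> 0) F"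
  shows "((\<lambda>k. char (distr M borel (Y k)) z) \<longlongrightarrow> char (distr M borel Z) z) F"
proof (rule tendstoI)
  fix e :: real assume "0 < e"
  \<comment> \<open>Where Y and Z are within d the integrand is at most |z| d < e / 2; elsewhere it
    is at most 2, on a set of probability below e / 4.\<close>
  define d where "d = e / (2 * (\<bar>z\<bar> + 1))"
  have d: "0 < d" using \<open>0 < e\<close> by (simp add: d_def)
  have zd: "\<bar>z\<bar> * d < e / 2" using \<open>0 < e\<close> by (simp add: d_def field_simps)
  have "\<forall>\<^sub>F k in F. prob {\<omega> \<in> space M. d < \<bar>Y k \<omega> - Z \<omega>\<bar>} < e / 4"
    using order_tendstoD(2)[OF conv[OF d], of "e / 4"] \<open>0 < e\<close> by simp
  then show "\<forall>\<^sub>F k in F. dist (char (distr M borel (Y k)) z) (char (distr M borel Z) z) < e"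
  proof eventually_elim
    case (elim k)
    define A where "A = {\<omega> \<in> space M. d < \<bar>Y k \<omega> - Z \<omega>\<bar>}"
    have A [measurable]: "A \<in> sets M" unfolding A_def by measurable
    have iA: "integrable M (indicator A :: _ \<Rightarrow> real)"
      by (intro integrable_real_indicator) (auto simp: emeasure_eq_measure)
    have ic: "char (distr M borel V) z = expectation (\<lambda>\<omega>. iexp (z * V \<omega>))"
      and ii: "integrable M (\<lambda>\<omega>. iexp (z * V \<omega>))" if [measurable]: "V \<in> borel_measurable M" for V
    proof -
      show "char (distr M borel V) z = expectation (\<lambda>\<omega>. iexp (z * V \<omega>))"
        unfolding char_def by (subst integral_distr) auto
      show "integrable M (\<lambda>\<omega>. iexp (z * V \<omega>))"
        by (rule integrable_const_bound[where B = 1]) auto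
    qed
    have "dist (char (distr M borel (Y k)) z) (char (distr M borel Z) z)
        = norm (expectation (\<lambda>\<omega>. iexp (z * Y k \<omega>) - iexp (z * Z \<omega>)))"
      unfolding dist_norm ic[OF assms(1)] ic[OF assms(2)]
      by (subst Bochner_Integration.integral_diff[OF ii[OF assms(1)] ii[OF assms(2)]]) (rule refl)
    also have "\<dots> \<le> expectation (\<lambda>\<omega>. norm (iexp (z * Y k \<omega>) - iexp (z * Z \<omega>)))"
      by (rule integral_norm_bound)
    also have "\<dots> \<le> expectation (\<lambda>\<omega>. \<bar>z\<bar> * d + 2 * indicator A \<omega>)"
    proof (rule integral_mono)
      show "integrable M (\<lambda>\<omega>. norm (iexp (z * Y k \<omega>) - iexp (z * Z \<omega>)))"
        by (intro integrable_norm Bochner_Integration.integrable_diff ii assms)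
      show "integrable M (\<lambda>\<omega>. \<bar>z\<bar> * d + 2 * indicator A \<omega> :: real)"
        by (intro Bochner_Integration.integrable_add integrable_mult_right iA) simp
      fix \<omega> assume "\<omega> \<in> space M"
      show "norm (iexp (z * Y k \<omega>) - iexp (z * Z \<omega>)) \<le> \<bar>z\<bar> * d + 2 * indicator A \<omega>"
      proof (cases "\<omega> \<in> A")
        case True
        have "norm (iexp (z * Y k \<omega>) - iexp (z * Z \<omega>)) \<le> norm (iexp (z * Y k \<omega>)) + norm (iexp (z * Z \<omega>))"
          by (rule norm_triangle_ineq4)
        then show ?thesis using True d by (simp add: add_increasing)
      next
        case False
        then have "\<bar>Y k \<omega> - Z \<omega>\<bar> \<le> d" using \<open>\<omega> \<in> space M\<close> by (simp add: A_def)
        then have "\<bar>z\<bar> * \<bar>Y k \<omega> - Z \<omega>\<bar> \<le> \<bar>z\<bar> * d" by (rule mult_left_mono) simp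
        moreover have "\<bar>z * Y k \<omega> - z * Z \<omega>\<bar> = \<bar>z\<bar> * \<bar>Y k \<omega> - Z \<omega>\<bar>"
          by (simp flip: right_diff_distrib abs_mult)
        ultimately show ?thesis
          using False iexp_diff_le[of "z * Y k \<omega>" "z * Z \<omega>"] by simp
      qed
    qed
    also have "\<dots> = \<bar>z\<bar> * d + 2 * prob A"
      by (subst Bochner_Integration.integral_add) (auto simp: prob_space iA)
    also have "\<dots> < e" using elim zd unfolding A_def by linarith
    finally show ?case .
  qed
qed

text \<open>Levy's continuity theorem gives weak convergence to the point mass at 0, whose
  distribution function is continuous at e and at - e. For a constant limit this amounts to
  convergence in probability.\<close>

lemma (in prob_space) char_tendsto_1_imp_tendsto_prob:
  assumes [measurable]: "\<And>k. Y k \<in> borel_measurable M"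
    and conv: "\<And>z. (\<lambda>k. char (distr M borel (Y k)) z) \<longlonglongrightarrow> 1" and "0 < e"
  shows "(\<lambda>k. prob {\<omega> \<in> space M. e < \<bar>Y k \<omega>\<bar>}) \<longlonglongrightarrow> 0"
proof -
  let ?\<delta> = "return borel (0::real)"
  have \<delta>: "real_distribution ?\<delta>"
    by (simp add: real_distribution_def real_distribution_axioms_def prob_space_return)
  interpret \<delta>: real_distribution ?\<delta> by (rule \<delta>)
  have char\<delta>: "char ?\<delta> z = 1" for z
    unfolding char_def by (subst integral_return) auto
  have rd: "real_distribution (distr M borel (Y k))" for k by (rule real_distribution_distr) simp
  have "weak_conv_m (\<lambda>k. distr M borel (Y k)) ?\<delta>"
    by (rule levy_continuity[OF rd \<delta>]) (use conv in \<open>simp add: char\<delta>\<close>)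
  moreover have "isCont (cdf ?\<delta>) x" if "x \<noteq> 0" for x
    unfolding \<delta>.isCont_cdf using that by (simp add: measure_return)
  ultimately have cdf: "(\<lambda>k. cdf (distr M borel (Y k)) x) \<longlonglongrightarrow> cdf ?\<delta> x" if "x \<noteq> 0" for x
    using that unfolding weak_conv_m_def weak_conv_def by blast
  have cY: "cdf (distr M borel (Y k)) x = prob {\<omega> \<in> space M. Y k \<omega> \<le> x}" for k x
    unfolding cdf_def by (subst measure_distr) (auto intro!: arg_cong[where f = prob])
  have le: "prob {\<omega> \<in> space M. e < \<bar>Y k \<omega>\<bar>}
      \<le> cdf (distr M borel (Y k)) (- e) + (1 - cdf (distr M borel (Y k)) e)" for k
  proof -
    have "prob {\<omega> \<in> space M. e < \<bar>Y k \<omega>\<bar>}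
        \<le> prob ({\<omega> \<in> space M. Y k \<omega> \<le> - e} \<union> {\<omega> \<in> space M. \<not> Y k \<omega> \<le> e})"
      by (rule finite_measure_mono) auto
    also have "\<dots> \<le> prob {\<omega> \<in> space M. Y k \<omega> \<le> - e} + prob {\<omega> \<in> space M. \<not> Y k \<omega> \<le> e}"
      by (rule measure_Un_le) measurable
    also have "prob {\<omega> \<in> space M. \<not> Y k \<omega> \<le> e} = 1 - prob {\<omega> \<in> space M. Y k \<omega> \<le> e}"
      by (rule prob_neg) measurable
    finally show ?thesis unfolding cY .
  qed
  have "(\<lambda>k. cdf (distr M borel (Y k)) (- e) + (1 - cdf (distr M borel (Y k)) e))
      \<longlonglongrightarrow> cdf ?\<delta> (- e) + (1 - cdf ?\<delta> e)"
    using \<open>0 < e\<close> by (intro tendsto_intros cdf) auto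
  also have "cdf ?\<delta> (- e) + (1 - cdf ?\<delta> e) = 0"
    using \<open>0 < e\<close> by (simp add: cdf_def measure_return)
  finally show ?thesis
    by (rule tendsto_sandwich[OF _ _ tendsto_const, rotated 2]) (use le in auto)
qed

lemma uniform_riemann_sums_converge:
  fixes H :: "real \<Rightarrow> complex" and u v :: real
  assumes H: "continuous_on {u..v} H" and "u \<le> v"
  shows "(\<lambda>k. \<Sum>j<Suc k. complex_of_real ((v - u) / Suc k) * H (u + (v - u) * j / Suc k))
    \<longlonglongrightarrow> integral {u..v} H"
proof (rule LIMSEQ_I)
  fix e :: real assume "0 < e"
  \<comment> \<open>The added 1 keeps the quotient meaningful when u = v.\<close>
  define e' where "e' = e / (2 * (v - u + 1))"
  have "e * (v - u) < e * (2 * (v - u + 1))"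
    using \<open>0 < e\<close> \<open>u \<le> v\<close> by (intro mult_strict_left_mono) auto
  then have e': "0 < e'" "e' * (v - u) < e"
    using \<open>0 < e\<close> \<open>u \<le> v\<close> by (auto simp: e'_def divide_less_eq)
  have "uniformly_continuous_on {u..v} H" by (intro compact_uniformly_continuous H) simp
  then obtain d where d: "0 < d" "\<And>x y. x \<in> {u..v} \<Longrightarrow> y \<in> {u..v} \<Longrightarrow> dist y x < d \<Longrightarrow> dist (H y) (H x) < e'"
    using e'(1) unfolding uniformly_continuous_on_def by metis
  obtain K where K: "(v - u) / d < real K" using reals_Archimedean2 by blast
  show "\<exists>K. \<forall>k\<ge>K. norm ((\<Sum>j<Suc k. complex_of_real ((v - u) / Suc k) * H (u + (v - u) * j / Suc k))
      - integral {u..v} H) < e"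
  proof (intro exI allI impI)
    fix k assume "K \<le> k"
    define n where "n = Suc k"
    define x where "x j = u + (v - u) * real j / n" for j
    define \<Delta> where "\<Delta> = (v - u) / n"
    have n: "0 < n" by (simp add: n_def)
    have "(v - u) / d < n" using K \<open>K \<le> k\<close> by (simp add: n_def)
    then have \<Delta>: "\<Delta> < d" "0 \<le> \<Delta>" using d(1) n \<open>u \<le> v\<close> by (auto simp: \<Delta>_def field_simps)
    have x: "x 0 = u" "x n = v" "\<And>j. x (Suc j) = x j + \<Delta>"
      using n by (auto simp: x_def \<Delta>_def field_simps)
    have xb: "u \<le> x j" "j \<le> n \<Longrightarrow> x j \<le> v" for j
    proof -
      show "u \<le> x j" using \<open>u \<le> v\<close> by (simp add: x_def)
      assume "j \<le> n"
      then have "(v - u) * real j / n \<le> (v - u) * n / n"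
        using \<open>u \<le> v\<close> by (intro divide_right_mono mult_left_mono) auto
      then show "x j \<le> v" using n by (simp add: x_def)
    qed
    have "norm ((\<Sum>j<j'. complex_of_real \<Delta> * H (x j)) - integral {u..x j'} H) \<le> real j' * (e' * \<Delta>)"
      if "j' \<le> n" for j'
      using that
    proof (induction j')
      case 0
      then show ?case by (simp add: x)
    next
      case (Suc j)
      have sub: "x j \<le> x (Suc j)" "x (Suc j) \<le> v" "u \<le> x j"
        using xb[of "Suc j"] xb(1)[of j] Suc.prems x(3)[of j] \<Delta> by auto
      have c: "continuous_on {x j..x (Suc j)} H"
        by (rule continuous_on_subset[OF H]) (use sub in auto)
      have "complex_of_real \<Delta> * H (x j) - integral {x j..x (Suc j)} H
          = integral {x j..x (Suc j)} (\<lambda>t. H (x j) - H t)"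
        using sub c x(3)[of j]
        by (subst integral_diff) (auto simp: scaleR_conv_of_real integrable_continuous_interval)
      also have "norm \<dots> \<le> e' * (x (Suc j) - x j)"
      proof (rule integral_bound[OF sub(1)])
        show "continuous_on {x j..x (Suc j)} (\<lambda>t. H (x j) - H t)" by (intro continuous_intros c)
        fix t assume t: "t \<in> {x j..x (Suc j)}"
        then have "dist (H (x j)) (H t) < e'"
          using sub \<Delta>(1) x(3)[of j] by (intro d(2)) (auto simp: dist_real_def)
        then show "norm (H (x j) - H t) \<le> e'" by (simp add: dist_norm)
      qed
      finally have 1: "norm (complex_of_real \<Delta> * H (x j) - integral {x j..x (Suc j)} H) \<le> e' * \<Delta>"
        using x(3)[of j] by simp
      have "H integrable_on {u..x (Suc j)}"
        by (intro integrable_continuous_interval continuous_on_subset[OF H]) (use sub in auto)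
      then have split: "integral {u..x (Suc j)} H = integral {u..x j} H + integral {x j..x (Suc j)} H"
        using sub by (intro Henstock_Kurzweil_Integration.integral_combine[symmetric]) auto
      have "(\<Sum>i<Suc j. complex_of_real \<Delta> * H (x i)) - integral {u..x (Suc j)} H
          = ((\<Sum>i<j. complex_of_real \<Delta> * H (x i)) - integral {u..x j} H)
            + (complex_of_real \<Delta> * H (x j) - integral {x j..x (Suc j)} H)"
        unfolding split by simp
      also have "norm \<dots> \<le> real j * (e' * \<Delta>) + e' * \<Delta>"
        using Suc 1 by (intro order_trans[OF norm_triangle_ineq] add_mono) auto
      finally show ?case by (simp add: algebra_simps)
    qed
    from this[of n] have "norm ((\<Sum>j<n. complex_of_real \<Delta> * H (x j)) - integral {u..v} H) \<le> e' * (v - u)"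
      using n by (simp add: x \<Delta>_def)
    then show "norm ((\<Sum>j<Suc k. complex_of_real ((v - u) / Suc k) * H (u + (v - u) * j / Suc k))
      - integral {u..v} H) < e"
      using e'(2) unfolding x_def \<Delta>_def n_def by linarith
  qed
qed

text \<open>The bound b + 1 in place of b because the mesh must lie strictly below it, also when b =
  0.\<close>

lemma uniform_tagged_partition:
  assumes "0 \<le> b"
  shows "tagged_partition b ((b + 1) / Suc k) (Suc k) (\<lambda>i. b * i / Suc k) (\<lambda>i. b * i / Suc k)"
  using assms unfolding tagged_partition_def
  by (auto simp: divide_simps algebra_simps mult_left_mono)

lemma tendsto_inverse_Suc: "(\<lambda>k. c / real (Suc k)) \<longlonglongrightarrow> 0"
  using LIMSEQ_Suc[OF lim_const_over_n[of c]] by simp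

section \<open>Integrals over bounded intervals\<close>

locale petersburg_levy = prob_space M for M :: "'b measure" +
  fixes S :: "real \<Rightarrow> 'b \<Rightarrow> real"
  assumes levy: "levy_process M S"
    and char_S: "\<And>t z. 0 \<le> t \<Longrightarrow>
      char (distr M borel (S t)) z = exp (complex_of_real t * petersburg_exponent z)"
begin

lemma S_measurable: "0 \<le> t \<Longrightarrow> S t \<in> borel_measurable M"
  using levy by (simp add: levy_process_def)

text \<open>For negative times \<^term>\<open>S\<close> is arbitrary; the path is set to 0 there to make it regulated on the whole line.\<close>

definition path :: "'b \<Rightarrow> real \<Rightarrow> real" where
  "path \<omega> s = (if s < 0 then 0 else S s \<omega>)"

lemma AE_regulated_path: "AE \<omega> in M. regulated (path \<omega>)"
proof -
  have "AE \<omega> in M. \<forall>t\<ge>0. continuous (at_right t) (\<lambda>s. S s \<omega>) \<and>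
      (t > 0 \<longrightarrow> (\<exists>l. ((\<lambda>s. S s \<omega>) \<longlongrightarrow> l) (at_left t)))"
    using levy by (simp add: levy_process_def)
  then show ?thesis
  proof eventually_elim
    case (elim \<omega>)
    have left: "\<exists>l. (path \<omega> \<longlongrightarrow> l) (at_left t)" for t
    proof (cases "0 < t")
      case True
      then obtain l where l: "((\<lambda>s. S s \<omega>) \<longlongrightarrow> l) (at_left t)" using elim by force
      have "\<forall>\<^sub>F s in at_left t. S s \<omega> = path \<omega> s"
        using True by (auto simp: eventually_at_left[OF True] path_def intro!: exI[of _ 0])
      then show ?thesis using Lim_transform_eventually[OF l] by blast
    next
      case False
      have "\<forall>\<^sub>F s in at_left t. path \<omega> s = 0"
        using False by (auto simp: eventually_at_filter path_def)
      then show ?thesis using tendsto_eventually by blast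
    qed
    have right: "\<exists>l. (path \<omega> \<longlongrightarrow> l) (at_right t)" for t
    proof (cases "0 \<le> t")
      case True
      then have l: "((\<lambda>s. S s \<omega>) \<longlongrightarrow> S t \<omega>) (at_right t)"
        using elim by (simp add: continuous_within)
      have "\<forall>\<^sub>F s in at_right t. S s \<omega> = path \<omega> s"
        using True by (auto simp: eventually_at_filter path_def)
      then show ?thesis using Lim_transform_eventually[OF l] by blast
    next
      case False
      then have "t < 0" by simp
      then have "\<forall>\<^sub>F s in at_right t. path \<omega> s = 0"
        by (auto simp: eventually_at_right[OF \<open>t < 0\<close>] path_def intro!: exI[of _ 0])
      then show ?thesis using tendsto_eventually by blast
    qed
    show ?case unfolding regulated_def using left right by blast
  qed
qed

definition riemann_sum ::
    "(real \<Rightarrow> real) \<Rightarrow> nat \<Rightarrow> (nat \<Rightarrow> real) \<Rightarrow> (nat \<Rightarrow> real) \<Rightarrow> 'b \<Rightarrow> real" where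
  "riemann_sum f m t \<xi> \<omega> = (\<Sum>i<m. f (\<xi> i) * (S (t (Suc i)) \<omega> - S (t i) \<omega>))"

lemma riemann_sum_measurable:
  assumes "tagged_partition b h m t \<xi>"
  shows "riemann_sum f m t \<xi> \<in> borel_measurable M"
proof -
  have "S (t i) \<in> borel_measurable M" if "i \<le> m" for i
    using tagged_partition_bounds(1)[OF assms that] by (rule S_measurable)
  then show ?thesis
    unfolding riemann_sum_def[abs_def]
    by (intro borel_measurable_sum borel_measurable_times borel_measurable_diff) auto
qed

text \<open>The integral of f against the path, rewritten by parts. Increments from 0 are used since
  S 0 vanishes only almost surely.\<close>

definition path_integral ::
    "(real \<Rightarrow> real) \<Rightarrow> (real \<Rightarrow> real) \<Rightarrow> real \<Rightarrow> 'b \<Rightarrow> real" where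
  "path_integral f f' b \<omega> = f b * (path \<omega> b - path \<omega> 0) -
     (\<integral>s. indicator {0..b} s * (f' s * (path \<omega> s - path \<omega> 0)) \<partial>lborel)"

lemma AE_riemann_sums_converge:
  assumes f: "\<And>s. (f has_real_derivative f' s) (at s)" and f': "continuous_on UNIV f'" and b: "0 \<le> b"
    and p: "\<And>k. tagged_partition b (h k) (m k) (t k) (\<xi> k)" and h: "\<And>k. 0 < h k" "h \<longlonglongrightarrow> 0"
  shows "AE \<omega> in M. (\<lambda>k. riemann_sum f (m k) (t k) (\<xi> k) \<omega>) \<longlonglongrightarrow> path_integral f f' b \<omega>"
  using AE_regulated_path
proof eventually_elim
  case (elim \<omega>)
  have "riemann_sum f (m k) (t k) (\<xi> k) \<omega>
      = (\<Sum>i<m k. f (\<xi> k i) * (path \<omega> (t k (Suc i)) - path \<omega> (t k i)))" for k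
    unfolding riemann_sum_def
  proof (rule sum.cong[OF refl])
    fix i assume "i \<in> {..<m k}"
    then have "0 \<le> t k i" "0 \<le> t k (Suc i)" by (auto intro!: tagged_partition_bounds(1)[OF p])
    then show "f (\<xi> k i) * (S (t k (Suc i)) \<omega> - S (t k i) \<omega>)
        = f (\<xi> k i) * (path \<omega> (t k (Suc i)) - path \<omega> (t k i))" by (simp add: path_def)
  qed
  then show ?case
    unfolding path_integral_def using riemann_stieltjes_sums_converge[OF elim f f' b p h] by simp
qed

lemma has_stochastic_integral_exists:
  assumes f: "\<And>s. (f has_real_derivative f' s) (at s)" and f': "continuous_on UNIV f'" and b: "0 \<le> b"
  shows "\<exists>I. has_stochastic_integral M S f b I"
proof -
  define R where "R k = riemann_sum f (Suc k) (\<lambda>i. b * i / Suc k) (\<lambda>i. b * i / Suc k)" for k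
  \<comment> \<open>As a limit of measurable sums I is measurable by construction; it equals
    \<open>path_integral\<close> almost surely.\<close>
  define I where "I \<omega> = lim (\<lambda>k. R k \<omega>)" for \<omega>
  have Rm [measurable]: "R k \<in> borel_measurable M" for k
    unfolding R_def by (rule riemann_sum_measurable[OF uniform_tagged_partition[OF b]])
  have Im [measurable]: "I \<in> borel_measurable M" unfolding I_def[abs_def] by measurable
  have "AE \<omega> in M. (\<lambda>k. R k \<omega>) \<longlonglongrightarrow> path_integral f f' b \<omega>"
    unfolding R_def using b
    by (intro AE_riemann_sums_converge[OF f f' b uniform_tagged_partition[OF b] _ tendsto_inverse_Suc]) auto
  then have I: "AE \<omega> in M. path_integral f f' b \<omega> = I \<omega>"
    by eventually_elim (simp add: I_def limI)
  have "\<exists>h>0. \<forall>m t \<xi>. tagged_partition b h m t \<xi> \<longrightarrow>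
      prob {\<omega> \<in> space M. \<epsilon> < \<bar>riemann_sum f m t \<xi> \<omega> - I \<omega>\<bar>} < \<delta>" if "0 < \<epsilon>" "0 < \<delta>" for \<epsilon> \<delta>
  \<comment> \<open>If no mesh were fine enough, there would be a bad partition of mesh below 1 / (k
    + 1) for every k; but the sums converge almost surely along every such sequence, and to the same
    limit.\<close>
  proof (rule ccontr)
    assume "\<not> ?thesis"
    then have "\<exists>m t \<xi>. tagged_partition b (1 / Suc k) m t \<xi> \<and>
        \<delta> \<le> prob {\<omega> \<in> space M. \<epsilon> < \<bar>riemann_sum f m t \<xi> \<omega> - I \<omega>\<bar>}" for k :: nat
      by (metis not_less of_nat_0_less_iff zero_less_Suc zero_less_divide_1_iff)
    then have "\<forall>k::nat. \<exists>q. tagged_partition b (1 / Suc k) (fst q) (fst (snd q)) (snd (snd q)) \<and>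
        \<delta> \<le> prob {\<omega> \<in> space M. \<epsilon> < \<bar>riemann_sum f (fst q) (fst (snd q)) (snd (snd q)) \<omega> - I \<omega>\<bar>}"
      by (simp only: split_paired_Ex fst_conv snd_conv) blast
    then obtain q where q: "\<forall>k::nat. tagged_partition b (1 / Suc k) (fst (q k)) (fst (snd (q k))) (snd (snd (q k))) \<and>
        \<delta> \<le> prob {\<omega> \<in> space M. \<epsilon> < \<bar>riemann_sum f (fst (q k)) (fst (snd (q k))) (snd (snd (q k))) \<omega> - I \<omega>\<bar>}"
      by (rule choice[THEN exE])
    define m t \<xi> where "m k = fst (q k)" and "t k = fst (snd (q k))" and "\<xi> k = snd (snd (q k))" for k
    have p: "tagged_partition b (1 / Suc k) (m k) (t k) (\<xi> k)"
      and ge: "\<delta> \<le> prob {\<omega> \<in> space M. \<epsilon> < \<bar>riemann_sum f (m k) (t k) (\<xi> k) \<omega> - I \<omega>\<bar>}" for k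
      using q unfolding m_def t_def \<xi>_def by blast+
    have "AE \<omega> in M. (\<lambda>k. riemann_sum f (m k) (t k) (\<xi> k) \<omega>) \<longlonglongrightarrow> path_integral f f' b \<omega>"
      by (rule AE_riemann_sums_converge[OF f f' b p _ tendsto_inverse_Suc]) auto
    with I have "AE \<omega> in M. (\<lambda>k. riemann_sum f (m k) (t k) (\<xi> k) \<omega>) \<longlonglongrightarrow> I \<omega>"
      by eventually_elim simp
    then have "(\<lambda>k. prob {\<omega> \<in> space M. \<epsilon> < \<bar>riemann_sum f (m k) (t k) (\<xi> k) \<omega> - I \<omega>\<bar>}) \<longlonglongrightarrow> 0"
      using \<open>0 < \<epsilon>\<close> by (intro AE_tendsto_imp_tendsto_prob riemann_sum_measurable[OF p] Im)
    then have "\<delta> \<le> 0" by (rule LIMSEQ_le_const) (use ge in auto)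
    then show False using \<open>0 < \<delta>\<close> by simp
  qed
  then show ?thesis
    unfolding has_stochastic_integral_def riemann_sum_def by (intro exI[of _ I] conjI Im) blast
qed

lemma char_increment:
  assumes "0 \<le> s" "s \<le> t"
  shows "char (distr M borel (\<lambda>\<omega>. c * (S t \<omega> - S s \<omega>))) z
    = exp (complex_of_real (t - s) * petersburg_exponent (z * c))"
proof -
  have [measurable]: "S s \<in> borel_measurable M" "S t \<in> borel_measurable M"
    using assms by (auto intro: S_measurable)
  have "distr M borel (\<lambda>\<omega>. S (s + (t - s)) \<omega> - S s \<omega>) = distr M borel (S (t - s))"
    using levy assms unfolding levy_process_def by (meson diff_ge_0_iff_ge)
  then have e: "distr M borel (\<lambda>\<omega>. S t \<omega> - S s \<omega>) = distr M borel (S (t - s))" by simp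
  have "char (distr M borel (\<lambda>\<omega>. c * (S t \<omega> - S s \<omega>))) z = char (distr M borel (\<lambda>\<omega>. S t \<omega> - S s \<omega>)) (z * c)"
    unfolding char_def by (simp add: integral_distr mult.assoc)
  then show ?thesis unfolding e using assms by (simp add: char_S)
qed

lemma char_weighted_increments:
  assumes "mono t" "0 \<le> t 0"
  shows "char (distr M borel (\<lambda>\<omega>. \<Sum>i<m. c i * (S (t (Suc i)) \<omega> - S (t i) \<omega>))) z
    = exp (\<Sum>i<m. complex_of_real (t (Suc i) - t i) * petersburg_exponent (z * c i))"
proof -
  have "indep_vars (\<lambda>_. borel) (\<lambda>i \<omega>. S (t (Suc i)) \<omega> - S (t i) \<omega>) {..<m}"
    using levy assms unfolding levy_process_def by blast
  then have "indep_vars (\<lambda>_. borel) (\<lambda>i \<omega>. c i * (S (t (Suc i)) \<omega> - S (t i) \<omega>)) {..<m}"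
    by (rule indep_vars_compose2[where Y = "\<lambda>i x. c i * x"]) auto
  then have "char (distr M borel (\<lambda>\<omega>. \<Sum>i<m. c i * (S (t (Suc i)) \<omega> - S (t i) \<omega>))) z
      = (\<Prod>i<m. char (distr M borel (\<lambda>\<omega>. c i * (S (t (Suc i)) \<omega> - S (t i) \<omega>))) z)"
    by (rule char_distr_sum)
  also have "\<dots> = (\<Prod>i<m. exp (complex_of_real (t (Suc i) - t i) * petersburg_exponent (z * c i)))"
  proof (rule prod.cong[OF refl])
    fix i
    have "0 \<le> t i" using monoD[OF \<open>mono t\<close>, of 0 i] assms(2) by simp
    then show "char (distr M borel (\<lambda>\<omega>. c i * (S (t (Suc i)) \<omega> - S (t i) \<omega>))) z
        = exp (complex_of_real (t (Suc i) - t i) * petersburg_exponent (z * c i))"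
      using monoD[OF \<open>mono t\<close>, of i "Suc i"] by (intro char_increment) auto
  qed
  finally show ?thesis by (simp add: exp_sum)
qed

lemma stochastic_integral_tendsto:
  assumes "has_stochastic_integral M S f b J"
    and p: "\<And>k. tagged_partition b (h k) (m k) (t k) (\<xi> k)" and h: "h \<longlonglongrightarrow> 0" and "0 < e"
  shows "(\<lambda>k. prob {\<omega> \<in> space M. e < \<bar>riemann_sum f (m k) (t k) (\<xi> k) \<omega> - J \<omega>\<bar>}) \<longlonglongrightarrow> 0"
proof (rule LIMSEQ_I)
  fix d :: real assume "0 < d"
  with assms(1) \<open>0 < e\<close> have "\<exists>h>0. \<forall>m t \<xi>. tagged_partition b h m t \<xi> \<longrightarrow>
      prob {\<omega> \<in> space M. e < \<bar>riemann_sum f m t \<xi> \<omega> - J \<omega>\<bar>} < d"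
    unfolding has_stochastic_integral_def riemann_sum_def by blast
  then obtain h0 where h0: "0 < h0" "\<And>m t \<xi>. tagged_partition b h0 m t \<xi> \<Longrightarrow>
      prob {\<omega> \<in> space M. e < \<bar>riemann_sum f m t \<xi> \<omega> - J \<omega>\<bar>} < d"
    by blast
  obtain K where K: "\<And>k. K \<le> k \<Longrightarrow> h k < h0"
    using order_tendstoD(2)[OF h h0(1)] unfolding eventually_sequentially by blast
  show "\<exists>K. \<forall>k\<ge>K. norm (prob {\<omega> \<in> space M. e < \<bar>riemann_sum f (m k) (t k) (\<xi> k) \<omega> - J \<omega>\<bar>} - 0) < d"
  proof (intro exI allI impI)
    fix k assume "K \<le> k"
    then have "tagged_partition b h0 (m k) (t k) (\<xi> k)"
      using tagged_partition_mesh_mono[OF p[of k]] K[of k] by simp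
    then show "norm (prob {\<omega> \<in> space M. e < \<bar>riemann_sum f (m k) (t k) (\<xi> k) \<omega> - J \<omega>\<bar>} - 0) < d"
      using h0(2) by simp
  qed
qed

end

section \<open>The improper integral and its law\<close>

lemma sum_lessThan_add:
  fixes g :: "nat \<Rightarrow> 'c :: comm_monoid_add"
  shows "(\<Sum>i<m + n. g i) = (\<Sum>i<m. g i) + (\<Sum>j<n. g (m + j))"
  by (induction n) (auto simp: add.assoc)

lemma continuous_on_exp_decay: "continuous_on A (\<lambda>t::real. exp (- 2 * a * t))"
  by (intro continuous_intros)

lemma exponent_integral:
  assumes a: "0 < a"
  shows "0 \<le> s \<Longrightarrow> (\<lambda>t. petersburg_exponent (z * exp (- 2 * a * t))) integrable_on {s..}"
    and "((\<lambda>s. integral {s..} (\<lambda>t. petersburg_exponent (z * exp (- 2 * a * t)))) \<longlongrightarrow> 0) at_top"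
    and "0 \<le> b \<Longrightarrow> b \<le> b' \<Longrightarrow> integral {b..b'} (\<lambda>t. petersburg_exponent (z * exp (- 2 * a * t)))
      = integral {b..} (\<lambda>t. petersburg_exponent (z * exp (- 2 * a * t)))
        - integral {b'..} (\<lambda>t. petersburg_exponent (z * exp (- 2 * a * t)))"
proof -
  let ?l = "\<lambda>t. petersburg_exponent (z * exp (- 2 * a * t))"
  \<comment> \<open>The decay estimates are stated with 2 a in front of the argument; y absorbs
    it.\<close>
  define y where "y = z / (2 * a)"
  have z: "z = 2 * a * y" using a by (simp add: y_def)
  show i: "?l integrable_on {s..}" if "0 \<le> s" for s
    unfolding z by (rule petersburg_exponent_exp_integrable[OF a that])
  define K where "K = 2 * moment_const * \<bar>2 * a * y\<bar> powr (3/4) + (2 * a * y)\<^sup>2"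
  have bd: "norm (integral {s..} ?l) \<le> K * (exp (- (3/2 * a) * s) / (3/2 * a))" if "0 \<le> s" for s
    unfolding z K_def
    by (rule norm_exp_decay_integral[OF continuous_on_petersburg_exponent_exp petersburg_exponent_decay])
      (use a that in auto)
  have "filterlim (\<lambda>s. (3/2 * a) * s) at_top at_top"
    using a by (intro filterlim_tendsto_pos_mult_at_top[OF tendsto_const] filterlim_ident) auto
  then have "filterlim (\<lambda>s. - ((3/2 * a) * s)) at_bot at_top"
    by (simp add: filterlim_uminus_at_top)
  then have "((\<lambda>s. exp (- ((3/2 * a) * s))) \<longlongrightarrow> 0) at_top"
    by (rule filterlim_compose[OF exp_at_bot])
  then have "((\<lambda>s. K * (exp (- (3/2 * a) * s) / (3/2 * a))) \<longlongrightarrow> K * (0 / (3/2 * a))) at_top"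
    using a by (intro tendsto_intros) auto
  then have "((\<lambda>s. K * (exp (- (3/2 * a) * s) / (3/2 * a))) \<longlongrightarrow> 0) at_top" by simp
  then show "((\<lambda>s. integral {s..} ?l) \<longlongrightarrow> 0) at_top"
    by (rule Lim_null_comparison[rotated])
      (use bd in \<open>auto intro!: eventually_mono[OF eventually_ge_at_top[of 0]]\<close>)
  show "integral {b..b'} ?l = integral {b..} ?l - integral {b'..} ?l" if "0 \<le> b" "b \<le> b'"
  proof -
    have "?l integrable_on {b..b'}"
      by (intro integrable_continuous_interval continuous_on_petersburg_exponent_exp)
    from integral_atLeast_split[OF this i that(2)] show ?thesis using that by simp
  qed
qed

lemma (in prob_space) prob_abs_diff_triangle:
  fixes X Y Z :: "'a \<Rightarrow> real"
  assumes [measurable]: "X \<in> borel_measurable M" "Y \<in> borel_measurable M" "Z \<in> borel_measurable M"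
  shows "prob {\<omega> \<in> space M. e < \<bar>X \<omega> - Z \<omega>\<bar>}
    \<le> prob {\<omega> \<in> space M. e / 2 < \<bar>X \<omega> - Y \<omega>\<bar>} + prob {\<omega> \<in> space M. e / 2 < \<bar>Y \<omega> - Z \<omega>\<bar>}"
proof -
  have "prob {\<omega> \<in> space M. e < \<bar>X \<omega> - Z \<omega>\<bar>}
      \<le> prob ({\<omega> \<in> space M. e / 2 < \<bar>X \<omega> - Y \<omega>\<bar>} \<union> {\<omega> \<in> space M. e / 2 < \<bar>Y \<omega> - Z \<omega>\<bar>})"
  proof (rule finite_measure_mono)
    have "e / 2 < \<bar>X \<omega> - Y \<omega>\<bar> \<or> e / 2 < \<bar>Y \<omega> - Z \<omega>\<bar>" if "e < \<bar>X \<omega> - Z \<omega>\<bar>" for \<omega>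
      using that by linarith
    then show "{\<omega> \<in> space M. e < \<bar>X \<omega> - Z \<omega>\<bar>}
        \<subseteq> {\<omega> \<in> space M. e / 2 < \<bar>X \<omega> - Y \<omega>\<bar>} \<union> {\<omega> \<in> space M. e / 2 < \<bar>Y \<omega> - Z \<omega>\<bar>}"
      by blast
  qed measurable
  also have "\<dots> \<le> prob {\<omega> \<in> space M. e / 2 < \<bar>X \<omega> - Y \<omega>\<bar>} + prob {\<omega> \<in> space M. e / 2 < \<bar>Y \<omega> - Z \<omega>\<bar>}"
    by (rule measure_Un_le) measurable
  finally show ?thesis .
qed

text \<open>Along times where deviation and probability are below 2^-j, Borel-Cantelli gives an
  almost sure limit U; the Cauchy property then carries the whole family to U.\<close>

lemma (in prob_space) cauchy_in_prob_imp_tendsto_prob: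
  fixes I :: "real \<Rightarrow> 'a \<Rightarrow> real"
  assumes meas: "\<And>b. 0 \<le> b \<Longrightarrow> I b \<in> borel_measurable M"
    and cauchy: "\<And>e. 0 < e \<Longrightarrow> \<exists>B\<ge>0. \<forall>b\<ge>B. \<forall>b'\<ge>b. prob {\<omega> \<in> space M. e < \<bar>I b' \<omega> - I b \<omega>\<bar>} < e"
  shows "\<exists>U. U \<in> borel_measurable M \<and>
    (\<forall>e>0. ((\<lambda>b. prob {\<omega> \<in> space M. e < \<bar>I b \<omega> - U \<omega>\<bar>}) \<longlongrightarrow> 0) at_top)"
proof -
  have "\<forall>j. \<exists>B\<ge>0. \<forall>b\<ge>B. \<forall>b'\<ge>b. prob {\<omega> \<in> space M. (1/2) ^ j < \<bar>I b' \<omega> - I b \<omega>\<bar>} < (1/2) ^ j"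
    using cauchy by simp
  then obtain B where B: "\<forall>j. 0 \<le> B j \<and> (\<forall>b\<ge>B j. \<forall>b'\<ge>b.
      prob {\<omega> \<in> space M. (1/2) ^ j < \<bar>I b' \<omega> - I b \<omega>\<bar>} < (1/2) ^ j)"
    by (rule choice[THEN exE])
  \<comment> \<open>Cumulative sums are increasing and still lie above every
    \<open>B j\<close>.\<close>
  define b where "b j = (\<Sum>i\<le>j. B i)" for j :: nat
  have bB: "B j \<le> b j" "0 \<le> b j" "b j \<le> b (Suc j)" for j
    unfolding b_def using B by (auto intro!: member_le_sum sum_nonneg)
  have close: "prob {\<omega> \<in> space M. (1/2) ^ j < \<bar>I b' \<omega> - I (b j) \<omega>\<bar>} < (1/2) ^ j" if "b j \<le> b'" for j b'
    using B bB that by blast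
  have Ib [measurable]: "I (b j) \<in> borel_measurable M" for j by (rule meas[OF bB(2)])
  define U where "U \<omega> = lim (\<lambda>j. I (b j) \<omega>)" for \<omega>
  have Um [measurable]: "U \<in> borel_measurable M" unfolding U_def[abs_def] by measurable
  define D where "D j = {\<omega> \<in> space M. (1/2) ^ j < \<bar>I (b (Suc j)) \<omega> - I (b j) \<omega>\<bar>}" for j
  have "AE \<omega> in M. \<forall>\<^sub>F j in sequentially. \<omega> \<in> space M - D j"
  proof (rule borel_cantelli_AE1)
    show "D j \<in> sets M" for j unfolding D_def by measurable
    show "emeasure M (D j) < \<infinity>" for j by (simp add: emeasure_eq_measure)
    have "norm (prob (D j)) \<le> (1/2) ^ j" for j
      unfolding D_def using close[OF bB(3), of j] by simp
    then show "summable (\<lambda>j. prob (D j))"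
      by (intro summable_comparison_test'[OF summable_geometric, of "1/2" 0]) auto
  qed
  then have U: "AE \<omega> in M. (\<lambda>j. I (b j) \<omega>) \<longlonglongrightarrow> U \<omega>"
  proof eventually_elim
    case (elim \<omega>)
    then have "\<forall>\<^sub>F j in sequentially. norm (I (b (Suc j)) \<omega> - I (b j) \<omega>) \<le> (1/2) ^ j"
      by eventually_elim (auto simp: D_def)
    then have "summable (\<lambda>j. I (b (Suc j)) \<omega> - I (b j) \<omega>)"
      by (rule summable_comparison_test_ev) simp
    then have "convergent (\<lambda>n. \<Sum>j<n. I (b (Suc j)) \<omega> - I (b j) \<omega>)"
      by (simp add: summable_iff_convergent)
    then have "convergent (\<lambda>n. I (b n) \<omega> - I (b 0) \<omega>)"
      by (simp only: sum_lessThan_telescope[of "\<lambda>j. I (b j) \<omega>"])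
    then have "convergent (\<lambda>n. I (b n) \<omega>)"
      using convergent_diff_const_right_iff by blast
    then show ?case by (simp add: U_def convergent_LIMSEQ_iff)
  qed
  have "((\<lambda>x. prob {\<omega> \<in> space M. e < \<bar>I x \<omega> - U \<omega>\<bar>}) \<longlongrightarrow> 0) at_top" if "0 < e" for e
  proof (rule tendstoI)
    fix d :: real assume "0 < d"
    have "(\<lambda>j. prob {\<omega> \<in> space M. e / 2 < \<bar>I (b j) \<omega> - U \<omega>\<bar>}) \<longlonglongrightarrow> 0"
      using \<open>0 < e\<close> U by (intro AE_tendsto_imp_tendsto_prob) auto
    then have "\<forall>\<^sub>F j in sequentially. prob {\<omega> \<in> space M. e / 2 < \<bar>I (b j) \<omega> - U \<omega>\<bar>} < d / 2"
      using \<open>0 < d\<close> by (intro order_tendstoD(2)) auto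
    moreover have "(\<lambda>j. (1/2::real) ^ j) \<longlonglongrightarrow> 0" by (rule LIMSEQ_realpow_zero) auto
    then have "\<forall>\<^sub>F j in sequentially. (1/2::real) ^ j < min (e / 2) (d / 2)"
      using \<open>0 < d\<close> \<open>0 < e\<close> by (intro order_tendstoD(2)) auto
    ultimately have "\<forall>\<^sub>F j in sequentially. prob {\<omega> \<in> space M. e / 2 < \<bar>I (b j) \<omega> - U \<omega>\<bar>} < d / 2 \<and>
        (1/2::real) ^ j < min (e / 2) (d / 2)" by (rule eventually_conj)
    then obtain j where j: "prob {\<omega> \<in> space M. e / 2 < \<bar>I (b j) \<omega> - U \<omega>\<bar>} < d / 2"
      "(1/2::real) ^ j < e / 2" "(1/2::real) ^ j < d / 2"
      by (auto simp: eventually_sequentially)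
    show "\<forall>\<^sub>F x in at_top. dist (prob {\<omega> \<in> space M. e < \<bar>I x \<omega> - U \<omega>\<bar>}) 0 < d"
      using eventually_ge_at_top[of "b j"]
    proof eventually_elim
      case (elim x)
      have [measurable]: "I x \<in> borel_measurable M" using elim bB(2)[of j] by (intro meas) auto
      have "prob {\<omega> \<in> space M. e / 2 < \<bar>I x \<omega> - I (b j) \<omega>\<bar>}
          \<le> prob {\<omega> \<in> space M. (1/2) ^ j < \<bar>I x \<omega> - I (b j) \<omega>\<bar>}"
        using j(2) by (intro finite_measure_mono) auto
      also have "\<dots> < d / 2" using close[OF elim] j(3) by linarith
      finally have "prob {\<omega> \<in> space M. e < \<bar>I x \<omega> - U \<omega>\<bar>} < d"
        using prob_abs_diff_triangle[of "I x" "I (b j)" U e] j(1) by simp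
      then show ?case by simp
    qed
  qed
  with Um show ?thesis by blast
qed

context petersburg_levy
begin

text \<open>Partitions of [0, b'] that pass through b serve both integrals, so the difference of the
  sums lives on [b, b'] alone. Independent increments give its law, with a Riemann sum of the
  claimed integral as exponent.\<close>

lemma char_stochastic_integral_diff:
  assumes b: "0 \<le> b" "b \<le> b'" and f: "continuous_on UNIV f"
    and J: "has_stochastic_integral M S f b J" and J': "has_stochastic_integral M S f b' J'"
  shows "char (distr M borel (\<lambda>\<omega>. J' \<omega> - J \<omega>)) z
    = exp (integral {b..b'} (\<lambda>s. petersburg_exponent (z * f s)))"
proof -
  \<comment> \<open>\<open>Suc k\<close> equal steps on [0, b], then \<open>Suc k\<close> on
    [b, b']. The truncated \<open>i - Suc k\<close> is 0 in the first half, and the minima freeze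
    \<open>t k\<close> at b' beyond the last point, so that it is monotone on all indices as
    \<open>levy_process\<close> asks.\<close>
  define t where "t k i = b * real (min i (Suc k)) / Suc k + (b' - b) * real (min (i - Suc k) (Suc k)) / Suc k"
    for k i
  define h where "h k = (b' + 1) / Suc k" for k :: nat
  have mono: "mono (t k)" for k
    unfolding t_def using b by (intro monoI add_mono divide_right_mono mult_left_mono) auto
  have t0: "t k 0 = 0" for k by (simp add: t_def)
  have tn: "t k (Suc k + j) = b + (b' - b) * j / Suc k" if "j \<le> Suc k" for k j
    using that by (simp add: t_def)
  have d1: "t k (Suc i) - t k i = b / Suc k" if "i < Suc k" for k i
  proof -
    have "t k (Suc i) = b * real (Suc i) / Suc k" "t k i = b * real i / Suc k"
      using that by (simp_all add: t_def)
    then show ?thesis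
      by (simp only: diff_divide_distrib[symmetric] right_diff_distrib[symmetric]) simp
  qed
  have d2: "t k (Suc (Suc k + j)) - t k (Suc k + j) = (b' - b) / Suc k" if "j < Suc k" for k j
    using that tn[of j k] tn[of "Suc j" k] by (simp add: field_simps)
  have mesh: "t k (Suc i) - t k i < h k" if "i < Suc k + Suc k" for k i
  proof (cases "i < Suc k")
    case True
    then show ?thesis using d1[OF True] b by (simp add: h_def divide_strict_right_mono)
  next
    case False
    define j where "j = i - Suc k"
    have j: "i = Suc k + j" "j < Suc k" using False that by (auto simp: j_def)
    show ?thesis
      unfolding j(1) d2[OF j(2)] h_def using b by (intro divide_strict_right_mono) auto
  qed
  have p: "tagged_partition b (h k) (Suc k) (t k) (t k)" for k
    unfolding tagged_partition_def using tn[of 0 k] t0 mesh[of _ k] monoD[OF mono[of k]] by auto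
  have p': "tagged_partition b' (h k) (Suc k + Suc k) (t k) (t k)" for k
    unfolding tagged_partition_def using tn[of "Suc k" k] t0 mesh[of _ k] monoD[OF mono[of k]] by auto
  have h0: "h \<longlonglongrightarrow> 0" unfolding h_def[abs_def] by (rule tendsto_inverse_Suc)
  define R where "R k = riemann_sum f (Suc k) (t k) (t k)" for k
  define R' where "R' k = riemann_sum f (Suc k + Suc k) (t k) (t k)" for k
  have [measurable]: "R k \<in> borel_measurable M" "R' k \<in> borel_measurable M" for k
    unfolding R_def R'_def by (rule riemann_sum_measurable[OF p] riemann_sum_measurable[OF p'])+
  have [measurable]: "J \<in> borel_measurable M" "J' \<in> borel_measurable M"
    using J J' by (auto simp: has_stochastic_integral_def)
  have "(\<lambda>k. char (distr M borel (\<lambda>\<omega>. R' k \<omega> - R k \<omega>)) z) \<longlonglongrightarrow> char (distr M borel (\<lambda>\<omega>. J' \<omega> - J \<omega>)) z"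
  proof (rule tendsto_prob_imp_tendsto_char)
    fix e :: real assume "0 < e"
    have le: "prob {\<omega> \<in> space M. e < \<bar>(R' k \<omega> - R k \<omega>) - (J' \<omega> - J \<omega>)\<bar>}
        \<le> prob {\<omega> \<in> space M. e / 2 < \<bar>R' k \<omega> - J' \<omega>\<bar>} + prob {\<omega> \<in> space M. e / 2 < \<bar>R k \<omega> - J \<omega>\<bar>}" for k
    proof -
      have "prob {\<omega> \<in> space M. e / 2 < \<bar>J' \<omega> - R k \<omega> - (J' \<omega> - J \<omega>)\<bar>} = prob {\<omega> \<in> space M. e / 2 < \<bar>R k \<omega> - J \<omega>\<bar>}"
        by (rule arg_cong[where f = prob]) (auto simp: abs_minus_commute)
      moreover have "prob {\<omega> \<in> space M. e / 2 < \<bar>R' k \<omega> - R k \<omega> - (J' \<omega> - R k \<omega>)\<bar>} = prob {\<omega> \<in> space M. e / 2 < \<bar>R' k \<omega> - J' \<omega>\<bar>}"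
        by (rule arg_cong[where f = prob]) auto
      ultimately show ?thesis
        using prob_abs_diff_triangle[of "\<lambda>\<omega>. R' k \<omega> - R k \<omega>" "\<lambda>\<omega>. J' \<omega> - R k \<omega>" "\<lambda>\<omega>. J' \<omega> - J \<omega>" e] by simp
    qed
    have "(\<lambda>k. prob {\<omega> \<in> space M. e / 2 < \<bar>R' k \<omega> - J' \<omega>\<bar>} + prob {\<omega> \<in> space M. e / 2 < \<bar>R k \<omega> - J \<omega>\<bar>}) \<longlonglongrightarrow> 0 + 0"
      unfolding R_def R'_def using \<open>0 < e\<close>
      by (intro tendsto_add stochastic_integral_tendsto[OF J' p' h0] stochastic_integral_tendsto[OF J p h0]) auto
    then have "(\<lambda>k. prob {\<omega> \<in> space M. e / 2 < \<bar>R' k \<omega> - J' \<omega>\<bar>} + prob {\<omega> \<in> space M. e / 2 < \<bar>R k \<omega> - J \<omega>\<bar>}) \<longlonglongrightarrow> 0"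
      by simp
    then show "(\<lambda>k. prob {\<omega> \<in> space M. e < \<bar>(R' k \<omega> - R k \<omega>) - (J' \<omega> - J \<omega>)\<bar>}) \<longlonglongrightarrow> 0"
      by (rule tendsto_sandwich[OF _ _ tendsto_const, rotated 2]) (use le in auto)
  qed measurable
  moreover have "char (distr M borel (\<lambda>\<omega>. R' k \<omega> - R k \<omega>)) z = exp (\<Sum>j<Suc k. complex_of_real ((b' - b) / Suc k) *
      petersburg_exponent (z * f (b + (b' - b) * j / Suc k)))" for k
  proof -
    \<comment> \<open>Zero weights on the first half, where the two sums agree; these terms vanish
      from the exponent since \<open>petersburg_exponent 0 = 0\<close>.\<close>
    define c where "c i = (if i < Suc k then 0 else f (t k i))" for i
    have "R' k \<omega> - R k \<omega> = (\<Sum>i<Suc k + Suc k. c i * (S (t k (Suc i)) \<omega> - S (t k i) \<omega>))" for \<omega>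
      unfolding R'_def R_def riemann_sum_def sum_lessThan_add by (simp add: c_def)
    then have "char (distr M borel (\<lambda>\<omega>. R' k \<omega> - R k \<omega>)) z = exp (\<Sum>i<Suc k + Suc k.
        complex_of_real (t k (Suc i) - t k i) * petersburg_exponent (z * c i))"
      by (simp only: char_weighted_increments[OF mono] t0 order_refl)
    also have "(\<Sum>i<Suc k + Suc k. complex_of_real (t k (Suc i) - t k i) * petersburg_exponent (z * c i))
        = (\<Sum>j<Suc k. complex_of_real (t k (Suc (Suc k + j)) - t k (Suc k + j)) * petersburg_exponent (z * c (Suc k + j)))"
    proof -
      have "(\<Sum>i<Suc k. complex_of_real (t k (Suc i) - t k i) * petersburg_exponent (z * c i)) = 0"
        by (intro sum.neutral) (auto simp: c_def)
      then show ?thesis unfolding sum_lessThan_add by simp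
    qed
    also have "\<dots> = (\<Sum>j<Suc k. complex_of_real ((b' - b) / Suc k) *
      petersburg_exponent (z * f (b + (b' - b) * j / Suc k)))"
    proof (rule sum.cong[OF refl])
      fix j assume "j \<in> {..<Suc k}"
      then have j: "j < Suc k" "j \<le> Suc k" by auto
      have "c (Suc k + j) = f (b + (b' - b) * j / Suc k)"
        unfolding c_def tn[OF j(2)] by simp
      then show "complex_of_real (t k (Suc (Suc k + j)) - t k (Suc k + j)) * petersburg_exponent (z * c (Suc k + j))
          = complex_of_real ((b' - b) / Suc k) * petersburg_exponent (z * f (b + (b' - b) * j / Suc k))"
        by (simp only: d2[OF j(1)])
    qed
    finally show ?thesis .
  qed
  moreover have "(\<lambda>k. exp (\<Sum>j<Suc k. complex_of_real ((b' - b) / Suc k) *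
      petersburg_exponent (z * f (b + (b' - b) * j / Suc k))))
      \<longlonglongrightarrow> exp (integral {b..b'} (\<lambda>s. petersburg_exponent (z * f s)))"
  proof (intro tendsto_exp uniform_riemann_sums_converge b(2))
    have "continuous_on {b..b'} f" using f by (rule continuous_on_subset) simp
    then show "continuous_on {b..b'} (\<lambda>s. petersburg_exponent (z * f s))"
      by (intro continuous_on_compose2[OF continuous_on_petersburg_exponent]) (auto intro!: continuous_intros)
  qed
  ultimately show ?thesis by (simp only: LIMSEQ_unique)
qed

text \<open>Makes the law of the integral over [0, b] the case of an increment that starts at
  0.\<close>

lemma has_stochastic_integral_at_0: "has_stochastic_integral M S f 0 (\<lambda>_. 0)"
proof -
  have "(\<Sum>i<m. f (\<xi> i) * (S (t (Suc i)) \<omega> - S (t i) \<omega>)) = 0"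
    if p: "tagged_partition 0 h m t \<xi>" for h m t \<xi> \<omega>
  proof (rule sum.neutral, rule ballI)
    fix i assume "i \<in> {..<m}"
    then have "t i = 0" "t (Suc i) = 0"
      using tagged_partition_bounds(1,2)[OF p, of i] tagged_partition_bounds(1,2)[OF p, of "Suc i"] by auto
    then show "f (\<xi> i) * (S (t (Suc i)) \<omega> - S (t i) \<omega>) = 0" by simp
  qed
  then show ?thesis
    unfolding has_stochastic_integral_def by (auto intro!: exI[of _ 1])
qed

text \<open>A failure would give pairs b k \<le> b' k tending to infinity with increments that stay
  large. Their characteristic functions are exponentials of differences of vanishing tail integrals,
  so they tend to 1, a contradiction.\<close>

lemma stochastic_integrals_cauchy:
  assumes a: "0 < a" and I: "\<And>b. 0 \<le> b \<Longrightarrow> has_stochastic_integral M S (\<lambda>t. exp (- 2 * a * t)) b (I b)"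
    and "0 < e"
  shows "\<exists>B\<ge>0. \<forall>b\<ge>B. \<forall>b'\<ge>b. prob {\<omega> \<in> space M. e < \<bar>I b' \<omega> - I b \<omega>\<bar>} < e"
proof (rule ccontr)
  assume *: "\<not> ?thesis"
  have "\<exists>q. real k \<le> fst q \<and> fst q \<le> snd q \<and> e \<le> prob {\<omega> \<in> space M. e < \<bar>I (snd q) \<omega> - I (fst q) \<omega>\<bar>}"
    for k :: nat
  proof -
    obtain b b' where "real k \<le> b" "b \<le> b'" "\<not> prob {\<omega> \<in> space M. e < \<bar>I b' \<omega> - I b \<omega>\<bar>} < e"
      using * of_nat_0_le_iff[of k] by blast
    then show ?thesis by (intro exI[of _ "(b, b')"]) simp
  qed
  then have "\<forall>k. \<exists>q. real k \<le> fst q \<and> fst q \<le> snd q \<and> e \<le> prob {\<omega> \<in> space M. e < \<bar>I (snd q) \<omega> - I (fst q) \<omega>\<bar>}"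
    by blast
  then obtain q where q: "\<forall>k. real k \<le> fst (q k) \<and> fst (q k) \<le> snd (q k) \<and>
      e \<le> prob {\<omega> \<in> space M. e < \<bar>I (snd (q k)) \<omega> - I (fst (q k)) \<omega>\<bar>}"
    by (rule choice[THEN exE])
  define b where "b k = fst (q k)" for k
  define b' where "b' k = snd (q k)" for k
  have b: "real k \<le> b k" "b k \<le> b' k" "0 \<le> b k" "0 \<le> b' k" "real k \<le> b' k"
    and ge: "e \<le> prob {\<omega> \<in> space M. e < \<bar>I (b' k) \<omega> - I (b k) \<omega>\<bar>}" for k
    using q[rule_format, of k] unfolding b_def b'_def by auto
  have lim: "filterlim b at_top sequentially" "filterlim b' at_top sequentially"
    by (rule filterlim_at_top_mono[OF filterlim_real_sequentially]; use b in simp)+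
  have [measurable]: "I (b k) \<in> borel_measurable M" "I (b' k) \<in> borel_measurable M" for k
    using I b by (auto simp: has_stochastic_integral_def)
  have "(\<lambda>k. prob {\<omega> \<in> space M. e < \<bar>I (b' k) \<omega> - I (b k) \<omega>\<bar>}) \<longlonglongrightarrow> 0"
  proof (rule char_tendsto_1_imp_tendsto_prob[OF _ _ \<open>0 < e\<close>])
    fix z
    let ?l = "\<lambda>t. petersburg_exponent (z * exp (- 2 * a * t))"
    have "char (distr M borel (\<lambda>\<omega>. I (b' k) \<omega> - I (b k) \<omega>)) z
        = exp (integral {b k..} ?l - integral {b' k..} ?l)" for k
      by (subst char_stochastic_integral_diff[OF b(3,2) continuous_on_exp_decay I[OF b(3)] I[OF b(4)]])
        (simp only: exponent_integral(3)[OF a b(3,2)])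
    moreover have "(\<lambda>k. exp (integral {b k..} ?l - integral {b' k..} ?l)) \<longlonglongrightarrow> exp (0 - 0)"
      by (intro tendsto_exp tendsto_diff filterlim_compose[OF exponent_integral(2)[OF a]] lim)
    ultimately show "(\<lambda>k. char (distr M borel (\<lambda>\<omega>. I (b' k) \<omega> - I (b k) \<omega>)) z) \<longlonglongrightarrow> 1"
      by simp
  qed measurable
  then have "e \<le> 0" by (rule LIMSEQ_le_const) (use ge in auto)
  then show False using \<open>0 < e\<close> by simp
qed

lemma improper_stochastic_integral_exists:
  assumes a: "0 < a"
  shows "\<exists>U. has_improper_stochastic_integral M S (\<lambda>t. exp (- 2 * a * t)) U"
proof -
  have "\<exists>I. has_stochastic_integral M S (\<lambda>t. exp (- 2 * a * t)) b I" if "0 \<le> b" for b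
    by (rule has_stochastic_integral_exists[where f' = "\<lambda>t. - 2 * a * exp (- 2 * a * t)"])
      (use that in \<open>auto intro!: derivative_eq_intros continuous_intros\<close>)
  then have "\<forall>b. \<exists>I. 0 \<le> b \<longrightarrow> has_stochastic_integral M S (\<lambda>t. exp (- 2 * a * t)) b I" by blast
  then obtain I where I: "\<And>b. 0 \<le> b \<Longrightarrow> has_stochastic_integral M S (\<lambda>t. exp (- 2 * a * t)) b (I b)"
    by metis
  have "I b \<in> borel_measurable M" if "0 \<le> b" for b
    using I[OF that] by (simp add: has_stochastic_integral_def)
  from cauchy_in_prob_imp_tendsto_prob[of I, OF this stochastic_integrals_cauchy[OF a I]]
  obtain U where "U \<in> borel_measurable M"
    "\<forall>e>0. ((\<lambda>b. prob {\<omega> \<in> space M. e < \<bar>I b \<omega> - U \<omega>\<bar>}) \<longlongrightarrow> 0) at_top"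
    by blast
  then show ?thesis
    unfolding has_improper_stochastic_integral_def using I by blast
qed

text \<open>Whichever integrals over [0, b] are chosen in the definition, their laws are fixed by
  the increment formula from 0; so every admissible U has the same law.\<close>

lemma char_improper_stochastic_integral:
  assumes a: "0 < a" and U: "has_improper_stochastic_integral M S (\<lambda>t. exp (- 2 * a * t)) U"
  shows "char (distr M borel U) z = exp (integral {0..} (\<lambda>t. petersburg_exponent (z * exp (- 2 * a * t))))"
proof -
  let ?l = "\<lambda>t. petersburg_exponent (z * exp (- 2 * a * t))"
  obtain I where I: "\<And>b. 0 \<le> b \<Longrightarrow> has_stochastic_integral M S (\<lambda>t. exp (- 2 * a * t)) b (I b)"
    and conv: "\<And>e. 0 < e \<Longrightarrow> ((\<lambda>b. prob {\<omega> \<in> space M. e < \<bar>I b \<omega> - U \<omega>\<bar>}) \<longlongrightarrow> 0) at_top"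
    using U by (auto simp: has_improper_stochastic_integral_def)
  have [measurable]: "U \<in> borel_measurable M" "I (real k) \<in> borel_measurable M" for k
    using U I[of "real k"] by (auto simp: has_improper_stochastic_integral_def has_stochastic_integral_def)
  have "(\<lambda>k. char (distr M borel (I (real k))) z) \<longlonglongrightarrow> char (distr M borel U) z"
  proof (rule tendsto_prob_imp_tendsto_char)
    show "(\<lambda>k. prob {\<omega> \<in> space M. e < \<bar>I (real k) \<omega> - U \<omega>\<bar>}) \<longlonglongrightarrow> 0" if "0 < e" for e
      by (rule filterlim_compose[OF conv[OF that] filterlim_real_sequentially])
  qed measurable
  moreover have "char (distr M borel (I (real k))) z = exp (integral {0..} ?l - integral {real k..} ?l)" for k
  proof -
    have "char (distr M borel (\<lambda>\<omega>. I (real k) \<omega> - 0)) z = exp (integral {0..real k} ?l)"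
      by (rule char_stochastic_integral_diff[OF order_refl _ continuous_on_exp_decay
            has_stochastic_integral_at_0 I]) simp_all
    then show ?thesis by (simp only: exponent_integral(3)[OF a order_refl] of_nat_0_le_iff diff_zero)
  qed
  moreover have "(\<lambda>k. exp (integral {0..} ?l - integral {real k..} ?l)) \<longlonglongrightarrow> exp (integral {0..} ?l - 0)"
    by (intro tendsto_exp tendsto_diff tendsto_const
        filterlim_compose[OF exponent_integral(2)[OF a] filterlim_real_sequentially])
  ultimately show ?thesis by (simp only: LIMSEQ_unique diff_zero)
qed

end

theorem mainTheorem2:
  fixes M :: "'a measure" and T :: "nat \<Rightarrow> 'a \<Rightarrow> nat"
    and M' :: "'b measure" and S :: "real \<Rightarrow> 'b \<Rightarrow> real"
    and a :: real and r :: "nat \<Rightarrow> real"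
  assumes "petersburg_times M T"
    and "levy_process M' S"
    and "\<And>t z. t \<ge> 0 \<Longrightarrow>
      char (distr M' borel (S t)) z = exp (complex_of_real t * petersburg_exponent z)"
    and "1 \<le> a" and "a < 2"
    and "\<And>n. r n = exp (- a / 2 ^ n)"
  shows "(\<exists>U. has_improper_stochastic_integral M' S (\<lambda>t. exp (- 2 * a * t)) U) \<and>
    (\<forall>U. has_improper_stochastic_integral M' S (\<lambda>t. exp (- 2 * a * t)) U \<longrightarrow>
      weak_conv_m
        (\<lambda>n. distr M borel (\<lambda>\<omega>. 2 * (1 - r n) * petersburg_value T (r n) \<omega> - real n))
        (distr M' borel (\<lambda>\<omega>. 2 * a * U \<omega>)))"
proof -
  interpret P: petersburg M T
    using assms(1) by (simp add: petersburg_def petersburg_axioms_def petersburg_times_def)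
  interpret L: petersburg_levy M' S
    using assms(2,3) by (simp add: petersburg_levy_def petersburg_levy_axioms_def levy_process_def)
  have a: "0 < a" using assms(4) by simp
  have "weak_conv_m
      (\<lambda>n. distr M borel (\<lambda>\<omega>. 2 * (1 - r n) * petersburg_value T (r n) \<omega> - real n))
      (distr M' borel (\<lambda>\<omega>. 2 * a * U \<omega>))"
    if U: "has_improper_stochastic_integral M' S (\<lambda>t. exp (- 2 * a * t)) U" for U
  proof (rule levy_continuity)
    have [measurable]: "U \<in> borel_measurable M'"
      using U by (simp add: has_improper_stochastic_integral_def)
    show "real_distribution (distr M borel (\<lambda>\<omega>. 2 * (1 - r n) * petersburg_value T (r n) \<omega> - real n))" for n
      by (rule P.real_distribution_distr) measurable
    show "real_distribution (distr M' borel (\<lambda>\<omega>. 2 * a * U \<omega>))"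
      by (rule L.real_distribution_distr) measurable
    fix z
    \<comment> \<open>Scaling U by 2 a moves the argument to 2 a z, the coefficient in
      \<open>discounted_exponent\<close>.\<close>
    have "char (distr M' borel (\<lambda>\<omega>. 2 * a * U \<omega>)) z = char (distr M' borel U) (2 * a * z)"
      unfolding char_def by (simp add: integral_distr mult_ac)
    also have "\<dots> = exp (integral {0..} (\<lambda>t. petersburg_exponent (2 * a * z * exp (- 2 * a * t))))"
      by (rule L.char_improper_stochastic_integral[OF a U])
    finally show "(\<lambda>n. char (distr M borel
        (\<lambda>\<omega>. 2 * (1 - r n) * petersburg_value T (r n) \<omega> - real n)) z)
        \<longlonglongrightarrow> char (distr M' borel (\<lambda>\<omega>. 2 * a * U \<omega>)) z"
      unfolding assms(6) using P.value_char_tendsto[OF assms(4,5)] by simp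
  qed
  then show ?thesis using L.improper_stochastic_integral_exists[OF a] by blast
qed

end
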